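(* Let $X,A,Q$ satisfy the assumptions (A1) and (A2) stated in the context, with exponent $\theta>0$, let $L$ be the generator of the Ornstein–Uhlenbeck semigroup $P_t$, and let $f\in C_b(X)$, $\lambda>0$. Consider the equation $$\lambda u-Lu=f.\qquad( * )$$ (a) If $1/\theta\notin\mathbb{N}$, equation $( * )$ has a unique solution $u\in C^{1/\theta}_b(X)$, and there is $C>0$, independent of $f$, such that $\|u\|_{C^{1/\theta}_b(X)}\le C\|f\|_\infty$. (b) If $1/\theta\in\mathbb{N}$, equation $( * )$ has a unique solution in $Z^{1/\theta}_b(X)$, and there is $C>0$, independent of $f$, such that $\|u\|_{Z^{1/\theta}_b(X)}\le C\|f\|_\infty$. (c) If in addition $f\in C^\alpha_b(X)$ with $\alpha\in(0,1)$ and $\alpha+1/\theta\notin\mathbb{N}$, then $u\in C^{\alpha+1/\theta}_b(X)$, and there is $C>0$, independent of $f$, such that $\|u\|_{C^{\alpha+1/\theta}_b(X)}\le C\|f\|_{C^\alpha_b(X)}$. (d) If in addition $f\in C^\alpha_b(X)$ with $\alpha\in(0,1)$ and $\alpha+1/\theta=k\in\mathbb{N}$, then $u\in Z^k_b(X)$, and there is $C>0$, independent of $f$, such that $\|u\|_{Z^k_b(X)}\le C\|f\|_{C^\alpha_b(X)}$.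
   Context: Assumptions. (A1) $X$ is a real separable (infinite dimensional) Hilbert space, $A:D(A)\subset X\to X$ is the infinitesimal generator of a strongly continuous semigroup $e^{tA}$, and $Q\in\mathcal{L}(X)$ is self-adjoint and nonnegative, such that the operators $Q_t=\int_0^te^{sA}Qe^{sA^*}ds$ have finite trace for every $t>0$; moreover $e^{tA}$ maps $X$ into $Q_t^{1/2}(X)$ for every $t>0$. (A2) There are $\omega\in\mathbb{R}$, $C,\theta>0$ such that $\|Q_t^{-1/2}e^{tA}\|_{\mathcal{L}(X)}\le Ce^{\omega t}t^{-\theta}$ for every $t>0$, where $Q_t^{-1/2}$ is the pseudo-inverse of $Q_t^{1/2}$. The operator. $P_tf(x)=\int_Xf(e^{tA}x+y)\,\mu_t(dy)$, where $\mu_t=\mathcal{N}(0,Q_t)$ is the centered Gaussian measure on $X$ with covariance $Q_t$ ($t>0$), $P_0=I$. Its generator $L$ is the unique closed operator in $C_b(X)$ with $R(\lambda,L)f(x)=\int_0^\infty e^{-\lambda t}P_tf(x)\,dt$, $\lambda>0$, $f\in C_b(X)$. The solution of $\lambda u-Lu=f$ is $u=R(\lambda,L)f$ (unique in the domain of $L$). Function spaces. $\mathbb{N}=\{1,2,\dots\}$. $C_b(X)$: bounded continuous functions $X\to\mathbb{R}$, sup norm. $\mathcal{L}^n(X)$: continuous $n$-linear forms on $X^n$ with the usual norm. $C^n_b(X)$: $f\in C_b(X)$ that are $n$ times Gateaux differentiable at every point ($D^kf:X\to\mathcal{L}^k(X)$ being the Gateaux derivative of $D^{k-1}f:X\to\mathcal{L}^{k-1}(X)$)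 with $x\mapsto D^kf(x)(h_1,\dots,h_k)$ continuous and bounded for all $k\le n$, $h_i\in X$; norm $\|f\|_\infty+\sum_{k=1}^n\sup_x\|D^kf(x)\|_{\mathcal{L}^k(X)}$. For $\sigma\in(0,1)$ and $F$ from $X$ to a Banach space, $[F]_\sigma=\sup_{x,\,h\ne0}\|F(x+h)-F(x)\|/\|h\|^\sigma$; $C^\sigma_b(X)=\{f\in C_b(X):[f]_\sigma<\infty\}$ with norm $\|f\|_\infty+[f]_\sigma$; $C^{\sigma+n}_b(X)=\{f\in C^n_b(X):[D^nf]_\sigma<\infty\}$ with norm $\|f\|_{C^n_b}+[D^nf]_\sigma$. $[F]_{Z^1}=\sup_{x,\,h\ne0}\|F(x+2h)-2F(x+h)+F(x)\|/\|h\|$; $Z^1_b(X)=\{f\in C_b(X):[f]_{Z^1}<\infty\}$ with norm $\|f\|_\infty+[f]_{Z^1}$; for $n\ge2$, $Z^n_b(X)=\{f\in C^{n-1}_b(X):[D^{n-1}f]_{Z^1}<\infty\}$ with norm $\|f\|_{C^{n-1}_b}+[D^{n-1}f]_{Z^1}$. *)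

theory Defs
  imports "HOL-Probability.Probability"
begin

text \<open>
  A real separable Hilbert space is a type of sort
  \<open>{real_inner, banach, second_countable_topology}\<close>.
\<close>

section \<open>Semigroups and their generators\<close>

definition C0_semigroup :: "(real \<Rightarrow> 'a::banach \<Rightarrow>\<^sub>L 'a) \<Rightarrow> bool" where
  "C0_semigroup T \<longleftrightarrow>
     T 0 = id_blinfun \<and>
     (\<forall>s\<ge>0. \<forall>t\<ge>0. T (s + t) = T s o\<^sub>L T t) \<and>
     (\<forall>x. continuous_on {0..} (\<lambda>t. T t x))"

text \<open>
  \<open>A\<close> is the operator and \<open>D\<close> its domain; the values of \<open>A\<close> outside \<open>D\<close> are irrelevant.
\<close>
definition infinitesimal_generator ::
    "(real \<Rightarrow> 'a::banach \<Rightarrow>\<^sub>L 'a) \<Rightarrow> 'a set \<Rightarrow> ('a \<Rightarrow> 'a) \<Rightarrow> bool" where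
  "infinitesimal_generator T D A \<longleftrightarrow>
     D = {x. \<exists>y. ((\<lambda>t. (T t x - x) /\<^sub>R t) \<longlongrightarrow> y) (at_right 0)} \<and>
     (\<forall>x\<in>D. ((\<lambda>t. (T t x - x) /\<^sub>R t) \<longlongrightarrow> A x) (at_right 0))"

section \<open>Operators on a Hilbert space\<close>

definition selfadjoint :: "('a::real_inner \<Rightarrow> 'a) \<Rightarrow> bool" where
  "selfadjoint S \<longleftrightarrow> (\<forall>x y. S x \<bullet> y = x \<bullet> S y)"

definition nonneg_op :: "('a::real_inner \<Rightarrow> 'a) \<Rightarrow> bool" where
  "nonneg_op S \<longleftrightarrow> (\<forall>x. 0 \<le> S x \<bullet> x)"

definition hilbert_basis :: "'a::real_inner set \<Rightarrow> bool" where
  "hilbert_basis B \<longleftrightarrow>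
     pairwise orthogonal B \<and> (\<forall>e\<in>B. norm e = 1) \<and> closure (span B) = UNIV"

text \<open>
  Meant for bounded nonnegative self-adjoint operators, for which the sum of the
  nonnegative numbers \<open>S e \<bullet> e\<close> does not depend on the chosen basis.
\<close>
definition finite_trace :: "('a::real_inner \<Rightarrow> 'a) \<Rightarrow> bool" where
  "finite_trace S \<longleftrightarrow> (\<exists>B. hilbert_basis B \<and> (\<lambda>e. S e \<bullet> e) summable_on B)"

definition op_sqrt :: "('a::real_inner \<Rightarrow> 'a) \<Rightarrow> 'a \<Rightarrow> 'a" where
  "op_sqrt S = (THE R. bounded_linear R \<and> selfadjoint R \<and> nonneg_op R \<and> R \<circ> R = S)"

text \<open>
  The pseudo-inverse maps \<open>y \<in> range R\<close> to the element of minimal norm in the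
  preimage \<open>R\<^sup>-\<^sup>1{y}\<close>; it is only meaningful on \<open>range R\<close>.
\<close>
definition pseudo_inverse :: "('a::real_normed_vector \<Rightarrow> 'b) \<Rightarrow> 'b \<Rightarrow> 'a" where
  "pseudo_inverse R y = (THE x. R x = y \<and> (\<forall>z. R z = y \<longrightarrow> norm x \<le> norm z))"

text \<open>\<open>Q\<^sub>t = \<integral>\<^sub>0\<^sup>t e\<^sup>s\<^sup>A Q e\<^sup>s\<^sup>A\<^sup>* ds\<close>, the integral being taken pointwise (in the strong sense).\<close>
definition Q_op ::
    "(real \<Rightarrow> 'a::{real_inner,banach} \<Rightarrow>\<^sub>L 'a) \<Rightarrow> ('a \<Rightarrow>\<^sub>L 'a) \<Rightarrow> real \<Rightarrow> 'a \<Rightarrow> 'a" where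
  "Q_op T Q t x = integral {0..t} (\<lambda>s. T s (Q (adjoint (T s) x)))"

section \<open>The standing assumptions\<close>

definition assumption_A1 ::
    "'a set \<Rightarrow> ('a \<Rightarrow> 'a) \<Rightarrow> (real \<Rightarrow> 'a::{real_inner,banach,second_countable_topology} \<Rightarrow>\<^sub>L 'a)
      \<Rightarrow> ('a \<Rightarrow>\<^sub>L 'a) \<Rightarrow> bool" where
  "assumption_A1 D A T Q \<longleftrightarrow>
     \<not> (\<exists>B. finite B \<and> span B = (UNIV :: 'a set)) \<and>
     C0_semigroup T \<and> infinitesimal_generator T D A \<and>
     selfadjoint Q \<and> nonneg_op Q \<and>
     (\<forall>t>0. finite_trace (Q_op T Q t)) \<and>
     (\<forall>t>0. range (T t) \<subseteq> range (op_sqrt (Q_op T Q t)))"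

text \<open>
  \<open>onorm\<close> is the norm of \<open>\<L>(X)\<close> for bounded linear maps only, so membership in
  \<open>\<L>(X)\<close> is stated separately.
\<close>
definition assumption_A2 ::
    "(real \<Rightarrow> 'a::{real_inner,banach} \<Rightarrow>\<^sub>L 'a) \<Rightarrow> ('a \<Rightarrow>\<^sub>L 'a) \<Rightarrow> real \<Rightarrow> bool" where
  "assumption_A2 T Q \<theta> \<longleftrightarrow>
     \<theta> > 0 \<and>
     (\<exists>\<omega> C. C > 0 \<and>
        (\<forall>t>0. bounded_linear (\<lambda>x. pseudo_inverse (op_sqrt (Q_op T Q t)) (T t x)) \<and>
               onorm (\<lambda>x. pseudo_inverse (op_sqrt (Q_op T Q t)) (T t x))
                 \<le> C * exp (\<omega> * t) * t powr (- \<theta>)))"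

section \<open>Gaussian measures and the Ornstein--Uhlenbeck semigroup\<close>

text \<open>The normal law on the real line, degenerating to a Dirac measure for \<open>\<sigma> = 0\<close>.\<close>
definition normal_law :: "real \<Rightarrow> real \<Rightarrow> real measure" where
  "normal_law m \<sigma> = (if \<sigma> = 0 then return borel m else density lborel (normal_density m \<sigma>))"

definition is_centered_gaussian ::
    "('a::{real_inner,banach,second_countable_topology}) measure \<Rightarrow> ('a \<Rightarrow> 'a) \<Rightarrow> bool" where
  "is_centered_gaussian \<mu> S \<longleftrightarrow>
     prob_space \<mu> \<and> sets \<mu> = sets borel \<and>
     (\<forall>h. \<exists>\<sigma>\<ge>0. distr \<mu> borel (\<lambda>y. y \<bullet> h) = normal_law 0 \<sigma>) \<and>
     (\<forall>h k. (\<integral>y. (y \<bullet> h) * (y \<bullet> k) \<partial>\<mu>) = S h \<bullet> k)"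

definition centered_gaussian ::
    "('a \<Rightarrow> 'a) \<Rightarrow> ('a::{real_inner,banach,second_countable_topology}) measure" where
  "centered_gaussian S = (THE \<mu>. is_centered_gaussian \<mu> S)"

definition ou_semigroup ::
    "(real \<Rightarrow> 'a::{real_inner,banach,second_countable_topology} \<Rightarrow>\<^sub>L 'a) \<Rightarrow> ('a \<Rightarrow>\<^sub>L 'a)
      \<Rightarrow> real \<Rightarrow> ('a \<Rightarrow> real) \<Rightarrow> 'a \<Rightarrow> real" where
  "ou_semigroup T Q t f x =
     (if t = 0 then f x else \<integral>y. f (T t x + y) \<partial>centered_gaussian (Q_op T Q t))"

text \<open>Unbounded operators are represented by their graphs.\<close>
definition closed_operator :: "('b::real_normed_vector \<times> 'b) set \<Rightarrow> bool" where
  "closed_operator L \<longleftrightarrow> subspace L \<and> single_valued L \<and> closed L"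

text \<open>\<open>lam\<close> is in the resolvent set of \<open>L\<close> and \<open>R = (lam I - L)\<^sup>-\<^sup>1\<close>.\<close>
definition is_resolvent :: "('b::real_normed_vector \<times> 'b) set \<Rightarrow> real \<Rightarrow> ('b \<Rightarrow> 'b) \<Rightarrow> bool" where
  "is_resolvent L lam R \<longleftrightarrow>
     bounded_linear R \<and>
     (\<forall>f. (R f, lam *\<^sub>R R f - f) \<in> L) \<and>
     (\<forall>(u, g) \<in> L. R (lam *\<^sub>R u - g) = u)"

text \<open>\<open>C\<^sub>b(X)\<close> is the Banach space \<^typ>\<open>'a \<Rightarrow>\<^sub>C real\<close> with the sup norm.\<close>
definition ou_generator ::
    "(real \<Rightarrow> 'a::{real_inner,banach,second_countable_topology} \<Rightarrow>\<^sub>L 'a) \<Rightarrow> ('a \<Rightarrow>\<^sub>L 'a)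
      \<Rightarrow> (('a \<Rightarrow>\<^sub>C real) \<times> ('a \<Rightarrow>\<^sub>C real)) set" where
  "ou_generator T Q =
     (THE L. closed_operator L \<and>
        (\<forall>lam>0. \<exists>R. is_resolvent L lam R \<and>
           (\<forall>f x. apply_bcontfun (R f) x =
             (LBINT t:{0..}. exp (- lam * t) * ou_semigroup T Q t (apply_bcontfun f) x))))"

text \<open>\<open>u \<in> D(L)\<close> and \<open>lam u - L u = f\<close>.\<close>
definition solves :: "('b::real_normed_vector \<times> 'b) set \<Rightarrow> real \<Rightarrow> 'b \<Rightarrow> 'b \<Rightarrow> bool" where
  "solves L lam f u \<longleftrightarrow> (\<exists>g. (u, g) \<in> L \<and> lam *\<^sub>R u - g = f)"

section \<open>Multilinear forms and iterated Gateaux derivatives\<close>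

text \<open>
  A \<open>k\<close>-linear form is a real function on lists, of which only the values on lists of
  length \<open>k\<close> matter; \<open>0\<close>-linear forms are the real numbers. Norms and seminorms take
  values in \<^typ>\<open>ennreal\<close>, so that finiteness is a condition rather than a convention.
\<close>
definition form_norm :: "nat \<Rightarrow> ('a::real_normed_vector list \<Rightarrow> real) \<Rightarrow> ennreal" where
  "form_norm k F =
     (SUP hs \<in> {hs. length hs = k \<and> (\<forall>h\<in>set hs. norm h \<le> 1)}. ennreal \<bar>F hs\<bar>)"

definition continuous_form :: "nat \<Rightarrow> ('a::real_normed_vector list \<Rightarrow> real) \<Rightarrow> bool" where
  "continuous_form k F \<longleftrightarrow>
     (\<forall>hs i. length hs = k \<and> i < k \<longrightarrow> linear (\<lambda>h. F (hs[i := h]))) \<and>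
     form_norm k F < \<infinity>"

text \<open>
  \<open>iter_deriv f [h\<^sub>1, \<dots>, h\<^sub>k] x\<close> is \<open>D\<^sup>kf(x)(h\<^sub>1, \<dots>, h\<^sub>k)\<close>, where \<open>h\<^sub>1\<close> is the direction of the
  outermost derivative. It is meaningful under \<open>gateaux_differentiable\<close> below, where the
  directional limits exist in the norm of the space of forms.
\<close>
primrec iter_deriv :: "('a::real_normed_vector \<Rightarrow> real) \<Rightarrow> 'a list \<Rightarrow> 'a \<Rightarrow> real" where
  "iter_deriv f [] = f"
| "iter_deriv f (h # hs) =
     (\<lambda>x. Lim (at 0) (\<lambda>t. (iter_deriv f hs (x + t *\<^sub>R h) - iter_deriv f hs x) / t))"

abbreviation D_form :: "('a::real_normed_vector \<Rightarrow> real) \<Rightarrow> 'a \<Rightarrow> 'a list \<Rightarrow> real" where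
  "D_form f x \<equiv> (\<lambda>hs. iter_deriv f hs x)"

text \<open>
  \<open>D\<^sup>kf : X \<rightarrow> \<L>\<^sup>k(X)\<close> is Gateaux differentiable at every point with derivative
  \<open>D\<^sup>k\<^sup>+\<^sup>1f : X \<rightarrow> \<L>\<^sup>k\<^sup>+\<^sup>1(X)\<close>, for all \<open>k < n\<close>. The spaces \<open>\<L>(X, \<L>\<^sup>k(X))\<close> and \<open>\<L>\<^sup>k\<^sup>+\<^sup>1(X)\<close>
  are identified.
\<close>
definition gateaux_differentiable :: "nat \<Rightarrow> ('a::real_normed_vector \<Rightarrow> real) \<Rightarrow> bool" where
  "gateaux_differentiable n f \<longleftrightarrow>
     (\<forall>k<n. \<forall>x.
        continuous_form (Suc k) (D_form f x) \<and>
        (\<forall>h. ((\<lambda>t. form_norm k (\<lambda>hs.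
                 (D_form f (x + t *\<^sub>R h) hs - D_form f x hs) / t - D_form f x (h # hs)))
               \<longlongrightarrow> 0) (at 0)))"

section \<open>Function spaces\<close>

definition Cb :: "nat \<Rightarrow> ('a::real_normed_vector \<Rightarrow>\<^sub>C real) set" where
  "Cb n = {f :: 'a \<Rightarrow>\<^sub>C real. gateaux_differentiable n f \<and>
              (\<forall>hs. length hs \<le> n \<longrightarrow>
                 continuous_on UNIV (iter_deriv f hs) \<and> bounded (range (iter_deriv f hs)))}"

definition Cb_norm :: "nat \<Rightarrow> ('a::real_normed_vector \<Rightarrow>\<^sub>C real) \<Rightarrow> ennreal" where
  "Cb_norm n f = ennreal (norm f) + (\<Sum>k=1..n. SUP x. form_norm k (D_form f x))"

text \<open>The seminorms of maps \<open>F : X \<rightarrow> \<L>\<^sup>k(X)\<close>.\<close>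
definition holder_seminorm ::
    "nat \<Rightarrow> real \<Rightarrow> ('a::real_normed_vector \<Rightarrow> 'a list \<Rightarrow> real) \<Rightarrow> ennreal" where
  "holder_seminorm k \<sigma> F =
     (SUP x. SUP h \<in> - {0}.
        form_norm k (\<lambda>hs. F (x + h) hs - F x hs) / ennreal (norm h powr \<sigma>))"

definition zygmund_seminorm ::
    "nat \<Rightarrow> ('a::real_normed_vector \<Rightarrow> 'a list \<Rightarrow> real) \<Rightarrow> ennreal" where
  "zygmund_seminorm k F =
     (SUP x. SUP h \<in> - {0}.
        form_norm k (\<lambda>hs. F (x + 2 *\<^sub>R h) hs - 2 * F (x + h) hs + F x hs) / ennreal (norm h))"

text \<open>
  \<open>C\<^sub>b\<^sup>s(X)\<close> for a positive noninteger \<open>s = n + \<sigma>\<close>, where \<open>n = \<lfloor>s\<rfloor>\<close> and \<open>\<sigma> = frac s \<in> (0,1)\<close>.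
\<close>
definition Holder :: "real \<Rightarrow> ('a::real_normed_vector \<Rightarrow>\<^sub>C real) set" where
  "Holder s = {f \<in> Cb (nat \<lfloor>s\<rfloor>). holder_seminorm (nat \<lfloor>s\<rfloor>) (frac s) (D_form f) < \<infinity>}"

definition Holder_norm :: "real \<Rightarrow> ('a::real_normed_vector \<Rightarrow>\<^sub>C real) \<Rightarrow> ennreal" where
  "Holder_norm s f = Cb_norm (nat \<lfloor>s\<rfloor>) f + holder_seminorm (nat \<lfloor>s\<rfloor>) (frac s) (D_form f)"

text \<open>\<open>Z\<^sub>b\<^sup>n(X)\<close> for \<open>n \<ge> 1\<close>; for \<open>n = 1\<close> note that \<open>Cb 0\<close> is all of \<open>C\<^sub>b(X)\<close>.\<close>
definition Zygmund :: "nat \<Rightarrow> ('a::real_normed_vector \<Rightarrow>\<^sub>C real) set" where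
  "Zygmund n = {f \<in> Cb (n - 1). zygmund_seminorm (n - 1) (D_form f) < \<infinity>}"

definition Zygmund_norm :: "nat \<Rightarrow> ('a::real_normed_vector \<Rightarrow>\<^sub>C real) \<Rightarrow> ennreal" where
  "Zygmund_norm n f = Cb_norm (n - 1) f + zygmund_seminorm (n - 1) (D_form f)"

end

theory Submission
  imports Defs
begin

text \<open>
  Put \<open>z = Q\<^sub>t\<^sup>-\<^sup>1\<^sup>/\<^sup>2 e\<^sup>t\<^sup>A h\<close>. The Gaussian measure \<open>\<mu>\<^sub>t\<close> is the law of \<open>\<xi> Q\<^sub>t\<^sup>1\<^sup>/\<^sup>2 z / \<parallel>z\<parallel> + Y\<close> with \<open>\<xi>\<close>
  standard normal and independent of \<open>Y\<close>, so moving \<open>x\<close> in the direction \<open>h\<close> amounts to shifting \<open>\<xi>\<close>.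
  Hence \<open>P\<^sub>t f\<close> is differentiable in the direction \<open>h\<close> with derivative bounded by
  \<open>\<parallel>z\<parallel> \<parallel>f\<parallel> \<le> C t\<^sup>-\<^sup>\<theta> \<parallel>h\<parallel> \<parallel>f\<parallel>\<close> for \<open>t \<le> 1\<close>. Since the derivative of \<open>P\<^sub>s g\<close> along \<open>h\<close> is \<open>P\<^sub>s\<close> applied to the
  derivative of \<open>g\<close> along \<open>e\<^sup>s\<^sup>A h\<close>, splitting the time by the semigroup law bounds \<open>D\<^sup>n P\<^sub>t f\<close> by
  \<open>C t\<^sup>-\<^sup>n\<^sup>\<theta> \<parallel>f\<parallel>\<close>. A function \<open>f\<close> in \<open>C\<^sup>\<alpha>\<close> is within \<open>O(\<epsilon>\<^sup>\<alpha>)\<close> of a function with Lipschitz constant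
  \<open>O(\<epsilon>\<^sup>\<alpha>\<^sup>-\<^sup>1)\<close>; taking \<open>\<epsilon> = t\<^sup>\<theta>\<close> improves the bound to \<open>C t\<^sup>-\<^sup>(\<^sup>n\<^sup>-\<^sup>\<alpha>\<^sup>)\<^sup>\<theta>\<close>.

  The solution is the Laplace transform of \<open>P\<^sub>t f\<close>. In the integral of the first (for Hoelder) or second
  (for Zygmund) differences of \<open>D\<^sup>n P\<^sub>t f\<close> with increment \<open>h\<close>, one bounds the integrand through \<open>D\<^sup>n\<close> for
  \<open>t \<le> \<parallel>h\<parallel>\<^sup>1\<^sup>/\<^sup>\<theta>\<close> and through \<open>D\<^sup>n\<^sup>+\<^sup>1\<close> or \<open>D\<^sup>n\<^sup>+\<^sup>2\<close> for larger \<open>t\<close>; both parts have the required order in \<open>\<parallel>h\<parallel>\<close>.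
\<close>

section \<open>Hilbert space preliminaries\<close>

text \<open>The square root, the Gaussian measure and the generator are definite descriptions, so
  each needs existence and uniqueness before any estimate makes sense: a fixed-point iteration, a
  random series with characteristic functions, and the resolvent identity with injectivity. The
  smoothing bound enters for t \<le> 1 only. For larger t, \<open>P t f = P 1 (P (t - 1) f)\<close>
  keeps all derivatives bounded, so the growth rate \<omega> disappears and every \<lambda> > 0 is
  admissible. All four claims are one estimate with a parameter \<beta>, equal to 0 for bounded and
  to \<alpha> for Hoelder data. The order-k bound t^(-(k - \<beta>) \<theta>) is integrable near 0
  exactly for k < \<beta> + 1/\<theta>, which fixes how often the time integral may be
  differentiated. If \<beta> + 1/\<theta> = k is an integer, the power at order k is 1/t, integrable
  neither at 0 nor at infinity; order k + 1 restores convergence at infinity, and what it controls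
  is a second difference of D^(k-1) u, hence the Zygmund spaces.\<close>

lemma min_norm_exists:
  fixes C :: "'a::{real_inner,banach} set"
  assumes cl: "closed C" and cv: "convex C" and ne: "C \<noteq> {}"
  shows "\<exists>!x. x \<in> C \<and> (\<forall>z\<in>C. norm x \<le> norm z)"
proof -
  define d where "d = Inf (norm ` C)"
  have bdd: "bdd_below (norm ` C)" by (auto intro!: bdd_belowI[of _ 0])
  have dle: "d \<le> norm x" if "x \<in> C" for x
    unfolding d_def using that by (intro cInf_lower bdd) auto
  have d0: "0 \<le> d" unfolding d_def using ne by (intro cInf_greatest) auto
  \<comment> \<open>The midpoint lies in \<open>C\<close>, so its norm is at least \<open>d\<close>;
    the parallelogram identity then bounds distances by the excess of the norms over
    \<open>d\<close>. This one inequality makes minimising sequences Cauchy and the minimiser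
    unique.\<close>
  have par: "(norm (x - y))\<^sup>2 \<le> 2 * (norm x)\<^sup>2 + 2 * (norm y)\<^sup>2 - 4 * d\<^sup>2" if "x \<in> C" "y \<in> C" for x y
  proof -
    have "(1/2) *\<^sub>R x + (1/2) *\<^sub>R y \<in> C"
      using convexD[OF cv that, of "1/2" "1/2"] by simp
    then have "d \<le> norm ((1/2) *\<^sub>R x + (1/2) *\<^sub>R y)" by (rule dle)
    also have "\<dots> = norm (x + y) / 2"
    proof -
      have "(1/2) *\<^sub>R x + (1/2) *\<^sub>R y = (1/2) *\<^sub>R (x + y)" by (simp add: scaleR_add_right)
      then show ?thesis by (simp only: norm_scaleR)
    qed
    finally have "(2 * d)\<^sup>2 \<le> (norm (x + y))\<^sup>2"
      using d0 by (intro power_mono) auto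
    moreover have "(norm (x + y))\<^sup>2 + (norm (x - y))\<^sup>2 = 2 * (norm x)\<^sup>2 + 2 * (norm y)\<^sup>2"
      by (simp add: power2_norm_eq_inner inner_simps)
    ultimately show ?thesis by (simp add: power_mult_distrib)
  qed
  have "\<exists>x\<in>C. norm x < d + inverse (Suc n)" for n
  proof -
    have "\<exists>y\<in>norm ` C. y < d + inverse (Suc n)"
      using ne unfolding d_def by (subst cInf_less_iff[symmetric]) (auto simp: bdd)
    then show ?thesis by auto
  qed
  then obtain X where X: "\<And>n. X n \<in> C" "\<And>n. norm (X n) < d + inverse (Suc n)" by metis
  have sm: "(norm (X n))\<^sup>2 - d\<^sup>2 \<le> (2 * d + 1) * inverse (Suc n)" for n
  proof -
    have "(norm (X n))\<^sup>2 \<le> (d + inverse (Suc n))\<^sup>2"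
      using X(2)[of n] by (intro power_mono) auto
    also have "\<dots> = d\<^sup>2 + (2 * d + inverse (Suc n)) * inverse (Suc n)"
      by (simp add: power2_eq_square algebra_simps)
    also have "\<dots> \<le> d\<^sup>2 + (2 * d + 1) * inverse (Suc n)"
      by (intro add_left_mono mult_right_mono) (auto simp: field_simps)
    finally show ?thesis by simp
  qed
  have "Cauchy X"
  proof (rule metric_CauchyI)
    fix e :: real assume e: "0 < e"
    have "(\<lambda>n. (2 * d + 1) * inverse (real (Suc n))) \<longlonglongrightarrow> (2 * d + 1) * 0"
      by (intro tendsto_mult tendsto_const LIMSEQ_inverse_real_of_nat)
    then have "eventually (\<lambda>n. (2 * d + 1) * inverse (real (Suc n)) < e\<^sup>2 / 4) sequentially"
      using e by (intro order_tendstoD) auto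
    then obtain N where N: "\<And>n. n \<ge> N \<Longrightarrow> (2 * d + 1) * inverse (real (Suc n)) < e\<^sup>2 / 4"
      by (auto simp: eventually_sequentially)
    have "dist (X m) (X n) < e" if "m \<ge> N" "n \<ge> N" for m n
    proof -
      have "(norm (X m - X n))\<^sup>2 < e\<^sup>2"
        using par[OF X(1) X(1), of m n] sm[of m] sm[of n] N[OF that(1)] N[OF that(2)] by linarith
      then show ?thesis using e by (simp add: dist_norm power2_less_imp_less)
    qed
    then show "\<exists>M. \<forall>m\<ge>M. \<forall>n\<ge>M. dist (X m) (X n) < e" by blast
  qed
  then obtain x where x: "X \<longlonglongrightarrow> x" using Cauchy_convergent_iff convergent_def by blast
  have xC: "x \<in> C" using cl X(1) x by (metis closed_sequentially)
  have "norm x \<le> d"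
  proof (rule LIMSEQ_le[OF tendsto_norm[OF x]])
    show "(\<lambda>n. d + inverse (real (Suc n))) \<longlonglongrightarrow> d"
      using tendsto_add[OF tendsto_const LIMSEQ_inverse_real_of_nat, of d] by simp
    show "\<exists>N. \<forall>n\<ge>N. norm (X n) \<le> d + inverse (real (Suc n))"
      using X(2) less_imp_le by blast
  qed
  then have nx: "norm x = d" using dle[OF xC] by simp
  show ?thesis
  proof (rule ex1I[of _ x])
    show "x \<in> C \<and> (\<forall>z\<in>C. norm x \<le> norm z)" using xC nx dle by auto
    fix y assume y: "y \<in> C \<and> (\<forall>z\<in>C. norm y \<le> norm z)"
    then have "norm y = d" using nx xC dle[of y] by force
    then have "(norm (x - y))\<^sup>2 \<le> 0" using par[OF xC, of y] y nx by simp
    then show "y = x" by simp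
  qed
qed

text \<open>First-order condition at a minimum: the chosen \<open>s\<close> minimises the square of
  norm (w + s m), and the minimal value lies below that of \<open>w\<close> by (w . m)^2 / (m .
  m).\<close>

lemma min_norm_orthogonal:
  fixes w m :: "'a::real_inner"
  assumes "\<And>s. norm w \<le> norm (w + s *\<^sub>R m)"
  shows "w \<bullet> m = 0"
proof (cases "m = 0")
  case False
  define s where "s = - (w \<bullet> m) / (m \<bullet> m)"
  have mm: "m \<bullet> m > 0" using False by simp
  have "(norm w)\<^sup>2 \<le> (norm (w + s *\<^sub>R m))\<^sup>2" by (intro power_mono assms) auto
  also have "\<dots> = (norm w)\<^sup>2 + 2 * s * (w \<bullet> m) + s\<^sup>2 * (m \<bullet> m)"
    unfolding power2_norm_eq_inner
    by (simp add: inner_simps inner_commute[of m w] power2_eq_square algebra_simps)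
  also have "\<dots> = (norm w)\<^sup>2 - (w \<bullet> m)\<^sup>2 / (m \<bullet> m)"
    using mm by (simp add: s_def field_simps power2_eq_square)
  finally have "(w \<bullet> m)\<^sup>2 / (m \<bullet> m) \<le> 0" by simp
  then show ?thesis using mm by (simp add: divide_le_0_iff)
qed simp

text \<open>Projection theorem in contrapositive form: for \<open>x\<close> outside
  \<open>M\<close>, the element of least norm in x + M is orthogonal to \<open>M\<close>, hence 0,
  which puts \<open>x\<close> into \<open>M\<close>.\<close>

lemma closed_subspace_eq_UNIV:
  fixes M :: "'a::{real_inner,banach} set"
  assumes cl: "closed M" and sub: "subspace M" and triv: "\<And>w. (\<And>m. m \<in> M \<Longrightarrow> w \<bullet> m = 0) \<Longrightarrow> w = 0"
  shows "M = UNIV"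
proof (rule ccontr)
  assume "M \<noteq> UNIV"
  then obtain x where x: "x \<notin> M" by auto
  have "\<exists>!w. w \<in> (+) x ` M \<and> (\<forall>z\<in>(+) x ` M. norm w \<le> norm z)"
    using sub by (intro min_norm_exists closed_translation cl convex_translation)
      (auto simp: subspace_imp_convex dest: subspace_0)
  then obtain m where m: "m \<in> M" "\<And>z. z \<in> M \<Longrightarrow> norm (x + m) \<le> norm (x + z)" by auto
  have "(x + m) \<bullet> k = 0" if "k \<in> M" for k
  proof (rule min_norm_orthogonal)
    fix s :: real
    have "m + s *\<^sub>R k \<in> M" using sub m that by (simp add: subspace_add subspace_scale)
    then show "norm (x + m) \<le> norm (x + m + s *\<^sub>R k)" using m(2)[of "m + s *\<^sub>R k"] by (simp add: add.assoc)
  qed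
  then have "x + m = 0" by (rule triv)
  then have "x = - m" by (simp add: eq_neg_iff_add_eq_0)
  then show False using x m(1) sub by (simp add: subspace_neg)
qed

text \<open>The vector \<open>z\<close> of least norm on the hyperplane f = 1 is orthogonal to the
  kernel of \<open>f\<close>; splitting off the component along \<open>z\<close> gives the
  representing vector z / (z . z).\<close>

lemma riesz_representation:
  fixes f :: "'a::{real_inner,banach} \<Rightarrow> real"
  assumes f: "bounded_linear f"
  shows "\<exists>y. \<forall>x. f x = x \<bullet> y"
proof (cases "\<forall>x. f x = 0")
  case False
  interpret f: bounded_linear f by fact
  obtain a where a: "f a \<noteq> 0" using False by auto
  have cl: "closed {x. f x = 1}"
    by (intro closed_Collect_eq continuous_intros f.continuous_on)
  have "\<exists>!x. x \<in> {x. f x = 1} \<and> (\<forall>z\<in>{x. f x = 1}. norm x \<le> norm z)"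
  proof (rule min_norm_exists[OF cl])
    show "convex {x. f x = 1}" by (auto simp: convex_def f.add f.scaleR)
    have "f (inverse (f a) *\<^sub>R a) = 1" using a by (simp add: f.scaleR)
    then show "{x. f x = 1} \<noteq> {}" by blast
  qed
  then obtain z where z: "f z = 1" "\<And>y. f y = 1 \<Longrightarrow> norm z \<le> norm y" by auto
  have orth: "z \<bullet> k = 0" if "f k = 0" for k
    by (rule min_norm_orthogonal) (auto intro!: z(2) simp: f.add f.scaleR z that)
  have zz: "z \<bullet> z \<noteq> 0" using z(1) f.zero by auto
  have "f x = x \<bullet> (inverse (z \<bullet> z) *\<^sub>R z)" for x
  proof -
    have "z \<bullet> (x - f x *\<^sub>R z) = 0" by (rule orth) (simp add: f.diff f.scaleR z)
    then have "x \<bullet> z = f x * (z \<bullet> z)" by (simp add: inner_simps inner_commute)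
    then show ?thesis using zz by simp
  qed
  then show ?thesis by blast
qed (auto intro: exI[of _ 0])

text \<open>\<open>adjoint\<close> is defined by choice; Riesz representation supplies the map that
  makes the choice meaningful in infinite dimension.\<close>

lemma bounded_linear_inner_adjoint:
  fixes F :: "'a::{real_inner,banach} \<Rightarrow> 'b::real_inner"
  assumes "bounded_linear F"
  shows "x \<bullet> adjoint F y = F x \<bullet> y"
proof -
  have "\<exists>w. \<forall>x. F x \<bullet> y = x \<bullet> w" for y
    using riesz_representation[OF bounded_linear_compose[OF bounded_linear_inner_left assms]] by simp
  then obtain g where "\<And>y x. F x \<bullet> y = x \<bullet> g y" by metis
  then have "\<exists>g. \<forall>x y. F x \<bullet> y = x \<bullet> g y" by blast
  then have "\<forall>x y. F x \<bullet> y = x \<bullet> adjoint F y" unfolding adjoint_def by (rule someI_ex)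
  then show ?thesis by simp
qed

lemma inner_eq_imp_eq:
  fixes x y :: "'a::real_inner"
  assumes "\<And>z. x \<bullet> z = y \<bullet> z"
  shows "x = y"
proof -
  have "(x - y) \<bullet> (x - y) = 0" using assms[of "x - y"] by (simp add: inner_diff_left)
  then show ?thesis by simp
qed

lemma norm_adjoint_le:
  fixes F :: "'a::{real_inner,banach} \<Rightarrow> 'b::real_inner"
  assumes F: "bounded_linear F"
  shows "norm (adjoint F y) \<le> onorm F * norm y"
proof (cases "adjoint F y = 0")
  case True
  then show ?thesis using onorm_pos_le[OF F] by simp
next
  case False
  have "(norm (adjoint F y))\<^sup>2 = F (adjoint F y) \<bullet> y"
    by (simp add: power2_norm_eq_inner bounded_linear_inner_adjoint[OF F])
  also have "\<dots> \<le> norm (F (adjoint F y)) * norm y" by (rule norm_cauchy_schwarz)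
  also have "\<dots> \<le> onorm F * norm (adjoint F y) * norm y"
    by (intro mult_right_mono onorm F) auto
  finally show ?thesis using False by (simp add: power2_eq_square)
qed

lemma bounded_linear_adjoint:
  fixes F :: "'a::{real_inner,banach} \<Rightarrow> 'b::real_inner"
  assumes F: "bounded_linear F"
  shows "bounded_linear (adjoint F)"
proof (rule bounded_linear_intro)
  note [simp] = bounded_linear_inner_adjoint[OF F]
  show "adjoint F (x + y) = adjoint F x + adjoint F y" for x y
    by (rule inner_eq_imp_eq) (simp add: inner_simps inner_commute[of "adjoint F _"] inner_commute[of _ "F _"])
  show "adjoint F (r *\<^sub>R x) = r *\<^sub>R adjoint F x" for r x
    by (rule inner_eq_imp_eq) (simp add: inner_simps inner_commute[of "adjoint F _"] inner_commute[of _ "F _"])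
  show "norm (adjoint F x) \<le> norm x * onorm F" for x
    using norm_adjoint_le[OF F, of x] by (simp add: mult.commute)
qed

section \<open>Orthonormal bases and Parseval's identity\<close>

text \<open>Distinct basis vectors are at distance sqrt 2, so the balls of radius 1/2 around them
  are disjoint, and separability allows only countably many disjoint nonempty open sets.\<close>

lemma hilbert_basis_countable:
  fixes B :: "'a::{real_inner,second_countable_topology} set"
  assumes "hilbert_basis B"
  shows "countable B"
proof -
  have d: "dist e e' > 1" if "e \<in> B" "e' \<in> B" "e \<noteq> e'" for e e'
  proof -
    have "e \<bullet> e' = 0" "norm e = 1" "norm e' = 1"
      using assms that by (auto simp: hilbert_basis_def pairwise_def orthogonal_def)
    then have "(dist e e')\<^sup>2 = 2"
      by (simp add: dist_norm power2_norm_eq_inner inner_simps inner_commute norm_eq_1)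
    then have "1\<^sup>2 < (dist e e')\<^sup>2" by simp
    then show ?thesis by (rule power2_less_imp_less) simp
  qed
  have inj: "inj_on (\<lambda>e. ball e (1/2)) B"
  proof (rule inj_onI)
    fix e e' assume *: "e \<in> B" "e' \<in> B" "ball e (1/2) = ball e' (1/2)"
    have "e \<in> ball e' (1/2)" using *(3)[symmetric] by simp
    then show "e = e'" using d[OF *(1,2)] by (force simp: dist_commute)
  qed
  have "pairwise disjnt ((\<lambda>e. ball e (1/2)) ` B)"
  proof (clarsimp simp: pairwise_def disjnt_iff)
    fix e e' z assume *: "e \<in> B" "e' \<in> B" "ball e (1/2) \<noteq> ball e' (1/2)" "dist e z * 2 < 1" "dist e' z * 2 < 1"
    then have "e \<noteq> e'" by auto
    then have "dist e e' > 1" using d * by blast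
    then show False using * dist_triangle2[of e e' z] by linarith
  qed
  then have "countable ((\<lambda>e. ball e (1/2)) ` B)"
    by (intro countable_disjoint_open_subsets) auto
  then show ?thesis using inj countable_image_inj_on by blast
qed

lemma orthonormal_approximation:
  fixes e :: "'a::real_inner"
  assumes fin: "finite F" and orth: "pairwise orthogonal F" and unit: "\<And>e. e \<in> F \<Longrightarrow> norm e = 1"
  shows "(norm (x - (\<Sum>e\<in>F. (e \<bullet> x) *\<^sub>R e)))\<^sup>2 = (norm x)\<^sup>2 - (\<Sum>e\<in>F. (e \<bullet> x)\<^sup>2)"
    and "norm (x - (\<Sum>e\<in>F. (e \<bullet> x) *\<^sub>R e)) \<le> norm (x - (\<Sum>e\<in>F. c e *\<^sub>R e))"
proof -
  have ee: "e \<bullet> e' = (if e = e' then 1 else 0)" if "e \<in> F" "e' \<in> F" for e e'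
    using that orth unit by (auto simp: pairwise_def orthogonal_def norm_eq_1)
  have sq: "(norm (\<Sum>e\<in>F. c e *\<^sub>R e))\<^sup>2 = (\<Sum>e\<in>F. (c e)\<^sup>2)" for c
  proof -
    have "(norm (\<Sum>e\<in>F. c e *\<^sub>R e))\<^sup>2 = (\<Sum>e\<in>F. \<Sum>e'\<in>F. c e * c e' * (e \<bullet> e'))"
      by (simp add: power2_norm_eq_inner inner_sum_left inner_sum_right algebra_simps inner_commute)
    also have "\<dots> = (\<Sum>e\<in>F. \<Sum>e'\<in>F. if e = e' then (c e)\<^sup>2 else 0)"
      by (intro sum.cong refl) (auto simp: ee power2_eq_square)
    finally show ?thesis using fin by (simp add: sum.delta)
  qed
  \<comment> \<open>Completing the square coefficient by coefficient. The Fourier coefficients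
    annihilate the last sum, which yields both the error formula and their optimality.\<close>
  have gen: "(norm (x - (\<Sum>e\<in>F. c e *\<^sub>R e)))\<^sup>2 = (norm x)\<^sup>2 - (\<Sum>e\<in>F. (e \<bullet> x)\<^sup>2) + (\<Sum>e\<in>F. (c e - e \<bullet> x)\<^sup>2)" for c
  proof -
    have "(norm (x - (\<Sum>e\<in>F. c e *\<^sub>R e)))\<^sup>2
        = (norm x)\<^sup>2 - 2 * (x \<bullet> (\<Sum>e\<in>F. c e *\<^sub>R e)) + (norm (\<Sum>e\<in>F. c e *\<^sub>R e))\<^sup>2"
      by (simp add: power2_norm_eq_inner inner_diff_left inner_diff_right inner_commute)
    also have "\<dots> = (norm x)\<^sup>2 - 2 * (\<Sum>e\<in>F. c e * (e \<bullet> x)) + (\<Sum>e\<in>F. (c e)\<^sup>2)"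
      by (simp add: sq inner_sum_right inner_commute)
    also have "\<dots> = (norm x)\<^sup>2 - (\<Sum>e\<in>F. (e \<bullet> x)\<^sup>2) + (\<Sum>e\<in>F. (c e - e \<bullet> x)\<^sup>2)"
      by (simp add: power2_diff sum.distrib sum_subtractf sum_distrib_left algebra_simps)
    finally show ?thesis .
  qed
  show *: "(norm (x - (\<Sum>e\<in>F. (e \<bullet> x) *\<^sub>R e)))\<^sup>2 = (norm x)\<^sup>2 - (\<Sum>e\<in>F. (e \<bullet> x)\<^sup>2)"
    using gen[of "\<lambda>e. e \<bullet> x"] by simp
  show "norm (x - (\<Sum>e\<in>F. (e \<bullet> x) *\<^sub>R e)) \<le> norm (x - (\<Sum>e\<in>F. c e *\<^sub>R e))"
    by (rule power2_le_imp_le) (simp_all add: * gen sum_nonneg)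
qed

text \<open>Density of the span gives one finite combination within sqrt \<epsilon> of
  \<open>x\<close>. Over every larger finite set the Fourier sum is at least as close, which is
  convergence along \<open>finite_subsets_at_top\<close>.\<close>

lemma hilbert_basis_parseval:
  fixes B :: "'a::real_inner set"
  assumes B: "hilbert_basis B"
  shows "((\<lambda>e. (e \<bullet> x)\<^sup>2) has_sum (norm x)\<^sup>2) B"
proof -
  have orth: "pairwise orthogonal F" "\<And>e. e \<in> F \<Longrightarrow> norm e = 1" if "F \<subseteq> B" for F
    using B that pairwise_subset unfolding hilbert_basis_def by blast+
  have "\<forall>\<^sub>F F in finite_subsets_at_top B. dist (\<Sum>e\<in>F. (e \<bullet> x)\<^sup>2) ((norm x)\<^sup>2) < \<epsilon>" if eps: "\<epsilon> > 0" for \<epsilon>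
  proof -
    have "x \<in> closure (span B)" using B by (simp add: hilbert_basis_def)
    then obtain y where y: "y \<in> span B" "dist y x < sqrt \<epsilon>"
      using eps by (metis closure_approachable real_sqrt_gt_zero)
    then obtain F0 c where F0: "finite F0" "F0 \<subseteq> B" "y = (\<Sum>e\<in>F0. c e *\<^sub>R e)"
      by (auto simp: span_explicit)
    have "dist (\<Sum>e\<in>F. (e \<bullet> x)\<^sup>2) ((norm x)\<^sup>2) < \<epsilon>" if F: "finite F" "F \<subseteq> B" "F0 \<subseteq> F" for F
    proof -
      define c' where "c' e = (if e \<in> F0 then c e else 0)" for e
      have y': "y = (\<Sum>e\<in>F. c' e *\<^sub>R e)"
        unfolding F0(3) c'_def using F F0 by (intro sum.mono_neutral_cong_left) auto
      have "(norm (x - (\<Sum>e\<in>F. (e \<bullet> x) *\<^sub>R e)))\<^sup>2 \<le> (norm (x - y))\<^sup>2"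
        unfolding y' using F by (intro power_mono orthonormal_approximation(2) orth) auto
      also have "\<dots> < (sqrt \<epsilon>)\<^sup>2"
        using y(2) by (intro power_strict_mono) (auto simp: dist_norm norm_minus_commute)
      finally have "(norm x)\<^sup>2 - (\<Sum>e\<in>F. (e \<bullet> x)\<^sup>2) < \<epsilon>"
        using orthonormal_approximation(1)[OF F(1) orth[OF F(2)], of x] eps by simp
      moreover have "(norm x)\<^sup>2 - (\<Sum>e\<in>F. (e \<bullet> x)\<^sup>2) \<ge> 0"
        using orthonormal_approximation(1)[OF F(1) orth[OF F(2)], of x] by (metis zero_le_power2)
      ultimately show ?thesis by (simp add: dist_real_def)
    qed
    then show ?thesis
      unfolding eventually_finite_subsets_at_top using F0 by blast
  qed
  then show ?thesis unfolding has_sum_def by (rule tendstoI)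
qed

text \<open>Weaker than an orthonormal basis enumerated by \<open>nat\<close>: Parseval's identity
  is all that is kept, so zero vectors may fill indices that no basis vector occupies.\<close>

definition parseval_frame :: "(nat \<Rightarrow> 'a::real_inner) \<Rightarrow> bool" where
  "parseval_frame e \<longleftrightarrow> (\<forall>x. (\<lambda>n. (e n \<bullet> x)\<^sup>2) sums (norm x)\<^sup>2)"

lemma finite_trace_frame:
  fixes S :: "'a::{real_inner,second_countable_topology} \<Rightarrow> 'a"
  assumes "finite_trace S" and S0: "S 0 = 0"
  obtains e where "parseval_frame e" and "summable (\<lambda>n::nat. S (e n) \<bullet> e n)"
proof -
  obtain B where B: "hilbert_basis B" and sB: "(\<lambda>e. S e \<bullet> e) summable_on B"
    using assms by (auto simp: finite_trace_def)
  have cB: "countable B" by (rule hilbert_basis_countable[OF B])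
  let ?N = "to_nat_on B ` B"
  define e where "e n = (if n \<in> ?N then from_nat_into B n else 0)" for n
  have eto: "e (to_nat_on B b) = b" if "b \<in> B" for b using that cB by (simp add: e_def)
  have bij: "bij_betw (to_nat_on B) B ?N"
    using cB inj_on_to_nat_on by (simp add: bij_betw_def)
  have tr: "((\<lambda>n. f (e n)) has_sum s) UNIV" if "(f has_sum s) B" "f 0 = 0" for f :: "'a \<Rightarrow> real" and s
  proof -
    have "((\<lambda>b. f (e (to_nat_on B b))) has_sum s) B"
      using that(1) by (subst has_sum_cong[of B _ f]) (auto simp: eto)
    then have "((\<lambda>n. f (e n)) has_sum s) ?N"
      using has_sum_reindex_bij_betw[OF bij, of "\<lambda>n. f (e n)"] by simp
    then show ?thesis
      using has_sum_cong_neutral[of UNIV ?N "\<lambda>n. f (e n)" "\<lambda>n. f (e n)" s] by (auto simp: e_def that(2))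
  qed
  show ?thesis
  proof
    show "parseval_frame e"
      unfolding parseval_frame_def
      using tr[OF hilbert_basis_parseval[OF B]] by (auto intro: has_sum_imp_sums)
    obtain s where "((\<lambda>e. S e \<bullet> e) has_sum s) B" using sB by (auto simp: summable_on_def)
    from tr[OF this] show "summable (\<lambda>n. S (e n) \<bullet> e n)"
      by (auto simp: S0 summable_def dest: has_sum_imp_sums)
  qed
qed

section \<open>Square roots of nonnegative operators\<close>

text \<open>Discriminant of the nonnegative polynomial t -> S (x + t y) . (x + t y). When S y . y =
  0 the polynomial is affine and its slope must vanish.\<close>

lemma nonneg_op_cauchy_schwarz:
  fixes S :: "'a::real_inner \<Rightarrow> 'a"
  assumes lin: "linear S" and sa: "selfadjoint S" and nn: "nonneg_op S"
  shows "(S x \<bullet> y)\<^sup>2 \<le> (S x \<bullet> x) * (S y \<bullet> y)"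
proof -
  have q: "0 \<le> S x \<bullet> x + 2 * t * (S x \<bullet> y) + t\<^sup>2 * (S y \<bullet> y)" for t
  proof -
    have "0 \<le> S (x + t *\<^sub>R y) \<bullet> (x + t *\<^sub>R y)" using nn by (simp add: nonneg_op_def)
    also have "\<dots> = S x \<bullet> x + 2 * t * (S x \<bullet> y) + t\<^sup>2 * (S y \<bullet> y)"
      using sa[unfolded selfadjoint_def, rule_format, of y x]
      by (simp add: linear_add[OF lin] linear_scale[OF lin] inner_simps inner_commute[of _ "S x"] power2_eq_square algebra_simps)
    finally show ?thesis .
  qed
  show ?thesis
  proof (cases "S y \<bullet> y = 0")
    case True
    have "S x \<bullet> y = 0"
    proof (rule ccontr)
      assume "S x \<bullet> y \<noteq> 0"
      then show False using q[of "- (S x \<bullet> x + 1) / (2 * (S x \<bullet> y))"] True by (simp add: field_simps)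
    qed
    then show ?thesis using True by simp
  next
    case False
    then have p: "S y \<bullet> y > 0" using nn by (simp add: nonneg_op_def less_le)
    have "0 \<le> S x \<bullet> x - (S x \<bullet> y)\<^sup>2 / (S y \<bullet> y)"
      using q[of "- (S x \<bullet> y) / (S y \<bullet> y)"] p by (simp add: field_simps power2_eq_square)
    then show ?thesis using p by (simp add: field_simps)
  qed
qed

lemma nonneg_op_eq_0:
  fixes S :: "'a::real_inner \<Rightarrow> 'a"
  assumes "linear S" "selfadjoint S" "nonneg_op S" "S x \<bullet> x = 0"
  shows "S x = 0"
  using nonneg_op_cauchy_schwarz[OF assms(1-3), of x "S x"] assms(4) by simp

text \<open>Cauchy-Schwarz for the form of \<open>S\<close>, taken with y = S x, upgrades a bound on
  the quadratic form to a bound on the operator.\<close>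

lemma nonneg_op_norm_le:
  fixes S :: "'a::real_inner \<Rightarrow> 'a"
  assumes S: "linear S" "selfadjoint S" "nonneg_op S" and le: "\<And>x. S x \<bullet> x \<le> (norm x)\<^sup>2"
  shows "norm (S x) \<le> norm x"
proof (cases "S x = 0")
  case False
  have "(norm (S x))\<^sup>2 * (norm (S x))\<^sup>2 = (S x \<bullet> S x)\<^sup>2"
    by (simp add: dot_square_norm)
  also have "\<dots> \<le> (S x \<bullet> x) * (S (S x) \<bullet> S x)" by (rule nonneg_op_cauchy_schwarz[OF S])
  also have "\<dots> \<le> (norm x)\<^sup>2 * (norm (S x))\<^sup>2"
    using S(3) by (intro mult_mono le) (auto simp: nonneg_op_def)
  finally have "(norm (S x))\<^sup>2 \<le> (norm x)\<^sup>2"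
    by (rule mult_right_le_imp_le) (use False in simp)
  then show ?thesis by (rule power2_le_imp_le) simp
qed simp

text \<open>The square root of \<open>1 - K\<close> is \<open>1 - Y\<close> for the fixed point \<open>Y\<close> of \<open>Y = (K + Y\<^sup>2) / 2\<close>.\<close>

primrec sqrt_iter :: "('a::real_normed_vector \<Rightarrow>\<^sub>L 'a) \<Rightarrow> nat \<Rightarrow> 'a \<Rightarrow>\<^sub>L 'a" where
  "sqrt_iter K 0 = 0"
| "sqrt_iter K (Suc n) = (1/2) *\<^sub>R (K + (sqrt_iter K n o\<^sub>L sqrt_iter K n))"

text \<open>The same iteration for the number K = 1. It increases inside [0,1] and majorises the
  operator iterates and their increments, which replaces the power series of sqrt (1 - x).\<close>

primrec sqrt_iter_real :: "nat \<Rightarrow> real" where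
  "sqrt_iter_real 0 = 0"
| "sqrt_iter_real (Suc n) = (1 + (sqrt_iter_real n)\<^sup>2) / 2"

lemma sqrt_iter_real_bounds: "0 \<le> sqrt_iter_real n" "sqrt_iter_real n \<le> 1"
proof -
  have "0 \<le> sqrt_iter_real n \<and> sqrt_iter_real n \<le> 1"
    by (induction n) (auto simp: power_le_one)
  then show "0 \<le> sqrt_iter_real n" "sqrt_iter_real n \<le> 1" by auto
qed

text \<open>The iterates are polynomials in \<open>K\<close>. Commutation with an arbitrary
  \<open>C\<close> is carried through the whole construction because uniqueness of the square root
  rests on it.\<close>

lemma sqrt_iter_commute:
  assumes C: "linear C" and "\<And>x. C (blinfun_apply K x) = K (C x)"
  shows "C (sqrt_iter K n x) = sqrt_iter K n (C x)"
  by (induction n arbitrary: x)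
    (auto simp: linear_0[OF C] linear_add[OF C] linear_scale[OF C] assms blinfun.bilinear_simps)

lemma sqrt_iter_commute_self: "sqrt_iter K m (sqrt_iter K n x) = sqrt_iter K n (sqrt_iter K m x)"
proof -
  have "K (sqrt_iter K m x) = sqrt_iter K m (K x)" for x
    by (rule sqrt_iter_commute) (auto intro: bounded_linear.linear blinfun.bounded_linear_right)
  then show ?thesis
    by (intro sqrt_iter_commute bounded_linear.linear[OF blinfun.bounded_linear_right]) simp
qed

text \<open>Since the iterates commute, Y(n+2) - Y(n+1) = (Y(n+1) - Y(n)) (Y(n+1) + Y(n)) / 2. The
  scalar sequence factorises in the same way, so domination passes from one step to the
  next.\<close>

lemma sqrt_iter_bounds:
  assumes K: "norm K \<le> 1"
  shows "norm (sqrt_iter K n) \<le> sqrt_iter_real n"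
    and "norm (sqrt_iter K (Suc n) - sqrt_iter K n) \<le> sqrt_iter_real (Suc n) - sqrt_iter_real n"
proof -
  show *: "norm (sqrt_iter K n) \<le> sqrt_iter_real n" for n
  proof (induction n)
    case (Suc n)
    have "norm (sqrt_iter K n o\<^sub>L sqrt_iter K n) \<le> (sqrt_iter_real n)\<^sup>2"
      using norm_blinfun_compose[of "sqrt_iter K n" "sqrt_iter K n"] mult_mono[OF Suc Suc] sqrt_iter_real_bounds(1)[of n]
      by (simp add: power2_eq_square)
    then show ?case using K norm_triangle_ineq[of K "(sqrt_iter K n o\<^sub>L sqrt_iter K n)"] by simp
  qed simp
  show "norm (sqrt_iter K (Suc n) - sqrt_iter K n) \<le> sqrt_iter_real (Suc n) - sqrt_iter_real n"
  proof (induction n)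
    case (Suc n)
    let ?Y = "sqrt_iter K" and ?y = sqrt_iter_real
    have "?Y (Suc (Suc n)) - ?Y (Suc n) = (1/2) *\<^sub>R ((?Y (Suc n) - ?Y n) o\<^sub>L (?Y (Suc n) + ?Y n))"
    proof (rule blinfun_eqI)
      fix x
      have "(?Y (Suc n) - ?Y n) ((?Y (Suc n) + ?Y n) x) = ?Y (Suc n) (?Y (Suc n) x) - ?Y n (?Y n x)"
        using sqrt_iter_commute_self[of K n "Suc n" x] by (simp add: blinfun.bilinear_simps del: sqrt_iter.simps)
      then show "(?Y (Suc (Suc n)) - ?Y (Suc n)) x = ((1/2) *\<^sub>R ((?Y (Suc n) - ?Y n) o\<^sub>L (?Y (Suc n) + ?Y n))) x"
        unfolding sqrt_iter.simps(2)[of K "Suc n"]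
        by (simp add: blinfun.bilinear_simps algebra_simps del: sqrt_iter.simps)
          (simp add: blinfun.bilinear_simps algebra_simps)
    qed
    also have "norm \<dots> \<le> (1/2) * (norm (?Y (Suc n) - ?Y n) * norm (?Y (Suc n) + ?Y n))"
      using norm_blinfun_compose by (simp del: sqrt_iter.simps)
    also have "\<dots> \<le> (1/2) * ((?y (Suc n) - ?y n) * (?y (Suc n) + ?y n))"
    proof (intro mult_left_mono mult_mono Suc norm_ge_zero order_trans[OF norm_ge_zero Suc])
      show "norm (?Y (Suc n) + ?Y n) \<le> ?y (Suc n) + ?y n"
        by (rule norm_triangle_le) (rule add_mono[OF * *])
    qed simp
    also have "\<dots> = ?y (Suc (Suc n)) - ?y (Suc n)"
      by (simp add: power2_eq_square field_simps)
    finally show ?case .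
  qed (use K in simp)
qed

lemma sqrt_iter_convergent:
  fixes K :: "'a::banach \<Rightarrow>\<^sub>L 'a"
  assumes K: "norm K \<le> 1"
  shows "convergent (sqrt_iter K)"
proof -
  let ?Y = "sqrt_iter K" and ?y = sqrt_iter_real
  have dec: "norm (?Y (n + k) - ?Y n) \<le> ?y (n + k) - ?y n" for n k
  proof (induction k)
    case (Suc k)
    have "norm (?Y (n + Suc k) - ?Y n) \<le> norm (?Y (Suc (n + k)) - ?Y (n + k)) + norm (?Y (n + k) - ?Y n)"
      using norm_triangle_ineq[of "?Y (Suc (n + k)) - ?Y (n + k)" "?Y (n + k) - ?Y n"] by simp
    then show ?case using Suc sqrt_iter_bounds(2)[OF K, of "n + k"] by (simp del: sqrt_iter.simps sqrt_iter_real.simps)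
  qed simp
  have "?y n \<le> ?y (Suc n)" for n
    using order_trans[OF norm_ge_zero sqrt_iter_bounds(2)[OF K, of n]] by simp
  then have "incseq ?y" by (rule incseq_SucI)
  then have "Cauchy ?y"
    by (metis incseq_convergent[of ?y 1] sqrt_iter_real_bounds(2) LIMSEQ_imp_Cauchy)
  have "Cauchy ?Y"
  proof (rule metric_CauchyI)
    fix e :: real assume "0 < e"
    then obtain N where N: "\<And>m n. m \<ge> N \<Longrightarrow> n \<ge> N \<Longrightarrow> dist (?y m) (?y n) < e"
      using \<open>Cauchy ?y\<close> metric_CauchyD by metis
    have "dist (?Y (n + k)) (?Y n) < e" if "n \<ge> N" for n k
      using dec[of n k] N[of "n + k" n] that by (auto simp: dist_norm dist_real_def)
    then have "dist (?Y m) (?Y n) < e" if "n \<ge> N" "m \<ge> N" for m n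
      using that by (metis dist_commute le_Suc_ex linear)
    then show "\<exists>M. \<forall>m\<ge>M. \<forall>n\<ge>M. dist (?Y m) (?Y n) < e" by blast
  qed
  then show ?thesis by (simp add: Cauchy_convergent_iff)
qed

lemma sqrt_exists_contraction:
  fixes K :: "'a::{real_inner,banach} \<Rightarrow>\<^sub>L 'a"
  assumes K: "norm K \<le> 1" and sa: "selfadjoint K"
  obtains R :: "'a \<Rightarrow>\<^sub>L 'a" where "selfadjoint R" "nonneg_op R" "\<And>x. R (R x) = x - K x"
    "\<And>C x. bounded_linear C \<Longrightarrow> (\<And>x. C (K x) = K (C x)) \<Longrightarrow> C (R x) = R (C x)"
proof -
  let ?Y = "sqrt_iter K"
  obtain Y where Y: "?Y \<longlonglongrightarrow> Y" using sqrt_iter_convergent[OF K] by (auto simp: convergent_def)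
  have Yx: "(\<lambda>n. ?Y n x) \<longlonglongrightarrow> Y x" for x
    by (intro tendsto_intros Y)
  have "(\<lambda>n. (1/2) *\<^sub>R (K + (?Y n o\<^sub>L ?Y n))) \<longlonglongrightarrow> (1/2) *\<^sub>R (K + (Y o\<^sub>L Y))"
    by (intro tendsto_intros bounded_bilinear.tendsto[OF bounded_bilinear_blinfun_compose] Y)
  then have "(\<lambda>n. ?Y (Suc n)) \<longlonglongrightarrow> (1/2) *\<^sub>R (K + (Y o\<^sub>L Y))"
    unfolding sqrt_iter.simps .
  then have fp: "Y = (1/2) *\<^sub>R (K + (Y o\<^sub>L Y))"
    by (rule LIMSEQ_unique[OF LIMSEQ_Suc[OF Y]])
  have fpx: "2 *\<^sub>R Y x = K x + Y (Y x)" for x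
    using arg_cong[OF fp, of "\<lambda>Z. 2 *\<^sub>R blinfun_apply Z x"] by (simp add: blinfun.bilinear_simps)
  have "norm Y \<le> 1"
    using order_trans[OF sqrt_iter_bounds(1)[OF K] sqrt_iter_real_bounds(2)]
    by (intro LIMSEQ_le_const2[OF tendsto_norm[OF Y]]) auto
  then have nY: "norm (Y x) \<le> norm x" for x
    using norm_blinfun[of Y x] mult_right_mono[of "norm Y" 1 "norm x"] by simp
  have "?Y n x \<bullet> y = x \<bullet> ?Y n y" for n x y
    using sa by (induction n arbitrary: x y) (auto simp: blinfun.bilinear_simps inner_simps selfadjoint_def)
  then have saY: "Y x \<bullet> y = x \<bullet> Y y" for x y
    using LIMSEQ_unique[OF tendsto_inner[OF Yx[of x] tendsto_const[of y]], of "x \<bullet> Y y"]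
      tendsto_inner[OF tendsto_const[of x] Yx[of y]] by simp
  define R where "R = id_blinfun - Y"
  have R: "R x = x - Y x" for x by (simp add: R_def blinfun.bilinear_simps)
  show ?thesis
  proof (rule that[of R])
    show "selfadjoint R" by (simp add: selfadjoint_def R inner_simps saY)
    have "Y x \<bullet> x \<le> x \<bullet> x" for x
      using order_trans[OF norm_cauchy_schwarz mult_right_mono[OF nY norm_ge_zero], of x x] by (simp add: dot_square_norm power2_eq_square)
    then show "nonneg_op R" by (simp add: nonneg_op_def R inner_simps)
    show "R (R x) = x - K x" for x
      using fpx[of x] by (simp add: R blinfun.bilinear_simps scaleR_2 algebra_simps)
    fix C :: "'a \<Rightarrow> 'a" and x assume C: "bounded_linear C" "\<And>x. C (K x) = K (C x)"
    have "C (?Y n x) = ?Y n (C x)" for n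
      using C by (intro sqrt_iter_commute) (auto intro: bounded_linear.linear)
    then have "C (Y x) = Y (C x)"
      using LIMSEQ_unique[OF bounded_linear.tendsto[OF C(1) Yx[of x]], of "Y (C x)"] Yx[of "C x"] by simp
    then show "C (R x) = R (C x)" using linear_diff[OF bounded_linear.linear[OF C(1)]] by (simp add: R)
  qed
qed

lemma nonneg_sqrt_exists:
  fixes S :: "'a::{real_inner,banach} \<Rightarrow> 'a"
  assumes S: "bounded_linear S" and sa: "selfadjoint S" and nn: "nonneg_op S"
  obtains R where "bounded_linear R" "selfadjoint R" "nonneg_op R" "R \<circ> R = S"
    "\<And>C x. bounded_linear C \<Longrightarrow> (\<And>x. C (S x) = S (C x)) \<Longrightarrow> C (R x) = R (C x)"
proof -
  interpret S: bounded_linear S by fact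
  \<comment> \<open>Any m > 0 at least the operator norm gives 0 \<le> S/m \<le> 1, which makes K =
    1 - S/m a contraction; the summand 1 keeps \<open>m\<close> positive for S = 0.\<close>
  define m where "m = onorm S + 1"
  have m: "m > 0" using onorm_pos_le[OF S] by (simp add: m_def)
  have Sm: "S x \<bullet> x \<le> m * (norm x)\<^sup>2" for x
  proof -
    have "S x \<bullet> x \<le> norm (S x) * norm x" by (rule norm_cauchy_schwarz)
    also have "\<dots> \<le> (onorm S * norm x) * norm x" by (intro mult_right_mono onorm S) auto
    also have "\<dots> \<le> (m * norm x) * norm x" by (intro mult_right_mono) (auto simp: m_def)
    finally show ?thesis by (simp add: power2_eq_square)
  qed
  define K where "K = Blinfun (\<lambda>x. x - (1/m) *\<^sub>R S x)"
  have K: "K x = x - (1/m) *\<^sub>R S x" for x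
    unfolding K_def by (subst bounded_linear_Blinfun_apply) (intro bounded_linear_intros S | simp)+
  have saK: "selfadjoint K" using sa by (simp add: selfadjoint_def K inner_simps)
  have "nonneg_op K"
    using Sm m by (auto simp: nonneg_op_def K inner_simps dot_square_norm field_simps)
  moreover have "K x \<bullet> x \<le> (norm x)\<^sup>2" for x
    using nn m by (auto simp: nonneg_op_def K inner_simps dot_square_norm field_simps)
  ultimately have "norm (K x) \<le> norm x" for x
    by (intro nonneg_op_norm_le saK) (auto intro: bounded_linear.linear blinfun.bounded_linear_right)
  then have "norm K \<le> 1" by (intro norm_blinfun_bound) auto
  from sqrt_exists_contraction[OF this saK] obtain R :: "'a \<Rightarrow>\<^sub>L 'a" where R: "selfadjoint R" "nonneg_op R" "\<And>x. R (R x) = x - K x"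
    "\<And>C x. bounded_linear C \<Longrightarrow> (\<And>x. C (K x) = K (C x)) \<Longrightarrow> C (R x) = R (C x)" by blast
  show ?thesis
  proof (rule that[of "\<lambda>x. sqrt m *\<^sub>R R x"])
    show "bounded_linear (\<lambda>x. sqrt m *\<^sub>R R x)" by (intro bounded_linear_intros)
    show "selfadjoint (\<lambda>x. sqrt m *\<^sub>R R x)" using R(1) by (simp add: selfadjoint_def)
    show "nonneg_op (\<lambda>x. sqrt m *\<^sub>R R x)" using R(2) m by (simp add: nonneg_op_def)
    show "(\<lambda>x. sqrt m *\<^sub>R R x) \<circ> (\<lambda>x. sqrt m *\<^sub>R R x) = S"
      using m by (auto simp: fun_eq_iff blinfun.bilinear_simps R(3) K)
    fix C :: "'a \<Rightarrow> 'a" and x assume C: "bounded_linear C" "\<And>x. C (S x) = S (C x)"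
    interpret C: bounded_linear C by fact
    have "C (R x) = R (C x)" by (rule R(4)[OF C(1)]) (simp add: K C.diff C.scaleR C(2))
    then show "C (sqrt m *\<^sub>R R x) = sqrt m *\<^sub>R R (C x)" by (simp add: C.scaleR)
  qed
qed

text \<open>Uniqueness behind the description: another root R' commutes with its square
  \<open>S\<close>, hence with \<open>R\<close>. For y = R x - R' x this gives (R + R') y = 0, so
  both nonnegative forms vanish at \<open>y\<close>, so R y = R' y = 0, and then y . y = 0.\<close>

lemma op_sqrt_props:
  fixes S :: "'a::{real_inner,banach} \<Rightarrow> 'a"
  assumes S: "bounded_linear S" "selfadjoint S" "nonneg_op S"
  shows "bounded_linear (op_sqrt S)" "selfadjoint (op_sqrt S)" "nonneg_op (op_sqrt S)"
    "op_sqrt S (op_sqrt S x) = S x"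
proof -
  obtain R where R: "bounded_linear R" "selfadjoint R" "nonneg_op R" "R \<circ> R = S"
    and comm: "\<And>C x. bounded_linear C \<Longrightarrow> (\<And>x. C (S x) = S (C x)) \<Longrightarrow> C (R x) = R (C x)"
    using nonneg_sqrt_exists[OF S] by metis
  have RR: "R (R x) = S x" for x using R(4) by (auto simp: fun_eq_iff)
  interpret R: bounded_linear R by fact
  have uniq: "R' = R" if R': "bounded_linear R'" "selfadjoint R'" "nonneg_op R'" "R' \<circ> R' = S" for R'
  proof
    fix x
    interpret R': bounded_linear R' by fact
    have RR': "R' (R' x) = S x" for x using R'(4) by (auto simp: fun_eq_iff)
    have c: "R' (R x) = R (R' x)" for x by (rule comm[OF R'(1)]) (metis RR')
    define y where "y = R x - R' x"
    have "(R y + R' y) = 0" by (simp add: y_def R.diff R'.diff RR RR' c)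
    then have "R y \<bullet> y + R' y \<bullet> y = 0" by (metis inner_add_left inner_zero_left)
    then have "R y \<bullet> y = 0" "R' y \<bullet> y = 0"
      using R(3) R'(3) by (auto simp: nonneg_op_def add_nonneg_eq_0_iff)
    then have "R y = 0" "R' y = 0"
      using nonneg_op_eq_0[OF R.linear R(2,3)] nonneg_op_eq_0[OF R'.linear R'(2,3)] by auto
    moreover have "y \<bullet> R x = R y \<bullet> x" "y \<bullet> R' x = R' y \<bullet> x"
      using R(2) R'(2) by (auto simp: selfadjoint_def)
    ultimately have "y \<bullet> y = 0" by (subst (2) y_def) (simp add: inner_diff_right)
    then show "R' x = R x" by (simp add: y_def)
  qed
  have "op_sqrt S = R" unfolding op_sqrt_def
  proof (rule the_equality)
    show "bounded_linear R \<and> selfadjoint R \<and> nonneg_op R \<and> R \<circ> R = S" using R by blast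
  qed (use uniq in blast)
  then show "bounded_linear (op_sqrt S)" "selfadjoint (op_sqrt S)" "nonneg_op (op_sqrt S)"
    "op_sqrt S (op_sqrt S x) = S x" using R RR by auto
qed

text \<open>The preimage of a point of the range is nonempty, closed and convex, so it has exactly
  one element of least norm and the description denotes it.\<close>

lemma pseudo_inverse_right:
  fixes R :: "'a::{real_inner,banach} \<Rightarrow> 'b::real_normed_vector"
  assumes R: "bounded_linear R" and y: "y \<in> range R"
  shows "R (pseudo_inverse R y) = y"
proof -
  interpret R: bounded_linear R by fact
  have "\<exists>!x. x \<in> {x. R x = y} \<and> (\<forall>z\<in>{x. R x = y}. norm x \<le> norm z)"
  proof (rule min_norm_exists)
    show "closed {x. R x = y}" by (intro closed_Collect_eq continuous_intros R.continuous_on)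
    show "convex {x. R x = y}" by (auto simp: convex_def R.add R.scaleR simp flip: scaleR_left.add)
    show "{x. R x = y} \<noteq> {}" using y by auto
  qed
  then have "\<exists>!x. R x = y \<and> (\<forall>z. R z = y \<longrightarrow> norm x \<le> norm z)" by simp
  from theI'[OF this] show ?thesis by (simp add: pseudo_inverse_def)
qed

section \<open>Strongly continuous semigroups\<close>

text \<open>Banach-Steinhaus through Baire: the closed sets \<open>E n\<close> cover the space, so
  one of them contains a ball, and that ball carries the bound to all directions.\<close>

lemma uniform_boundedness:
  fixes F :: "'i \<Rightarrow> 'a::banach \<Rightarrow>\<^sub>L 'b::real_normed_vector"
  assumes "\<And>x. \<exists>M. \<forall>i\<in>I. norm (F i x) \<le> M"
  shows "\<exists>M. \<forall>i\<in>I. norm (F i) \<le> M"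
proof -
  define E where "E n = {x. \<forall>i\<in>I. norm (F i x) \<le> real n}" for n :: nat
  have cl: "closed (E n)" for n
    unfolding E_def Collect_ball_eq by (intro closed_INT ballI closed_Collect_le continuous_intros)
  have un: "\<Union>(range E) = UNIV"
  proof -
    have "\<exists>n. x \<in> E n" for x
    proof -
      obtain M where M: "\<forall>i\<in>I. norm (F i x) \<le> M" using assms by blast
      obtain n where "M \<le> real n" using real_arch_simple by blast
      then have "x \<in> E n" unfolding E_def using M by fastforce
      then show ?thesis by blast
    qed
    then show ?thesis by auto
  qed
  have "\<exists>n. interior (E n) \<noteq> {}"
  proof (rule ccontr)
    assume "\<not> ?thesis"
    then have "(euclidean :: 'a topology) interior_of \<Union>(range E) = {}"
      by (intro Baire_category_alt) (auto simp: cl completely_metrizable_space_euclidean)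
    then show False by (simp add: un)
  qed
  then obtain n x0 r where r: "r > 0" "cball x0 r \<subseteq> E n"
    by (metis ex_in_conv mem_interior_cball)
  \<comment> \<open>A vector of length \<open>r\<close> is the difference of two points of the ball,
    each with image of norm at most \<open>n\<close>; this accounts for the factor 2 and the
    division by \<open>r\<close>.\<close>
  have "norm (F i) \<le> 2 * real n / r" if "i \<in> I" for i
  proof (rule norm_blinfun_bound)
    show "0 \<le> 2 * real n / r" using r by simp
    fix x
    show "norm (F i x) \<le> 2 * real n / r * norm x"
    proof (cases "x = 0")
      case False
      define h where "h = (r / norm x) *\<^sub>R x"
      have "x0 \<in> cball x0 r" "x0 + h \<in> cball x0 r" using r False by (auto simp: h_def dist_norm)
      then have "norm (F i x0) \<le> real n" "norm (F i (x0 + h)) \<le> real n"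
        using r(2) that unfolding E_def by blast+
      then have "norm (F i h) \<le> 2 * real n"
        using norm_triangle_ineq4[of "F i (x0 + h)" "F i x0"] by (simp add: blinfun.add_right)
      then show ?thesis using r(1) False by (simp add: h_def blinfun.scaleR_right field_simps)
    qed (simp add: blinfun.zero_right)
  qed
  then show ?thesis by blast
qed

lemma C0_semigroup_locally_bounded:
  assumes T: "C0_semigroup T"
  obtains M where "M \<ge> 1" "\<And>t. 0 \<le> t \<Longrightarrow> t \<le> b \<Longrightarrow> norm (T t) \<le> M"
proof -
  have "\<exists>M. \<forall>t\<in>{0..b}. norm (T t) \<le> M"
  proof (rule uniform_boundedness)
    fix x
    have "continuous_on {0..b} (\<lambda>t. T t x)"
      using T by (auto simp: C0_semigroup_def intro: continuous_on_subset)
    then have "compact ((\<lambda>t. T t x) ` {0..b})" by (intro compact_continuous_image) auto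
    then have "bounded ((\<lambda>t. T t x) ` {0..b})" by (rule compact_imp_bounded)
    then show "\<exists>M. \<forall>t\<in>{0..b}. norm (T t x) \<le> M" by (auto simp: bounded_iff)
  qed
  then obtain M where "\<forall>t\<in>{0..b}. norm (T t) \<le> M" by blast
  then show ?thesis by (intro that[of "max 1 M"]) (auto simp: le_max_iff_disj)
qed

text \<open>For s < r, S r x - S s x = S s (S (r - s) x - x), so local boundedness turns continuity
  at 0 into two-sided continuity. It is stated for plain families of maps in order to apply to the
  adjoint semigroup.\<close>

lemma strongly_continuous_from_0:
  fixes S :: "real \<Rightarrow> 'a::real_normed_vector \<Rightarrow> 'a"
  assumes sg: "\<And>s t x. 0 \<le> s \<Longrightarrow> 0 \<le> t \<Longrightarrow> S (s + t) x = S s (S t x)"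
    and lin: "\<And>t. linear (S t)"
    and bd: "\<And>b. \<exists>M. \<forall>t\<in>{0..b}. \<forall>x. norm (S t x) \<le> M * norm x"
    and at0: "((\<lambda>t. S t x) \<longlongrightarrow> x) (at_right 0)"
  shows "continuous_on {0..} (\<lambda>t. S t x)"
  unfolding continuous_on_iff
proof (intro ballI allI impI)
  fix t e :: real assume t: "t \<in> {0..}" and e: "e > 0"
  obtain M where M: "\<And>r y. 0 \<le> r \<Longrightarrow> r \<le> t + 1 \<Longrightarrow> norm (S r y) \<le> M * norm y"
    using bd[of "t + 1"] by (meson atLeastAtMost_iff)
  define M' where "M' = max M 1"
  have M': "M' > 0" "\<And>r y. 0 \<le> r \<Longrightarrow> r \<le> t + 1 \<Longrightarrow> norm (S r y) \<le> M' * norm y"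
  proof -
    show "M' > 0" by (simp add: M'_def)
    fix r y assume "0 \<le> r" "r \<le> t + 1"
    then have "norm (S r y) \<le> M * norm y" by (rule M)
    also have "\<dots> \<le> M' * norm y" by (intro mult_right_mono) (auto simp: M'_def)
    finally show "norm (S r y) \<le> M' * norm y" .
  qed
  have "\<forall>\<^sub>F u in at_right 0. dist (S u x) x < e / M'"
    using at0 e M'(1) by (intro tendstoD) auto
  then obtain d where d: "d > 0" "\<And>u. 0 < u \<Longrightarrow> u < d \<Longrightarrow> dist (S u x) x < e / M'"
    by (auto simp: eventually_at_right_field)
  have *: "dist (S r x) (S s x) < e" if "0 \<le> s" "s < r" "r \<le> t + 1" "r - s < d" for r s
  proof -
    have "S r x - S s x = S s (S (r - s) x - x)"
      using sg[of s "r - s" x] that by (simp add: linear_diff[OF lin])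
    then have "dist (S r x) (S s x) \<le> M' * dist (S (r - s) x) x"
      using M'(2)[of s] that by (simp add: dist_norm)
    also have "\<dots> < M' * (e / M')" using d(2)[of "r - s"] that M'(1) by (intro mult_strict_left_mono) auto
    finally show ?thesis using M'(1) by simp
  qed
  show "\<exists>d>0. \<forall>x'\<in>{0..}. dist x' t < d \<longrightarrow> dist (S x' x) (S t x) < e"
  proof (intro exI[of _ "min d 1"] conjI ballI impI)
    fix r assume r: "r \<in> {0..}" "dist r t < min d 1"
    consider "r < t" | "r = t" | "r > t" by linarith
    then show "dist (S r x) (S t x) < e"
    proof cases
      case 1
      then show ?thesis using *[of r t] r by (simp add: dist_real_def dist_commute)
    next
      case 3
      then show ?thesis using *[of t r] r t by (simp add: dist_real_def)
    qed (use e in simp)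
  qed (use d in auto)
qed

section \<open>The adjoint semigroup and the covariance operators\<close>

locale covariance_semigroup =
  fixes T :: "real \<Rightarrow> 'a::{real_inner,banach} \<Rightarrow>\<^sub>L 'a" and Q :: "'a \<Rightarrow>\<^sub>L 'a"
  assumes C0: "C0_semigroup T" and Q_sa: "selfadjoint Q" and Q_nn: "nonneg_op Q"
begin

abbreviation TA :: "real \<Rightarrow> 'a \<Rightarrow> 'a" where "TA t \<equiv> adjoint (blinfun_apply (T t))"

lemma T_0: "T 0 x = x" using C0 by (simp add: C0_semigroup_def)

lemma T_add: "0 \<le> s \<Longrightarrow> 0 \<le> t \<Longrightarrow> T (s + t) x = T s (T t x)"
  using C0 by (simp add: C0_semigroup_def)

lemma T_cont: "continuous_on {0..} (\<lambda>t. T t x)"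
  using C0 by (simp add: C0_semigroup_def)

lemma T_tendsto_0: "((\<lambda>t. T t x) \<longlongrightarrow> x) (at_right 0)"
proof -
  have "((\<lambda>t. T t x) \<longlongrightarrow> T 0 x) (at 0 within {0..})"
    using T_cont[of x] by (auto simp: continuous_on_def)
  then show ?thesis unfolding T_0 by (rule tendsto_within_subset) auto
qed

lemma TA_inner: "x \<bullet> TA t y = T t x \<bullet> y" "TA t y \<bullet> x = T t x \<bullet> y"
  by (simp_all add: bounded_linear_inner_adjoint blinfun.bounded_linear_right inner_commute[of "TA t y"])

lemma TA_bounded_linear: "bounded_linear (TA t)"
  by (intro bounded_linear_adjoint blinfun.bounded_linear_right)

lemma TA_linear: "linear (TA t)"
  by (intro bounded_linear.linear TA_bounded_linear)

lemma TA_norm: "norm (TA t x) \<le> norm (T t) * norm x"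
  using norm_adjoint_le[OF blinfun.bounded_linear_right, of "T t" x] by (simp add: norm_blinfun.rep_eq)

lemma TA_add:
  assumes "0 \<le> s" "0 \<le> t" shows "TA (s + t) x = TA s (TA t x)"
proof (rule inner_eq_imp_eq)
  fix z show "TA (s + t) x \<bullet> z = TA s (TA t x) \<bullet> z"
    using T_add[OF assms(2,1), of z] by (simp add: TA_inner add.commute)
qed

text \<open>The adjoints inherit only weak continuity directly. The vectors with strong convergence
  form a closed subspace \<open>V\<close>; it contains all weak averages of orbits over
  [0,\<epsilon>], and a vector orthogonal to these averages is 0. The resulting strong continuity is
  what makes the integrand of \<open>Q_op\<close> continuous.\<close>

lemma TA_tendsto_0: "((\<lambda>t. TA t x) \<longlongrightarrow> x) (at_right 0)"
proof -
  obtain M where M: "M \<ge> 1" "\<And>t. 0 \<le> t \<Longrightarrow> t \<le> 2 \<Longrightarrow> norm (T t) \<le> M"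
    using C0_semigroup_locally_bounded[OF C0] by metis
  define V where "V = {x. ((\<lambda>t. TA t x) \<longlongrightarrow> x) (at_right 0)}"
  have small: "\<forall>\<^sub>F t in at_right 0. 0 < t \<and> t < (1::real)"
    by (auto simp: eventually_at_right_field intro: exI[of _ 1])
  have sub: "subspace V"
    unfolding subspace_def V_def
    by (auto simp: linear_0[OF TA_linear] linear_add[OF TA_linear] linear_scale[OF TA_linear] intro!: tendsto_intros)
  have cl: "closed V"
    unfolding closed_sequential_limits
  proof (intro allI impI, elim conjE)
    fix y l assume y: "\<forall>n. y n \<in> V" and l: "y \<longlonglongrightarrow> l"
    have "((\<lambda>t. TA t l) \<longlongrightarrow> l) (at_right 0)"
    proof (rule tendstoI)
      fix e :: real assume e: "e > 0"
      have "\<forall>\<^sub>F n in sequentially. dist (y n) l < e / (2 * (M + 1))"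
        using l e M(1) by (intro tendstoD) auto
      then obtain n where n: "dist (y n) l < e / (2 * (M + 1))" by (auto simp: eventually_sequentially)
      have "\<forall>\<^sub>F t in at_right 0. dist (TA t (y n)) (y n) < e / 2"
        using y e by (intro tendstoD) (auto simp: V_def)
      with small show "\<forall>\<^sub>F t in at_right 0. dist (TA t l) l < e"
      proof eventually_elim
        case (elim t)
        have "dist (TA t l) (TA t (y n)) = norm (TA t (l - y n))" by (simp add: dist_norm linear_diff[OF TA_linear])
        also have "\<dots> \<le> M * dist (y n) l"
          using TA_norm[of t "l - y n"] mult_right_mono[OF M(2)[of t], of "norm (l - y n)"] elim
          by (simp add: dist_norm norm_minus_commute)
        finally have "dist (TA t l) l \<le> M * dist (y n) l + dist (TA t (y n)) (y n) + dist (y n) l"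
          using dist_triangle[of "TA t l" l "TA t (y n)"] dist_triangle[of "TA t (y n)" l "y n"] by linarith
        moreover have "M * dist (y n) l + dist (y n) l < e / 2"
          using n M(1) by (simp add: field_simps)
        ultimately show ?case using elim by linarith
      qed
    qed
    then show "l \<in> V" by (simp add: V_def)
  qed
  have int: "(\<lambda>r. T r z \<bullet> y) integrable_on {a..b}" if "0 \<le> a" for z y a b
    using that by (intro integrable_continuous_interval continuous_intros continuous_on_subset[OF T_cont]) auto
  have ibd: "\<bar>integral {a..b} (\<lambda>r. T r z \<bullet> y)\<bar> \<le> M * norm z * norm y * (b - a)"
    if "0 \<le> a" "a \<le> b" "b \<le> 2" for z y a b
  proof -
    have "norm (integral {a..b} (\<lambda>r. T r z \<bullet> y)) \<le> M * norm z * norm y * (b - a)"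
    proof (rule integral_bound[OF that(2)])
      show "continuous_on {a..b} (\<lambda>r. T r z \<bullet> y)"
        using that by (intro continuous_intros continuous_on_subset[OF T_cont]) auto
      fix r assume "r \<in> {a..b}"
      then have "norm (T r z) \<le> M * norm z"
        using norm_blinfun[of "T r" z] mult_right_mono[OF M(2)[of r], of "norm z"] that by auto
      then have "norm (T r z) * norm y \<le> M * norm z * norm y" by (rule mult_right_mono) simp
      then show "norm (T r z \<bullet> y) \<le> M * norm z * norm y"
        using Cauchy_Schwarz_ineq2[of "T r z" y] by simp
    qed
    then show ?thesis by simp
  qed
  \<comment> \<open>\<open>w\<close> is the integral of TA r y over [0,\<epsilon>] in the weak
    sense. It is produced by Riesz from the integrals of T r z . y, whose integrand is known to be
    continuous.\<close>
  have w: "\<exists>w\<in>V. \<forall>z. integral {0..\<epsilon>} (\<lambda>r. T r z \<bullet> y) = z \<bullet> w" if eps: "0 < \<epsilon>" "\<epsilon> \<le> 1" for \<epsilon> y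
  proof -
    have "bounded_linear (\<lambda>z. integral {0..\<epsilon>} (\<lambda>r. T r z \<bullet> y))"
    proof (rule bounded_linear_intro)
      show "integral {0..\<epsilon>} (\<lambda>r. T r (z + z') \<bullet> y) = integral {0..\<epsilon>} (\<lambda>r. T r z \<bullet> y) + integral {0..\<epsilon>} (\<lambda>r. T r z' \<bullet> y)" for z z'
        by (simp add: blinfun.add_right inner_add_left integral_add int)
      show "integral {0..\<epsilon>} (\<lambda>r. T r (c *\<^sub>R z) \<bullet> y) = c *\<^sub>R integral {0..\<epsilon>} (\<lambda>r. T r z \<bullet> y)" for c z
        by (simp add: blinfun.scaleR_right)
      show "norm (integral {0..\<epsilon>} (\<lambda>r. T r z \<bullet> y)) \<le> norm z * (M * norm y * \<epsilon>)" for z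
        using ibd[of 0 \<epsilon> z y] eps by (simp add: algebra_simps)
    qed
    from riesz_representation[OF this] obtain w where w: "\<And>z. integral {0..\<epsilon>} (\<lambda>r. T r z \<bullet> y) = z \<bullet> w" by blast
    \<comment> \<open>Testing TA t w - w against itself and shifting time leaves two end pieces of
      length \<open>t\<close>, each at most M times the norms of \<open>?z\<close> and
      \<open>y\<close>. The bound \<open>M\<close> was taken up to time 2 in order to cover
      \<epsilon> + t.\<close>
    have est: "norm (TA t w - w) \<le> 2 * M * norm y * t" if t: "0 < t" "t < 1" for t
    proof -
      let ?z = "TA t w - w"
      have sh: "integral {0..\<epsilon>} (\<lambda>r. T r (T t ?z) \<bullet> y) = integral {t..\<epsilon> + t} (\<lambda>r. T r ?z \<bullet> y)"
      proof -
        have "integral {0..\<epsilon>} (\<lambda>r. T r (T t ?z) \<bullet> y) = integral {0..\<epsilon>} (\<lambda>r. T (r + t) ?z \<bullet> y)"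
          using t by (intro integral_cong) (simp add: T_add)
        also have "\<dots> = integral {t..\<epsilon> + t} (\<lambda>r. T r ?z \<bullet> y)"
          using integral_shift_Icc_real[of 0 \<epsilon> "\<lambda>r. T r ?z \<bullet> y" t] by (simp add: o_def add.commute[of t])
        finally show ?thesis .
      qed
      have c1: "integral {0..t} (\<lambda>r. T r ?z \<bullet> y) + integral {t..\<epsilon> + t} (\<lambda>r. T r ?z \<bullet> y) = integral {0..\<epsilon> + t} (\<lambda>r. T r ?z \<bullet> y)"
        using t eps by (intro Henstock_Kurzweil_Integration.integral_combine int) auto
      have c2: "integral {0..\<epsilon>} (\<lambda>r. T r ?z \<bullet> y) + integral {\<epsilon>..\<epsilon> + t} (\<lambda>r. T r ?z \<bullet> y) = integral {0..\<epsilon> + t} (\<lambda>r. T r ?z \<bullet> y)"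
        using t eps by (intro Henstock_Kurzweil_Integration.integral_combine int) auto
      have "(norm ?z)\<^sup>2 = T t ?z \<bullet> w - ?z \<bullet> w"
        by (simp add: power2_norm_eq_inner inner_diff_right TA_inner)
      also have "\<dots> = integral {\<epsilon>..\<epsilon> + t} (\<lambda>r. T r ?z \<bullet> y) - integral {0..t} (\<lambda>r. T r ?z \<bullet> y)"
        using sh c1 c2 by (simp flip: w)
      also have "\<dots> \<le> M * norm ?z * norm y * t + M * norm ?z * norm y * t"
      proof -
        have "\<bar>integral {\<epsilon>..\<epsilon> + t} (\<lambda>r. T r ?z \<bullet> y)\<bar> \<le> M * norm ?z * norm y * t"
          using ibd[of \<epsilon> "\<epsilon> + t" ?z y] eps t by simp
        moreover have "\<bar>integral {0..t} (\<lambda>r. T r ?z \<bullet> y)\<bar> \<le> M * norm ?z * norm y * t"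
          using ibd[of 0 t ?z y] t by simp
        ultimately show ?thesis by linarith
      qed
      finally have "norm ?z * norm ?z \<le> (2 * M * norm y * t) * norm ?z"
        by (simp add: power2_eq_square algebra_simps)
      then show ?thesis
        using M(1) t by (cases "?z = 0") auto
    qed
    have "((\<lambda>t. TA t w - w) \<longlongrightarrow> 0) (at_right 0)"
    proof (rule Lim_null_comparison)
      show "\<forall>\<^sub>F t in at_right 0. norm (TA t w - w) \<le> 2 * M * norm y * t"
        using small by eventually_elim (simp add: est)
      show "((\<lambda>t. 2 * M * norm y * t) \<longlongrightarrow> 0) (at_right 0)"
        by (intro tendsto_eq_intros) auto
    qed
    then have "w \<in> V" by (simp add: V_def LIM_zero_iff)
    then show ?thesis using w by blast
  qed
  have "V = UNIV"
  proof (rule closed_subspace_eq_UNIV[OF cl sub], rule ccontr)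
    fix z assume orth: "\<And>m. m \<in> V \<Longrightarrow> z \<bullet> m = 0" and "z \<noteq> 0"
    then have zz: "z \<bullet> z > 0" by simp
    have "((\<lambda>t. T t z \<bullet> z) \<longlongrightarrow> z \<bullet> z) (at_right 0)" by (intro tendsto_intros T_tendsto_0)
    then have "\<forall>\<^sub>F t in at_right 0. T t z \<bullet> z > (z \<bullet> z) / 2" using zz by (intro order_tendstoD) auto
    then obtain d where d: "d > 0" "\<And>t. 0 < t \<Longrightarrow> t < d \<Longrightarrow> T t z \<bullet> z > (z \<bullet> z) / 2"
      by (auto simp: eventually_at_right_field)
    \<comment> \<open>On [0,\<epsilon>] the function T t z . z stays at least half its value at 0,
      so its integral, which equals z . w = 0, would be positive.\<close>
    define \<epsilon> where "\<epsilon> = min (d / 2) 1"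
    have eps: "0 < \<epsilon>" "\<epsilon> < d" "\<epsilon> \<le> 1" using d(1) by (auto simp: \<epsilon>_def)
    have "integral {0..\<epsilon>} (\<lambda>r. (z \<bullet> z) / 2) \<le> integral {0..\<epsilon>} (\<lambda>r. T r z \<bullet> z)"
    proof (rule integral_le)
      fix r assume r: "r \<in> {0..\<epsilon>}"
      show "(z \<bullet> z) / 2 \<le> T r z \<bullet> z"
        using d(2)[of r] r eps zz by (cases "r = 0") (auto simp: T_0)
    qed (auto intro: int)
    moreover have "integral {0..\<epsilon>} (\<lambda>r. T r z \<bullet> z) = 0"
      using w[OF eps(1,3), of z] orth by fastforce
    ultimately show False using zz eps by (simp add: mult_le_0_iff)
  qed
  then show ?thesis by (auto simp: V_def)
qed

lemma TA_cont: "continuous_on {0..} (\<lambda>t. TA t x)"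
proof (rule strongly_continuous_from_0)
  show "\<exists>M. \<forall>t\<in>{0..b}. \<forall>x. norm (TA t x) \<le> M * norm x" for b
  proof -
    obtain M where M: "M \<ge> 1" "\<And>t. 0 \<le> t \<Longrightarrow> t \<le> b \<Longrightarrow> norm (T t) \<le> M"
      using C0_semigroup_locally_bounded[OF C0] by metis
    then show ?thesis
      by (intro exI[of _ M] ballI allI order_trans[OF TA_norm] mult_right_mono) auto
  qed
qed (auto simp: TA_add TA_linear TA_tendsto_0)

lemma T_apply_cont:
  assumes y: "continuous_on {0..} y"
  shows "continuous_on {0..} (\<lambda>t. T t (y t))"
  unfolding continuous_on_def
proof
  fix t0 :: real assume t0: "t0 \<in> {0..}"
  obtain M where M: "M \<ge> 1" "\<And>t. 0 \<le> t \<Longrightarrow> t \<le> t0 + 1 \<Longrightarrow> norm (T t) \<le> M"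
    using C0_semigroup_locally_bounded[OF C0] by metis
  have "((\<lambda>t. T t (y t - y t0)) \<longlongrightarrow> 0) (at t0 within {0..})"
  proof (rule Lim_null_comparison)
    have "\<forall>\<^sub>F t in at t0 within {0..}. t \<in> {0..} \<and> dist t t0 < 1"
      by (auto simp: eventually_at intro!: exI[of _ 1])
    then show "\<forall>\<^sub>F t in at t0 within {0..}. norm (T t (y t - y t0)) \<le> M * norm (y t - y t0)"
    proof eventually_elim
      case (elim t)
      then show ?case
        using norm_blinfun[of "T t" "y t - y t0"] mult_right_mono[OF M(2)[of t], of "norm (y t - y t0)"]
        by (auto simp: dist_real_def abs_less_iff)
    qed
    have "((\<lambda>t. M * norm (y t - y t0)) \<longlongrightarrow> M * norm (y t0 - y t0)) (at t0 within {0..})"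
      using y t0 by (intro tendsto_intros) (auto simp: continuous_on_def)
    then show "((\<lambda>t. M * norm (y t - y t0)) \<longlongrightarrow> 0) (at t0 within {0..})" by simp
  qed
  moreover have "((\<lambda>t. T t (y t0)) \<longlongrightarrow> T t0 (y t0)) (at t0 within {0..})"
    using T_cont t0 by (auto simp: continuous_on_def)
  ultimately have "((\<lambda>t. T t (y t - y t0) + T t (y t0)) \<longlongrightarrow> 0 + T t0 (y t0)) (at t0 within {0..})"
    by (rule tendsto_add)
  then show "((\<lambda>t. T t (y t)) \<longlongrightarrow> T t0 (y t0)) (at t0 within {0..})"
    by (simp add: blinfun.diff_right)
qed

lemma Q_form:
  assumes "0 \<le> t"
  shows "Q_op T Q t x \<bullet> y = integral {0..t} (\<lambda>s. Q (TA s x) \<bullet> TA s y)"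
proof -
  have "(\<lambda>s. T s (Q (TA s x))) integrable_on {0..t}"
    by (intro integrable_continuous_interval continuous_on_subset[OF T_apply_cont] continuous_intros TA_cont) auto
  from integral_linear[OF this bounded_linear_inner_left, of y]
  show ?thesis by (simp add: Q_op_def o_def TA_inner)
qed

lemma Q_form_cont: "0 \<le> a \<Longrightarrow> continuous_on {a..b} (\<lambda>s. Q (TA s x) \<bullet> TA s y)"
  by (intro continuous_intros continuous_on_subset[OF TA_cont]) auto

lemma Q_form_integrable: "0 \<le> a \<Longrightarrow> (\<lambda>s. Q (TA s x) \<bullet> TA s y) integrable_on {a..b}"
  by (intro integrable_continuous_interval Q_form_cont)

lemma Q_op_bound:
  obtains M where "M \<ge> 0" "\<And>t x y. 0 \<le> t \<Longrightarrow> t \<le> b \<Longrightarrow> \<bar>Q_op T Q t x \<bullet> y\<bar> \<le> M * t * (norm x * norm y)"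
proof -
  obtain M where M: "M \<ge> 1" "\<And>t. 0 \<le> t \<Longrightarrow> t \<le> b \<Longrightarrow> norm (T t) \<le> M"
    using C0_semigroup_locally_bounded[OF C0] by metis
  show ?thesis
  proof (rule that[of "norm Q * M * M"])
    show "0 \<le> norm Q * M * M" using M(1) by simp
    fix t x y assume t: "0 \<le> (t::real)" "t \<le> b"
    have "norm (integral {0..t} (\<lambda>s. Q (TA s x) \<bullet> TA s y)) \<le> norm Q * M * M * (norm x * norm y) * (t - 0)"
    proof (rule integral_bound[OF t(1)])
      fix s assume s: "s \<in> {0..t}"
      have A: "norm (TA s z) \<le> M * norm z" for z
        using TA_norm[of s z] mult_right_mono[OF M(2)[of s], of "norm z"] s t by auto
      have "norm (Q (TA s x) \<bullet> TA s y) \<le> norm (Q (TA s x)) * norm (TA s y)"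
        using Cauchy_Schwarz_ineq2 by simp
      also have "\<dots> \<le> (norm Q * norm (TA s x)) * norm (TA s y)"
        by (intro mult_right_mono norm_blinfun) auto
      also have "\<dots> \<le> (norm Q * (M * norm x)) * (M * norm y)"
        using M(1) by (intro mult_mono mult_left_mono A) auto
      finally show "norm (Q (TA s x) \<bullet> TA s y) \<le> norm Q * M * M * (norm x * norm y)"
        by (simp add: algebra_simps)
    qed (rule Q_form_cont, simp)
    then show "\<bar>Q_op T Q t x \<bullet> y\<bar> \<le> norm Q * M * M * t * (norm x * norm y)"
      using Q_form[OF t(1)] by (simp add: algebra_simps)
  qed
qed

lemma Q_op_bounded_linear:
  assumes t: "0 \<le> t" shows "bounded_linear (Q_op T Q t)"
proof -
  obtain M where M: "M \<ge> 0" "\<And>x y. \<bar>Q_op T Q t x \<bullet> y\<bar> \<le> M * t * (norm x * norm y)"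
    using Q_op_bound[of t] t by (metis order_refl)
  note lins = linear_add[OF TA_linear] linear_scale[OF TA_linear]
  show ?thesis
  proof (rule bounded_linear_intro)
    show "Q_op T Q t (x + y) = Q_op T Q t x + Q_op T Q t y" for x y
      by (rule inner_eq_imp_eq)
        (simp add: inner_add_left Q_form[OF t] lins blinfun.add_right integral_add Q_form_integrable)
    show "Q_op T Q t (r *\<^sub>R x) = r *\<^sub>R Q_op T Q t x" for r x
      by (rule inner_eq_imp_eq) (simp add: Q_form[OF t] lins blinfun.scaleR_right)
    show "norm (Q_op T Q t x) \<le> norm x * (M * t)" for x
    proof (cases "Q_op T Q t x = 0")
      case False
      have "norm (Q_op T Q t x) * norm (Q_op T Q t x) \<le> (norm x * (M * t)) * norm (Q_op T Q t x)"
        using M(2)[of x "Q_op T Q t x"] by (simp add: dot_square_norm power2_eq_square algebra_simps)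
      then show ?thesis using False by simp
    qed (use M t in simp)
  qed
qed

lemma Q_op_selfadjoint: "0 \<le> t \<Longrightarrow> selfadjoint (Q_op T Q t)"
  using Q_sa by (simp add: selfadjoint_def Q_form inner_commute[of _ "Q_op T Q t _"] inner_commute[of "Q _"])

lemma Q_op_nonneg: "0 \<le> t \<Longrightarrow> nonneg_op (Q_op T Q t)"
  using Q_nn by (auto simp: nonneg_op_def Q_form intro!: integral_nonneg Q_form_integrable)

lemma Q_op_mono:
  assumes "0 \<le> s" "s \<le> t" shows "Q_op T Q s x \<bullet> x \<le> Q_op T Q t x \<bullet> x"
  using assms Q_nn by (auto simp: Q_form nonneg_op_def intro!: integral_subset_le Q_form_integrable)

text \<open>The cocycle identity \<open>Q_(s+t)\<close> = \<open>Q_t + T t Q_s TA t\<close> in weak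
  form, obtained by cutting the integral at \<open>t\<close>. It is the source of the convolution
  law of the Gaussian measures and hence of the semigroup law.\<close>

lemma Q_op_add:
  assumes s: "0 \<le> s" and t: "0 \<le> t"
  shows "Q_op T Q (s + t) x \<bullet> y = Q_op T Q t x \<bullet> y + Q_op T Q s (TA t x) \<bullet> TA t y"
proof -
  have "Q_op T Q s (TA t x) \<bullet> TA t y = integral {0..s} (\<lambda>r. Q (TA (r + t) x) \<bullet> TA (r + t) y)"
    unfolding Q_form[OF s] using t by (intro integral_cong) (simp add: TA_add)
  also have "\<dots> = integral {t..s + t} (\<lambda>r. Q (TA r x) \<bullet> TA r y)"
    using integral_shift_Icc_real[of 0 s "\<lambda>r. Q (TA r x) \<bullet> TA r y" t] by (simp add: o_def add.commute[of t])
  finally show ?thesis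
    using s t by (simp add: Q_form Henstock_Kurzweil_Integration.integral_combine Q_form_integrable)
qed

lemma Q_op_tendsto_0: "((\<lambda>s. Q_op T Q s x \<bullet> x) \<longlongrightarrow> 0) (at_right 0)"
proof -
  obtain M where M: "M \<ge> 0" "\<And>t. 0 \<le> t \<Longrightarrow> t \<le> 1 \<Longrightarrow> \<bar>Q_op T Q t x \<bullet> x\<bar> \<le> M * t * (norm x * norm x)"
    using Q_op_bound[of 1] by metis
  show ?thesis
  proof (rule Lim_null_comparison)
    have "\<forall>\<^sub>F t in at_right 0. 0 < t \<and> t < (1::real)"
      by (auto simp: eventually_at_right_field intro: exI[of _ 1])
    then show "\<forall>\<^sub>F t in at_right 0. norm (Q_op T Q t x \<bullet> x) \<le> M * t * (norm x * norm x)"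
      by eventually_elim (simp add: M)
    show "((\<lambda>t. M * t * (norm x * norm x)) \<longlongrightarrow> 0) (at_right 0)"
      by (intro tendsto_eq_intros) auto
  qed
qed

end

section \<open>Gaussian measures on Hilbert spaces\<close>

text \<open>
  Measures with equal characteristic functions agree on finite intersections of half-spaces: the
  exponential factors are replaced by indicators one at a time. The weights \<open>1 + cos\<close> and \<open>1 + sin\<close>
  keep the measures positive, so that Levy's uniqueness theorem applies at each step.
\<close>

lemma weighted_half_line_eq:
  fixes w X :: "'b \<Rightarrow> real"
  assumes "finite_measure \<mu>" "finite_measure \<nu>" and sets: "sets \<nu> = sets \<mu>"
    and w[measurable]: "w \<in> borel_measurable \<mu>" and w0: "\<And>y. 0 \<le> w y" and wB: "\<And>y. w y \<le> B"
    and X[measurable]: "X \<in> borel_measurable \<mu>"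
    and eq: "\<And>t. (CLINT y|\<mu>. w y * iexp (t * X y)) = (CLINT y|\<nu>. w y * iexp (t * X y))"
  shows "(LINT y|\<mu>. w y * indicator {..a} (X y)) = (LINT y|\<nu>. w y * indicator {..a} (X y))"
proof -
  note [measurable_cong] = sets
  interpret \<mu>: finite_measure \<mu> by fact
  interpret \<nu>: finite_measure \<nu> by fact
  have int\<mu>: "integrable \<mu> w" by (rule \<mu>.integrable_const_bound[of _ B]) (auto simp: w0 wB)
  have int\<nu>: "integrable \<nu> w" by (rule \<nu>.integrable_const_bound[of _ B]) (auto simp: w0 wB)
  define c where "c = (LINT y|\<mu>. w y)"
  have c\<nu>: "c = (LINT y|\<nu>. w y)"
    using eq[of 0] unfolding c_def by simp
  have c0: "c \<ge> 0" unfolding c_def by (simp add: w0)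
  show ?thesis
  proof (cases "c = 0")
    case True
    have "AE y in \<mu>. w y = 0"
      using integral_nonneg_eq_0_iff_AE[OF int\<mu>] w0 True c_def by auto
    then have 1: "(LINT y|\<mu>. w y * indicator {..a} (X y)) = 0"
      by (intro integral_eq_zero_AE) auto
    have "AE y in \<nu>. w y = 0"
      using integral_nonneg_eq_0_iff_AE[OF int\<nu>] w0 True c\<nu> by auto
    then have "(LINT y|\<nu>. w y * indicator {..a} (X y)) = 0"
      by (intro integral_eq_zero_AE) auto
    with 1 show ?thesis by simp
  next
    case False
    then have c: "c > 0" using c0 by simp
    \<comment> \<open>The law of \<open>X\<close> under the normalised weight. Division by the total
      mass \<open>c\<close> is why a vanishing weight is treated separately.\<close>
    define R where "R M = distr (density M (\<lambda>y. ennreal (w y / c))) borel X" for M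
    have R: "real_distribution (R M)"
      "char (R M) t = (CLINT y|M. w y * iexp (t * X y)) / c"
      "c * measure (R M) {..a} = (LINT y|M. w y * indicator {..a} (X y))"
      if M: "sets M = sets \<mu>" "integrable M w" "(LINT y|M. w y) = c" for M t
    proof -
      note [measurable_cong] = M(1)
      have "(\<integral>\<^sup>+y. ennreal (w y / c) \<partial>M) = ennreal (LINT y|M. w y / c)"
        using M(2) w0 c by (intro nn_integral_eq_integral) auto
      then have "prob_space (density M (\<lambda>y. ennreal (w y / c)))"
        using M(3) c by (intro prob_spaceI) (simp add: emeasure_density cong: nn_integral_cong)
      then have "prob_space (R M)" unfolding R_def by (intro prob_space.prob_space_distr) auto
      then show rd: "real_distribution (R M)"
        by (simp add: real_distribution_def real_distribution_axioms_def R_def)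
      have "char (R M) t = (CLINT y|M. (w y / c) *\<^sub>R iexp (t * X y))"
        unfolding char_def R_def using w0 c by (simp add: integral_distr integral_density)
      also have "\<dots> = (CLINT y|M. (w y * iexp (t * X y)) / c)"
        by (intro Bochner_Integration.integral_cong) (auto simp: scaleR_conv_of_real)
      finally show "char (R M) t = (CLINT y|M. w y * iexp (t * X y)) / c" by simp
      interpret RM: real_distribution "R M" by fact
      have "measure (R M) {..a} = (LINT x|R M. indicator {..a} x)" by simp
      also have "\<dots> = (LINT y|M. (w y / c) *\<^sub>R indicator {..a} (X y))"
        unfolding R_def using w0 c by (subst integral_distr) (auto simp: integral_density simp del: indicator_simps)
      also have "\<dots> = (LINT y|M. w y * indicator {..a} (X y)) / c"
        by (simp add: mult.commute)
      finally show "c * measure (R M) {..a} = (LINT y|M. w y * indicator {..a} (X y))" using c by simp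
    qed
    have "R \<mu> = R \<nu>"
    proof (rule Levy_uniqueness)
      show "real_distribution (R \<mu>)" "real_distribution (R \<nu>)"
        using int\<mu> int\<nu> sets c_def c\<nu> by (auto intro!: R(1))
      show "char (R \<mu>) = char (R \<nu>)"
        using int\<mu> int\<nu> sets c_def c\<nu> eq by (auto simp: R(2) fun_eq_iff)
    qed
    then show ?thesis using R(3)[of \<mu>] R(3)[of \<nu>] int\<mu> int\<nu> sets c_def c\<nu> by simp
  qed
qed

text \<open>Lists of constraints are convenient twice: appending them gives intersections, so the
  cylinders are stable under intersection, and an induction can add one half-space at a
  time.\<close>

definition half_space_cylinder :: "('a::real_inner \<times> real) list \<Rightarrow> 'a set" where
  "half_space_cylinder L = {x. \<forall>(k, a)\<in>set L. x \<bullet> k \<le> a}"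

lemma half_space_cylinder_measurable[measurable]:
  "half_space_cylinder L \<in> sets (borel :: 'a::{real_inner,second_countable_topology} measure)"
proof -
  have "half_space_cylinder L = (\<Inter>p\<in>set L. {x. x \<bullet> fst p \<le> snd p})"
    by (auto simp: half_space_cylinder_def case_prod_beta)
  moreover have "closed (\<Inter>p\<in>set L. {x :: 'a. x \<bullet> fst p \<le> snd p})"
    by (intro closed_INT ballI closed_Collect_le continuous_intros)
  ultimately show ?thesis by simp
qed

text \<open>A closed ball is an intersection of half-spaces (z - x) . d \<le> r norm d over a
  countable dense set of \<open>d\<close>: by closure the inequality extends to d = z - x. Open sets
  are countable unions of such balls.\<close>

lemma borel_eq_half_space_cylinders:
  "sets (borel :: 'a::{real_inner,second_countable_topology} measure) = sigma_sets UNIV (range half_space_cylinder)"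
proof
  show "sigma_sets UNIV (range half_space_cylinder) \<subseteq> sets (borel :: 'a measure)"
    using sets.sigma_sets_subset[of "range (half_space_cylinder :: _ \<Rightarrow> 'a set)" borel]
    by (auto simp: image_subset_iff half_space_cylinder_measurable)
  interpret S: sigma_algebra UNIV "sigma_sets UNIV (range (half_space_cylinder :: _ \<Rightarrow> 'a set))"
    by (rule sigma_algebra_sigma_sets) auto
  obtain D :: "'a set" where D: "countable D" "\<And>X. open X \<Longrightarrow> X \<noteq> {} \<Longrightarrow> \<exists>d\<in>D. d \<in> X"
    using countable_dense_setE by metis
  obtain d0 where "d0 \<in> D" using D(2)[of UNIV] by auto
  have dns: "closure D = UNIV"
    using D(2) by (auto simp: closure_def islimpt_def)
  have cb: "cball x r \<in> sigma_sets UNIV (range half_space_cylinder)" if r: "r \<ge> 0" for x :: 'a and r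
  proof -
    have "cball x r = (\<Inter>d\<in>D. {z. z \<bullet> d \<le> r * norm d + x \<bullet> d})"
    proof (intro set_eqI iffI)
      fix z assume z: "z \<in> cball x r"
      have "(z - x) \<bullet> d \<le> r * norm d" for d
        using norm_cauchy_schwarz[of "z - x" d] mult_right_mono[of "norm (z - x)" r "norm d"] z
        by (simp add: dist_norm norm_minus_commute)
      then show "z \<in> (\<Inter>d\<in>D. {z. z \<bullet> d \<le> r * norm d + x \<bullet> d})" by (simp add: inner_diff_left algebra_simps)
    next
      fix z assume "z \<in> (\<Inter>d\<in>D. {z. z \<bullet> d \<le> r * norm d + x \<bullet> d})"
      then have "D \<subseteq> {d. (z - x) \<bullet> d \<le> r * norm d}" by (auto simp: inner_diff_left algebra_simps)
      moreover have "closed {d. (z - x) \<bullet> d \<le> r * norm d}" by (intro closed_Collect_le continuous_intros)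
      ultimately have "closure D \<subseteq> {d. (z - x) \<bullet> d \<le> r * norm d}" by (rule closure_minimal)
      then have "\<And>d. (z - x) \<bullet> d \<le> r * norm d" using dns by auto
      from this[of "z - x"] have *: "norm (z - x) * norm (z - x) \<le> r * norm (z - x)"
        by (simp add: dot_square_norm power2_eq_square)
      show "z \<in> cball x r"
        using * r by (cases "z = x") (auto simp: dist_norm norm_minus_commute)
    qed
    also have "\<dots> = (\<Inter>d\<in>D. half_space_cylinder [(d, r * norm d + x \<bullet> d)])"
      by (auto simp: half_space_cylinder_def)
    also have "\<dots> \<in> sigma_sets UNIV (range half_space_cylinder)"
      using D(1) \<open>d0 \<in> D\<close> by (intro S.countable_INT') auto
    finally show ?thesis .
  qed
  have "U \<in> sigma_sets UNIV (range half_space_cylinder)" if U: "open U" for U :: "'a set"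
  proof -
    have "U = (\<Union>p\<in>{p \<in> D \<times> (\<rat> \<inter> {0..}). cball (fst p) (snd p) \<subseteq> U}. cball (fst p) (snd p))"
    proof (intro set_eqI iffI)
      fix x assume "x \<in> U"
      then obtain e where e: "e > 0" "ball x e \<subseteq> U" using U by (auto simp: open_contains_ball)
      obtain q where q: "q \<in> \<rat>" "e/4 < q" "q < e/2" using Rats_dense_in_real[of "e/4" "e/2"] e by auto
      obtain d where d: "d \<in> D" "d \<in> ball x (e/4)" using D(2)[of "ball x (e/4)"] e by auto
      have "cball d q \<subseteq> ball x e"
      proof
        fix y assume "y \<in> cball d q"
        then have "dist x y < e" using dist_triangle[of x y d] d(2) q e by auto
        then show "y \<in> ball x e" by simp
      qed
      moreover have "x \<in> cball d q" using d(2) q by (simp add: dist_commute)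
      ultimately show "x \<in> (\<Union>p\<in>{p \<in> D \<times> (\<rat> \<inter> {0..}). cball (fst p) (snd p) \<subseteq> U}. cball (fst p) (snd p))"
        using d(1) q e by (intro UN_I[of "(d, q)"]) auto
    qed auto
    also have "\<dots> \<in> sigma_sets UNIV (range half_space_cylinder)"
    proof (rule S.countable_UN'')
      have "countable (D \<times> \<rat> :: ('a \<times> real) set)" by (intro countable_SIGMA D(1) countable_rat)
      then show "countable {p \<in> D \<times> (\<rat> \<inter> {0..}). cball (fst p) (snd p) \<subseteq> U}"
        by (rule countable_subset[rotated]) auto
    qed (rule cb, auto)
    finally show ?thesis .
  qed
  then have "{S :: 'a set. open S} \<subseteq> sigma_sets UNIV (range half_space_cylinder)" by auto
  then have "sigma_sets UNIV {S :: 'a set. open S} \<subseteq> sigma_sets UNIV (range half_space_cylinder)"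
    by (rule sigma_sets_mono)
  then show "sets (borel :: 'a measure) \<subseteq> sigma_sets UNIV (range half_space_cylinder)"
    by (simp add: borel_def)
qed

definition char_fun :: "'a::real_inner measure \<Rightarrow> 'a \<Rightarrow> complex" where
  "char_fun M h = (CLINT y|M. iexp (y \<bullet> h))"

lemma measure_eqI_char_fun:
  fixes \<mu> \<nu> :: "'a::{real_inner,second_countable_topology} measure"
  assumes "prob_space \<mu>" "prob_space \<nu>" and s[measurable_cong]: "sets \<mu> = sets borel" "sets \<nu> = sets borel"
    and eq: "\<And>h. char_fun \<mu> h = char_fun \<nu> h"
  shows "\<mu> = \<nu>"
proof -
  interpret \<mu>: prob_space \<mu> by fact
  interpret \<nu>: prob_space \<nu> by fact
  define agree :: "('a \<Rightarrow> complex) \<Rightarrow> bool" where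
    "agree g \<longleftrightarrow> integrable \<mu> g \<and> integrable \<nu> g \<and> integral\<^sup>L \<mu> g = integral\<^sup>L \<nu> g" for g
  have ag: "agree (\<lambda>y. g y + g' y)" "agree (\<lambda>y. g y - g' y)" if "agree g" "agree g'" for g g'
    using that by (auto simp: agree_def)
  have agc: "agree (\<lambda>y. c * g y)" if "agree g" for c g
    using that by (auto simp: agree_def)
  define C where "C = (half_space_cylinder :: _ \<Rightarrow> 'a set)"
  have [measurable]: "C L \<in> sets borel" for L by (simp add: C_def)
  have int: "integrable \<mu> (\<lambda>y. indicator (C L) y * iexp (y \<bullet> h))" "integrable \<nu> (\<lambda>y. indicator (C L) y * iexp (y \<bullet> h))" for L h
    by (auto intro!: \<mu>.integrable_const_bound[of _ 1] \<nu>.integrable_const_bound[of _ 1] simp: indicator_def)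
  \<comment> \<open>The induction carries a free exponential factor along. Having the claim for
    every \<open>h\<close> is what supplies, at the next half-space, equality of the characteristic
    functions of the new coordinate.\<close>
  have main: "agree (\<lambda>y. indicator (C L) y * iexp (y \<bullet> h))" for L h
  proof (induction L arbitrary: h)
    case Nil
    then show ?case using int[of "[]"] eq[of h] by (simp add: C_def half_space_cylinder_def agree_def char_fun_def)
  next
    case (Cons p L)
    obtain k a where p: "p = (k, a)" by force
    have I: "indicator (C (p # L)) y = (indicator (C L) y * indicator {..a} (y \<bullet> k) :: real)" for y
      by (auto simp: C_def half_space_cylinder_def p indicator_def)
    \<comment> \<open>\<open>v\<close> will be 1, 1 + cos (y . h) and 1 + sin (y . h). Expanding cos
      and sin in exponentials reduces the last two to the induction hypothesis, and subtracting the
      case v = 1 leaves the real and imaginary parts of the exponential.\<close>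
    have step: "(LINT y|\<mu>. (indicator (C L) y * v y) * indicator {..a} (y \<bullet> k)) = (LINT y|\<nu>. (indicator (C L) y * v y) * indicator {..a} (y \<bullet> k))"
      if v: "\<And>y. 0 \<le> v y" "\<And>y. v y \<le> 2" "v \<in> borel_measurable borel"
        "\<And>h'. agree (\<lambda>y. indicator (C L) y * v y * iexp (y \<bullet> h'))" for v :: "'a \<Rightarrow> real"
    proof (rule weighted_half_line_eq[where B=2])
      note [measurable] = v(3)
      show "finite_measure \<mu>" "finite_measure \<nu>" by unfold_locales
      show "(\<lambda>y. indicator (C L) y * v y) \<in> borel_measurable \<mu>" by measurable
      show "0 \<le> indicator (C L) y * v y" "indicator (C L) y * v y \<le> 2" for y
        using v(1,2) by (auto simp: indicator_def)
      fix t
      have "agree (\<lambda>y. indicator (C L) y * v y * iexp (y \<bullet> (t *\<^sub>R k)))" by (rule v(4))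
      then show "(CLINT y|\<mu>. complex_of_real (indicator (C L) y * v y) * iexp (t * (y \<bullet> k))) =
            (CLINT y|\<nu>. complex_of_real (indicator (C L) y * v y) * iexp (t * (y \<bullet> k)))"
        by (simp add: agree_def)
    qed (auto simp: s)
    have E: "iexp (y \<bullet> (h1 + h2)) = iexp (y \<bullet> h1) * iexp (y \<bullet> h2)" for y h1 h2 :: 'a
      by (simp add: inner_add_right algebra_simps exp_add)
    have b1: "0 \<le> 1 + cos x" "1 + cos x \<le> 2" for x :: real
      using cos_ge_minus_one[of x] cos_le_one[of x] by linarith+
    have b2: "0 \<le> 1 + sin x" "1 + sin x \<le> 2" for x :: real
      using sin_ge_minus_one[of x] sin_le_one[of x] by linarith+
    have cosE: "complex_of_real (cos x) = (iexp x + iexp (- x)) / 2" for x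
      by (simp add: cos_of_real[symmetric] cos_exp_eq)
    have sinE: "complex_of_real (sin x) = (iexp x - iexp (- x)) / (2 * \<i>)" for x
      by (simp add: sin_of_real[symmetric] sin_exp_eq)
    have one: "(LINT y|\<mu>. indicator (C L) y * indicator {..a} (y \<bullet> k)) = (LINT y|\<nu>. indicator (C L) y * indicator {..a} (y \<bullet> k) :: real)"
      using step[of "\<lambda>_. 1"] Cons.IH by (simp add: of_real_indicator)
    have c: "(LINT y|\<mu>. (indicator (C L) y * (1 + cos (y \<bullet> h))) * indicator {..a} (y \<bullet> k)) = (LINT y|\<nu>. (indicator (C L) y * (1 + cos (y \<bullet> h))) * indicator {..a} (y \<bullet> k))"
    proof (rule step)
      fix h'
      have "agree (\<lambda>y. indicator (C L) y * iexp (y \<bullet> h') + ((1/2) * (indicator (C L) y * iexp (y \<bullet> (h + h'))) + (1/2) * (indicator (C L) y * iexp (y \<bullet> (- h + h')))))"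
        by (intro ag agc Cons.IH)
      also have "(\<lambda>y. indicator (C L) y * iexp (y \<bullet> h') + ((1/2) * (indicator (C L) y * iexp (y \<bullet> (h + h'))) + (1/2) * (indicator (C L) y * iexp (y \<bullet> (- h + h'))))) = (\<lambda>y. indicator (C L) y * complex_of_real (1 + cos (y \<bullet> h)) * iexp (y \<bullet> h'))"
        unfolding E of_real_add cosE by (simp add: fun_eq_iff algebra_simps add_divide_distrib)
      finally show "agree (\<lambda>y. complex_of_real (indicator (C L) y * (1 + cos (y \<bullet> h))) * iexp (y \<bullet> h'))"
        by (simp add: of_real_indicator)
    qed (auto simp: b1 b2)
    have sn: "(LINT y|\<mu>. (indicator (C L) y * (1 + sin (y \<bullet> h))) * indicator {..a} (y \<bullet> k)) = (LINT y|\<nu>. (indicator (C L) y * (1 + sin (y \<bullet> h))) * indicator {..a} (y \<bullet> k))"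
    proof (rule step)
      fix h'
      have "agree (\<lambda>y. indicator (C L) y * iexp (y \<bullet> h') + ((1/(2*\<i>)) * (indicator (C L) y * iexp (y \<bullet> (h + h'))) - (1/(2*\<i>)) * (indicator (C L) y * iexp (y \<bullet> (- h + h')))))"
        by (intro ag agc Cons.IH)
      also have "(\<lambda>y. indicator (C L) y * iexp (y \<bullet> h') + ((1/(2*\<i>)) * (indicator (C L) y * iexp (y \<bullet> (h + h'))) - (1/(2*\<i>)) * (indicator (C L) y * iexp (y \<bullet> (- h + h'))))) = (\<lambda>y. indicator (C L) y * complex_of_real (1 + sin (y \<bullet> h)) * iexp (y \<bullet> h'))"
        unfolding E of_real_add sinE by (simp add: fun_eq_iff algebra_simps diff_divide_distrib)
      finally show "agree (\<lambda>y. complex_of_real (indicator (C L) y * (1 + sin (y \<bullet> h))) * iexp (y \<bullet> h'))"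
        by (simp add: of_real_indicator)
    qed (auto simp: b1 b2)
    have bi: "integrable M (\<lambda>y. indicator (C (p # L)) y * f (y \<bullet> h))"
      if "M = \<mu> \<or> M = \<nu>" "\<And>x. \<bar>f x\<bar> \<le> 1" "f \<in> borel_measurable borel" for M and f :: "real \<Rightarrow> real"
      using that by (auto intro!: \<mu>.integrable_const_bound[of _ 1] \<nu>.integrable_const_bound[of _ 1] simp: indicator_def)
    have split: "(LINT y|M. (indicator (C L) y * (1 + f (y \<bullet> h))) * indicator {..a} (y \<bullet> k)) =
        (LINT y|M. indicator (C L) y * indicator {..a} (y \<bullet> k)) + (LINT y|M. indicator (C (p # L)) y * f (y \<bullet> h))"
      if "M = \<mu> \<or> M = \<nu>" "\<And>x. \<bar>f x\<bar> \<le> 1" "f \<in> borel_measurable borel" for M and f :: "real \<Rightarrow> real"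
    proof -
      have "(LINT y|M. (indicator (C L) y * (1 + f (y \<bullet> h))) * indicator {..a} (y \<bullet> k)) =
        (LINT y|M. indicator (C (p # L)) y + indicator (C (p # L)) y * f (y \<bullet> h))"
        by (intro Bochner_Integration.integral_cong) (auto simp: I algebra_simps)
      also have "\<dots> = (LINT y|M. indicator (C (p # L)) y) + (LINT y|M. indicator (C (p # L)) y * f (y \<bullet> h))"
        using bi[OF that] bi[OF that(1), of "\<lambda>_. 1"] by simp
      finally show ?thesis by (simp add: I)
    qed
    have rc: "(LINT y|\<mu>. indicator (C (p # L)) y * cos (y \<bullet> h)) = (LINT y|\<nu>. indicator (C (p # L)) y * cos (y \<bullet> h))"
      using c one by (subst (asm) (1 2) split) auto
    have rs: "(LINT y|\<mu>. indicator (C (p # L)) y * sin (y \<bullet> h)) = (LINT y|\<nu>. indicator (C (p # L)) y * sin (y \<bullet> h))"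
      using sn one by (subst (asm) (1 2) split) auto
    have "(CLINT y|\<mu>. indicator (C (p # L)) y * iexp (y \<bullet> h)) = (CLINT y|\<nu>. indicator (C (p # L)) y * iexp (y \<bullet> h))"
    proof -
      have "(\<lambda>y. indicator (C (p # L)) y * iexp (y \<bullet> h)) = (\<lambda>y. complex_of_real (indicator (C (p # L)) y * cos (y \<bullet> h)) + \<i> * complex_of_real (indicator (C (p # L)) y * sin (y \<bullet> h)))"
        by (auto simp: fun_eq_iff indicator_def exp_Euler cos_of_real sin_of_real)
      moreover have "(CLINT y|M. complex_of_real (indicator (C (p # L)) y * cos (y \<bullet> h)) + \<i> * complex_of_real (indicator (C (p # L)) y * sin (y \<bullet> h))) =
          complex_of_real (LINT y|M. indicator (C (p # L)) y * cos (y \<bullet> h)) + \<i> * complex_of_real (LINT y|M. indicator (C (p # L)) y * sin (y \<bullet> h))" if "M = \<mu> \<or> M = \<nu>" for M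
        using bi[OF that, of cos] bi[OF that, of sin]
        by (subst Bochner_Integration.integral_add)
          (auto intro!: integrable_of_real simp only: integral_mult_right_zero integral_complex_of_real abs_cos_le_one abs_sin_le_one
            borel_measurable_cos borel_measurable_sin measurable_ident)
      ultimately show ?thesis using rc rs by simp
    qed
    then show ?case using int unfolding agree_def by blast
  qed
  show ?thesis
  proof (rule measure_eqI_generator_eq[where \<Omega>=UNIV and E="range C" and A="\<lambda>_. C []"])
    show "Int_stable (range C)"
    proof (rule Int_stableI, clarify)
      fix L L'
      have "C L \<inter> C L' = C (L @ L')" by (auto simp: C_def half_space_cylinder_def)
      then show "C L \<inter> C L' \<in> range C" by blast
    qed
    fix X assume "X \<in> range C"
    then obtain L where X: "X = C L" by auto
    have "complex_of_real (LINT y|\<mu>. indicator (C L) y) = complex_of_real (LINT y|\<nu>. indicator (C L) y)"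
      using main[of L 0] unfolding agree_def integral_complex_of_real[symmetric] by (simp add: of_real_indicator)
    then have "measure \<mu> X = measure \<nu> X"
      using X sets_eq_imp_space_eq[OF s(1)] sets_eq_imp_space_eq[OF s(2)] by simp
    then show "emeasure \<mu> X = emeasure \<nu> X"
      by (simp add: \<mu>.emeasure_eq_measure \<nu>.emeasure_eq_measure)
  next
    show "(\<Union>i::nat. C []) = UNIV" by (simp add: C_def half_space_cylinder_def)
    show "sets \<mu> = sigma_sets UNIV (range C)" "sets \<nu> = sigma_sets UNIV (range C)"
      by (simp_all add: s borel_eq_half_space_cylinders C_def)
  qed auto
qed

section \<open>Normal laws and the characterisation and construction of Gaussian measures\<close>

text \<open>Scaling a standard normal variable treats the degenerate law \<sigma> = 0 and the
  densities uniformly, so moments and characteristic functions need no further case split.\<close>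

lemma normal_law_eq_distr:
  assumes "\<sigma> \<ge> 0"
  shows "normal_law 0 \<sigma> = distr std_normal_distribution borel (\<lambda>x. \<sigma> * x)"
proof -
  interpret N: real_distribution std_normal_distribution by (rule real_dist_normal_dist)
  show ?thesis
  proof (cases "\<sigma> = 0")
    case True
    have "distr std_normal_distribution borel (\<lambda>x. 0) = return borel (0 :: real)"
    proof (rule measure_eqI)
      fix A :: "real set" assume "A \<in> sets (distr std_normal_distribution borel (\<lambda>x. 0))"
      then show "emeasure (distr std_normal_distribution borel (\<lambda>x. 0)) A = emeasure (return borel 0) A"
        using N.emeasure_space_1 by (cases "0 \<in> A") (auto simp: emeasure_distr)
    qed simp
    then show ?thesis using True by (simp add: normal_law_def)
  next
    case False
    then have s: "\<sigma> > 0" using assms by simp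
    have "distributed std_normal_distribution lborel (\<lambda>x. x) std_normal_density"
      by (simp add: distributed_def distr_id2 measurable_ident_sets)
    from N.normal_density_affine[OF this, of \<sigma> 0]
    have "distr std_normal_distribution lborel (\<lambda>x. \<sigma> * x) = density lborel (normal_density 0 \<sigma>)"
      using s by (simp add: distributed_distr_eq_density)
    moreover have "distr std_normal_distribution lborel (\<lambda>x. \<sigma> * x) = distr std_normal_distribution borel (\<lambda>x. \<sigma> * x)"
      by (intro distr_cong) auto
    ultimately show ?thesis using s by (simp add: normal_law_def)
  qed
qed

lemma std_normal_moments:
  "integrable std_normal_distribution (\<lambda>x. x)" "(LINT x|std_normal_distribution. x) = 0"
  "integrable std_normal_distribution (\<lambda>x. x\<^sup>2)" "(LINT x|std_normal_distribution. x\<^sup>2) = 1"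
  using integrable_std_normal_distribution_moment[of 1] integral_std_normal_distribution_moment_odd[of 1]
    integrable_std_normal_distribution_moment[of 2] std_normal_distribution_even_moments(1)[of 1]
  by (simp_all add: fact_numeral)

lemma normal_law_props:
  assumes s: "\<sigma> \<ge> 0"
  shows "real_distribution (normal_law 0 \<sigma>)"
    and "char (normal_law 0 \<sigma>) t = exp (- (\<sigma> * t)\<^sup>2 / 2)"
    and "integrable (normal_law 0 \<sigma>) (\<lambda>x. x\<^sup>2)"
    and "(LINT x|normal_law 0 \<sigma>. x\<^sup>2) = \<sigma>\<^sup>2"
proof -
  interpret N: real_distribution std_normal_distribution by (rule real_dist_normal_dist)
  note eq = normal_law_eq_distr[OF s]
  show "real_distribution (normal_law 0 \<sigma>)"
    unfolding eq by (intro N.real_distribution_distr) simp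
  have "char (normal_law 0 \<sigma>) t = char std_normal_distribution (\<sigma> * t)"
    unfolding eq char_def by (subst integral_distr) (auto simp: mult_ac)
  then show "char (normal_law 0 \<sigma>) t = exp (- (\<sigma> * t)\<^sup>2 / 2)"
    by (simp add: char_std_normal_distribution exp_of_real[symmetric])
  show "integrable (normal_law 0 \<sigma>) (\<lambda>x. x\<^sup>2)"
    unfolding eq by (subst integrable_distr_eq) (auto simp: power_mult_distrib std_normal_moments)
  show "(LINT x|normal_law 0 \<sigma>. x\<^sup>2) = \<sigma>\<^sup>2"
    unfolding eq by (subst integral_distr) (auto simp: power_mult_distrib std_normal_moments)
qed

lemma char_distr_inner:
  fixes \<mu> :: "'a::{real_inner,second_countable_topology} measure"
  assumes [measurable_cong]: "sets \<mu> = sets borel"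
  shows "char (distr \<mu> borel (\<lambda>y. y \<bullet> h)) t = char_fun \<mu> (t *\<^sub>R h)"
  unfolding char_def char_fun_def by (subst integral_distr) auto

lemma is_centered_gaussianD:
  fixes \<mu> :: "'a::{real_inner,banach,second_countable_topology} measure"
  assumes \<mu>: "is_centered_gaussian \<mu> S"
  shows "prob_space \<mu>" "sets \<mu> = sets borel" "space \<mu> = UNIV"
    "char_fun \<mu> h = exp (- (S h \<bullet> h) / 2)"
    "integrable \<mu> (\<lambda>y. (y \<bullet> h)\<^sup>2)" "(LINT y|\<mu>. (y \<bullet> h)\<^sup>2) = S h \<bullet> h"
proof -
  show "prob_space \<mu>" and s[measurable_cong]: "sets \<mu> = sets borel" using \<mu> by (auto simp: is_centered_gaussian_def)
  show "space \<mu> = UNIV" using sets_eq_imp_space_eq[OF s] by simp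
  obtain \<sigma> where \<sigma>: "\<sigma> \<ge> 0" "distr \<mu> borel (\<lambda>y. y \<bullet> h) = normal_law 0 \<sigma>"
    using \<mu> unfolding is_centered_gaussian_def by blast
  show "(LINT y|\<mu>. (y \<bullet> h)\<^sup>2) = S h \<bullet> h"
    using \<mu> by (auto simp: is_centered_gaussian_def power2_eq_square)
  moreover have "(LINT y|\<mu>. (y \<bullet> h)\<^sup>2) = (LINT x|distr \<mu> borel (\<lambda>y. y \<bullet> h). x\<^sup>2)"
    by (subst integral_distr) auto
  ultimately have "S h \<bullet> h = \<sigma>\<^sup>2" unfolding \<sigma> by (simp add: normal_law_props \<sigma>)
  then show "char_fun \<mu> h = exp (- (S h \<bullet> h) / 2)"
    using char_distr_inner[OF s, of h 1] by (simp add: \<sigma> normal_law_props(2))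
  have "integrable (distr \<mu> borel (\<lambda>y. y \<bullet> h)) (\<lambda>x. x\<^sup>2)"
    unfolding \<sigma> by (rule normal_law_props(3)[OF \<sigma>(1)])
  then show "integrable \<mu> (\<lambda>y. (y \<bullet> h)\<^sup>2)" by (subst (asm) integrable_distr_eq) auto
qed

text \<open>The characteristic function determines everything: along each direction Levy's theorem
  identifies the normal law, and polarisation turns the second moments into the covariance.\<close>

lemma is_centered_gaussianI:
  fixes \<mu> :: "'a::{real_inner,banach,second_countable_topology} measure"
  assumes ps: "prob_space \<mu>" and s[measurable_cong]: "sets \<mu> = sets borel"
    and S: "linear S" "selfadjoint S" "nonneg_op S"
    and cf: "\<And>h. char_fun \<mu> h = exp (- (S h \<bullet> h) / 2)"
  shows "is_centered_gaussian \<mu> S"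
proof -
  interpret prob_space \<mu> by fact
  define \<sigma> where "\<sigma> h = sqrt (S h \<bullet> h)" for h
  have \<sigma>: "\<sigma> h \<ge> 0" "(\<sigma> h)\<^sup>2 = S h \<bullet> h" for h using S(3) by (auto simp: \<sigma>_def nonneg_op_def)
  have d: "distr \<mu> borel (\<lambda>y. y \<bullet> h) = normal_law 0 (\<sigma> h)" for h
  proof (rule Levy_uniqueness)
    show "real_distribution (distr \<mu> borel (\<lambda>y. y \<bullet> h))" by (rule real_distribution_distr) measurable
    show "real_distribution (normal_law 0 (\<sigma> h))" by (rule normal_law_props[OF \<sigma>(1)])
    show "char (distr \<mu> borel (\<lambda>y. y \<bullet> h)) = char (normal_law 0 (\<sigma> h))"
      unfolding fun_eq_iff char_distr_inner[OF s] cf normal_law_props(2)[OF \<sigma>(1)] power_mult_distrib \<sigma>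
      by (simp add: linear_scale[OF S(1)]) (simp add: power2_eq_square algebra_simps)
  qed
  have i: "integrable \<mu> (\<lambda>y. (y \<bullet> h)\<^sup>2)" for h
  proof -
    have "integrable (distr \<mu> borel (\<lambda>y. y \<bullet> h)) (\<lambda>x. x\<^sup>2)"
      unfolding d by (rule normal_law_props(3)[OF \<sigma>(1)])
    then show ?thesis by (subst (asm) integrable_distr_eq) auto
  qed
  have m: "(LINT y|\<mu>. (y \<bullet> h)\<^sup>2) = S h \<bullet> h" for h
  proof -
    have "(LINT y|\<mu>. (y \<bullet> h)\<^sup>2) = (LINT x|distr \<mu> borel (\<lambda>y. y \<bullet> h). x\<^sup>2)"
      by (subst integral_distr) auto
    then show ?thesis by (simp add: d normal_law_props(4)[OF \<sigma>(1)] \<sigma>)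
  qed
  have "(LINT y|\<mu>. (y \<bullet> h) * (y \<bullet> k)) = S h \<bullet> k" for h k
  proof -
    have "(LINT y|\<mu>. (y \<bullet> h) * (y \<bullet> k)) = (LINT y|\<mu>. ((y \<bullet> (h + k))\<^sup>2 - (y \<bullet> (h - k))\<^sup>2) / 4)"
      by (intro Bochner_Integration.integral_cong) (auto simp: inner_simps power2_eq_square algebra_simps)
    also have "\<dots> = (S (h + k) \<bullet> (h + k) - S (h - k) \<bullet> (h - k)) / 4"
      using i by (simp add: m)
    also have "\<dots> = S h \<bullet> k"
      using S(2)[unfolded selfadjoint_def, rule_format, of k h]
      by (simp add: linear_add[OF S(1)] linear_diff[OF S(1)] inner_simps inner_commute)
    finally show ?thesis .
  qed
  then show ?thesis using ps s d \<sigma>(1) unfolding is_centered_gaussian_def by blast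
qed

lemma centered_gaussian_eqI:
  assumes "is_centered_gaussian \<mu> S"
  shows "centered_gaussian S = \<mu>"
  unfolding centered_gaussian_def
proof (rule the_equality[where a = \<mu>])
  show "is_centered_gaussian \<mu> S" by fact
  fix \<nu> assume "is_centered_gaussian \<nu> S"
  then show "\<nu> = \<mu>"
    using assms by (intro measure_eqI_char_fun) (simp_all add: is_centered_gaussianD)
qed

text \<open>The measure is the law of the random series of \<open>\<omega> n *\<^sub>R v n\<close>
  with independent standard normal coefficients. A subsequence of partial sums with fast decaying
  variances converges almost surely, and characteristic functions pass to the limit by dominated
  convergence.\<close>

lemma gaussian_series_exists:
  fixes v :: "nat \<Rightarrow> 'a::{real_inner,banach,second_countable_topology}"
  assumes sv: "summable (\<lambda>n. (norm (v n))\<^sup>2)"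
  obtains \<mu> :: "'a measure" where "prob_space \<mu>" "sets \<mu> = sets borel"
    "\<And>h s. (\<lambda>n. (v n \<bullet> h)\<^sup>2) sums s \<Longrightarrow> char_fun \<mu> h = exp (- s / 2)"
proof -
  let ?N = std_normal_distribution
  interpret N: real_distribution ?N by (rule real_dist_normal_dist)
  define M where "M = PiM UNIV (\<lambda>_::nat. ?N)"
  interpret P: product_prob_space "\<lambda>_::nat. ?N" UNIV by unfold_locales
  interpret M: prob_space M unfolding M_def by (rule P.prob_space_axioms)
  have [measurable]: "(\<lambda>\<omega>. \<omega> i) \<in> borel_measurable M" for i
  proof -
    have "(\<lambda>\<omega>. \<omega> i) \<in> measurable M ?N" unfolding M_def by (rule measurable_component_singleton) simp
    then show ?thesis by simp
  qed
  have comp: "distr M borel (\<lambda>\<omega>. \<omega> i) = ?N" for i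
  proof -
    have "distr M borel (\<lambda>\<omega>. \<omega> i) = distr M ?N (\<lambda>\<omega>. \<omega> i)" by (rule distr_cong) auto
    then show ?thesis using P.PiM_component[of i] by (simp add: M_def)
  qed
  have ind: "M.indep_vars (\<lambda>_. borel) (\<lambda>i \<omega>. \<omega> i) UNIV"
  proof (subst M.indep_vars_iff_distr_eq_PiM')
    have sp: "sets (PiM UNIV (\<lambda>_::nat. borel :: real measure)) = sets M"
      unfolding M_def by (intro sets_PiM_cong) auto
    show "distr M (Pi\<^sub>M UNIV (\<lambda>i. borel)) (\<lambda>x. \<lambda>i\<in>UNIV. x i) = (\<Pi>\<^sub>M i\<in>UNIV. distr M borel (\<lambda>\<omega>. \<omega> i))"
      unfolding comp using sp by (simp add: restrict_UNIV distr_id2) (simp add: M_def)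
  qed auto
  have int1: "integrable M (\<lambda>\<omega>. \<omega> i)" "(LINT \<omega>|M. \<omega> i) = 0" for i
  proof -
    have "integrable (distr M borel (\<lambda>\<omega>. \<omega> i)) (\<lambda>x. x)" "(LINT x|distr M borel (\<lambda>\<omega>. \<omega> i). x) = 0"
      unfolding comp by (rule std_normal_moments)+
    then show "integrable M (\<lambda>\<omega>. \<omega> i)" "(LINT \<omega>|M. \<omega> i) = 0"
      by (simp_all add: integrable_distr_eq integral_distr)
  qed
  have int2: "integrable M (\<lambda>\<omega>. (\<omega> i)\<^sup>2)" "(LINT \<omega>|M. (\<omega> i)\<^sup>2) = 1" for i
  proof -
    have "integrable (distr M borel (\<lambda>\<omega>. \<omega> i)) (\<lambda>x. x\<^sup>2)" "(LINT x|distr M borel (\<lambda>\<omega>. \<omega> i). x\<^sup>2) = 1"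
      unfolding comp by (rule std_normal_moments)+
    then show "integrable M (\<lambda>\<omega>. (\<omega> i)\<^sup>2)" "(LINT \<omega>|M. (\<omega> i)\<^sup>2) = 1"
      by (simp_all add: integrable_distr_eq integral_distr)
  qed
  have int3: "integrable M (\<lambda>\<omega>. \<omega> i * \<omega> j)" "(LINT \<omega>|M. \<omega> i * \<omega> j) = (if i = j then 1 else 0)" for i j
  proof -
    have "integrable M (\<lambda>\<omega>. \<omega> i * \<omega> j) \<and> (LINT \<omega>|M. \<omega> i * \<omega> j) = 0" if "i \<noteq> j"
    proof -
      have "M.indep_vars (\<lambda>_. borel) (\<lambda>i \<omega>. \<omega> i) {i, j}" by (rule M.indep_vars_subset[OF ind]) simp
      from M.indep_vars_lebesgue_integral[OF _ this] M.indep_vars_integrable[OF _ this] that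
      show ?thesis by (simp add: int1)
    qed
    then show "integrable M (\<lambda>\<omega>. \<omega> i * \<omega> j)" "(LINT \<omega>|M. \<omega> i * \<omega> j) = (if i = j then 1 else 0)"
      using int2[of i] by (auto simp: power2_eq_square)
  qed
  define Z where "Z F \<omega> = (\<Sum>k\<in>F. \<omega> k *\<^sub>R v k)" for F and \<omega> :: "nat \<Rightarrow> real"
  have [measurable]: "Z F \<in> borel_measurable M" for F unfolding Z_def by measurable
  have Z2: "(norm (Z F \<omega>))\<^sup>2 = (\<Sum>i\<in>F. \<Sum>j\<in>F. (\<omega> i * \<omega> j) * (v i \<bullet> v j))" for F \<omega>
    unfolding power2_norm_eq_inner Z_def
    by (simp add: inner_sum_left inner_sum_right mult.assoc sum_distrib_left inner_commute[of "v _" "v _"])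
  have intZ: "integrable M (\<lambda>\<omega>. (norm (Z F \<omega>))\<^sup>2)" for F
    unfolding Z2 by (intro Bochner_Integration.integrable_sum integrable_mult_left int3)
  have EZ: "(LINT \<omega>|M. (norm (Z F \<omega>))\<^sup>2) = (\<Sum>k\<in>F. (norm (v k))\<^sup>2)" if "finite F" for F
  proof -
    have "(LINT \<omega>|M. (norm (Z F \<omega>))\<^sup>2) = (\<Sum>i\<in>F. (LINT \<omega>|M. (\<Sum>j\<in>F. (\<omega> i * \<omega> j) * (v i \<bullet> v j))))"
      unfolding Z2 by (intro Bochner_Integration.integral_sum Bochner_Integration.integrable_sum integrable_mult_left int3)
    also have "\<dots> = (\<Sum>i\<in>F. \<Sum>j\<in>F. (LINT \<omega>|M. (\<omega> i * \<omega> j) * (v i \<bullet> v j)))"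
      by (intro sum.cong refl Bochner_Integration.integral_sum integrable_mult_left int3)
    also have "\<dots> = (\<Sum>i\<in>F. \<Sum>j\<in>F. (if i = j then 1 else 0) * (v i \<bullet> v j))"
      by (simp only: integral_mult_left_zero int3)
    also have "\<dots> = (\<Sum>i\<in>F. \<Sum>j\<in>F. if i = j then v i \<bullet> v i else 0)"
      by (intro sum.cong) auto
    finally show ?thesis using that by (simp add: power2_norm_eq_inner)
  qed
  have "\<exists>N. \<forall>m\<ge>N. \<forall>n. (\<Sum>k=m..<n. (norm (v k))\<^sup>2) < (1/4) ^ j" for j :: nat
    using sv[unfolded summable_Cauchy, rule_format, of "(1/4)^j"] by (simp add: sum_nonneg)
  then obtain R where R: "\<And>j m n. m \<ge> R j \<Longrightarrow> (\<Sum>k=m..<n. (norm (v k))\<^sup>2) < (1/4) ^ j" by metis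
  \<comment> \<open>The maximum makes \<open>r\<close> nondecreasing and at least
    \<open>R j\<close>, so that consecutive blocks have variance below 4^(-j); the summand
    \<open>j\<close> forces \<open>r\<close> to infinity.\<close>
  define r where "r j = Max (R ` {..j}) + j" for j
  have rR: "r j \<ge> R j" for j unfolding r_def by (rule trans_le_add1) simp
  have rj: "r j \<ge> j" for j by (simp add: r_def)
  have rmono: "r j \<le> r (Suc j)" for j unfolding r_def by (intro add_mono Max_mono) auto
  define Y where "Y j = Z {..<r j}" for j
  have [measurable]: "Y j \<in> borel_measurable M" for j by (simp add: Y_def)
  have dY: "Y (Suc j) \<omega> - Y j \<omega> = Z {r j..<r (Suc j)} \<omega>" for j \<omega>
    unfolding Y_def Z_def lessThan_atLeast0
    using sum_diff_nat_ivl[of 0 "r j" "r (Suc j)" "\<lambda>k. \<omega> k *\<^sub>R v k"] rmono by simp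
  have E1: "(\<integral>\<^sup>+\<omega>. ennreal (norm (Y (Suc j) \<omega> - Y j \<omega>)) \<partial>M) \<le> ennreal ((1/2) ^ j)" for j
  proof -
    let ?W = "\<lambda>\<omega>. (2 ^ j * (norm (Z {r j..<r (Suc j)} \<omega>))\<^sup>2 + (1/2) ^ j) / 2"
    \<comment> \<open>Weighted arithmetic-geometric mean inequality, in place of Cauchy-Schwarz for
      the expectation: with E(x^2) \<le> 4^(-j) the right side has mean at most 2^(-j).\<close>
    have le: "x \<le> (2 ^ j * x\<^sup>2 + (1/2) ^ j) / 2" for x :: real
    proof -
      have "0 \<le> 2 ^ j * (x - (1/2) ^ j)\<^sup>2" by simp
      also have "\<dots> = 2 ^ j * x\<^sup>2 + (1/2) ^ j - 2 * x"
        by (simp add: power2_eq_square field_simps power_one_over)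
      finally show ?thesis by simp
    qed
    have "(\<integral>\<^sup>+\<omega>. ennreal (norm (Y (Suc j) \<omega> - Y j \<omega>)) \<partial>M) \<le> (\<integral>\<^sup>+\<omega>. ennreal (?W \<omega>) \<partial>M)"
      unfolding dY by (intro nn_integral_mono ennreal_leI le)
    also have "\<dots> = ennreal (LINT \<omega>|M. ?W \<omega>)"
      by (intro nn_integral_eq_integral) (auto intro!: integrable_divide Bochner_Integration.integrable_add integrable_mult_right intZ)
    also have "(LINT \<omega>|M. ?W \<omega>) = (2 ^ j * (\<Sum>k=r j..<r (Suc j). (norm (v k))\<^sup>2) + (1/2) ^ j) / 2"
      using intZ by (simp add: EZ M.prob_space)
    also have "ennreal \<dots> \<le> ennreal ((2 ^ j * (1/4) ^ j + (1/2) ^ j) / 2)"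
      by (intro ennreal_leI divide_right_mono add_right_mono mult_left_mono less_imp_le[OF R] rR) auto
    also have "(2 ^ j * (1/4) ^ j + (1/2) ^ j) / 2 = (1/2 :: real) ^ j"
      by (simp flip: power_mult_distrib)
    finally show ?thesis .
  qed
  have ae: "AE \<omega> in M. (\<lambda>j. Y j \<omega>) \<longlonglongrightarrow> lim (\<lambda>j. Y j \<omega>)"
  proof -
    have "(\<integral>\<^sup>+\<omega>. (\<Sum>j. ennreal (norm (Y (Suc j) \<omega> - Y j \<omega>))) \<partial>M) = (\<Sum>j. \<integral>\<^sup>+\<omega>. ennreal (norm (Y (Suc j) \<omega> - Y j \<omega>)) \<partial>M)"
      by (rule nn_integral_suminf) measurable
    also have "\<dots> \<le> (\<Sum>j. ennreal ((1/2) ^ j))" by (intro suminf_le E1) auto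
    also have "\<dots> = ennreal (\<Sum>j. (1/2) ^ j)" by (intro suminf_ennreal2) (auto simp: summable_geometric)
    also have "\<dots> < \<infinity>" by simp
    finally have "AE \<omega> in M. (\<Sum>j. ennreal (norm (Y (Suc j) \<omega> - Y j \<omega>))) \<noteq> \<infinity>"
      by (intro nn_integral_PInf_AE) auto
    then show ?thesis
    proof eventually_elim
      case (elim \<omega>)
      then have "summable (\<lambda>j. norm (Y (Suc j) \<omega> - Y j \<omega>))"
        by (intro summable_suminf_not_top) auto
      then have "summable (\<lambda>j. Y (Suc j) \<omega> - Y j \<omega>)" by (rule summable_norm_cancel)
      then obtain l where "(\<lambda>n. Y n \<omega> - Y 0 \<omega>) \<longlonglongrightarrow> l"
        unfolding summable_iff_convergent convergent_def sum_lessThan_telescope[of "\<lambda>j. Y j \<omega>"] by blast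
      from tendsto_add[OF this tendsto_const[of "Y 0 \<omega>"]]
      have "convergent (\<lambda>j. Y j \<omega>)" by (auto simp: convergent_def)
      then show ?case by (simp add: convergent_LIMSEQ_iff)
    qed
  qed
  define Y' where "Y' \<omega> = lim (\<lambda>j. Y j \<omega>)" for \<omega>
  have [measurable]: "Y' \<in> borel_measurable M" unfolding Y'_def by measurable
  show ?thesis
  proof (rule that[of "distr M borel Y'"])
    show "prob_space (distr M borel Y')" by (rule M.prob_space_distr) measurable
    fix h s assume s: "(\<lambda>n. (v n \<bullet> h)\<^sup>2) sums s"
    have fin: "(CLINT \<omega>|M. iexp (Z {..<n} \<omega> \<bullet> h)) = exp (- (\<Sum>k<n. (v k \<bullet> h)\<^sup>2) / 2)" for n
    proof -
      have "M.indep_vars (\<lambda>_. borel) (\<lambda>i \<omega>. \<omega> i * (v i \<bullet> h)) {..<n}"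
        by (rule M.indep_vars_compose2[OF M.indep_vars_subset[OF ind]]) auto
      then have "char (distr M borel (\<lambda>\<omega>. \<Sum>i<n. \<omega> i * (v i \<bullet> h))) 1 = (\<Prod>i<n. char (distr M borel (\<lambda>\<omega>. \<omega> i * (v i \<bullet> h))) 1)"
        by (rule M.char_distr_sum)
      moreover have "char (distr M borel (\<lambda>\<omega>. \<omega> i * (v i \<bullet> h))) 1 = exp (- (v i \<bullet> h)\<^sup>2 / 2)" for i
      proof -
        have "char (distr M borel (\<lambda>\<omega>. \<omega> i * (v i \<bullet> h))) 1 = char (distr M borel (\<lambda>\<omega>. \<omega> i)) (v i \<bullet> h)"
          unfolding char_def by (simp add: integral_distr mult.commute)
        then show ?thesis by (simp add: comp char_std_normal_distribution exp_of_real[symmetric])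
      qed
      moreover have "char (distr M borel (\<lambda>\<omega>. \<Sum>i<n. \<omega> i * (v i \<bullet> h))) 1 = (CLINT \<omega>|M. iexp (Z {..<n} \<omega> \<bullet> h))"
        unfolding char_def by (simp add: integral_distr Z_def inner_sum_left)
      moreover have "exp (- (\<Sum>k<n. (v k \<bullet> h)\<^sup>2) / 2) = (\<Prod>i<n. exp (- (v i \<bullet> h)\<^sup>2 / 2))"
        by (simp add: sum_negf sum_divide_distrib flip: exp_sum)
      ultimately show ?thesis by simp
    qed
    have "(\<lambda>j. CLINT \<omega>|M. iexp (Y j \<omega> \<bullet> h)) \<longlonglongrightarrow> (CLINT \<omega>|M. iexp (Y' \<omega> \<bullet> h))"
    proof (rule integral_dominated_convergence[where w="\<lambda>_. 1"])
      show "AE \<omega> in M. (\<lambda>j. iexp (Y j \<omega> \<bullet> h)) \<longlonglongrightarrow> iexp (Y' \<omega> \<bullet> h)"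
        using ae unfolding Y'_def by eventually_elim (intro tendsto_intros)
    qed auto
    moreover have "(\<lambda>j. CLINT \<omega>|M. iexp (Y j \<omega> \<bullet> h)) \<longlonglongrightarrow> exp (- s / 2)"
    proof -
      have "filterlim r at_top sequentially"
        by (rule filterlim_at_top_mono[OF filterlim_ident]) (simp add: rj)
      then have "(\<lambda>j. \<Sum>k<r j. (v k \<bullet> h)\<^sup>2) \<longlonglongrightarrow> s"
        using s unfolding sums_def by (rule filterlim_compose[rotated])
      then have "(\<lambda>j. complex_of_real (exp (- (\<Sum>k<r j. (v k \<bullet> h)\<^sup>2) / 2))) \<longlonglongrightarrow> complex_of_real (exp (- s / 2))"
        by (intro tendsto_intros) simp_all
      then show ?thesis unfolding Y_def fin by (simp add: exp_of_real[symmetric])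
    qed
    ultimately have "(CLINT \<omega>|M. iexp (Y' \<omega> \<bullet> h)) = exp (- s / 2)" by (rule LIMSEQ_unique)
    then show "char_fun (distr M borel Y') h = exp (- s / 2)"
      unfolding char_fun_def by (subst integral_distr) auto
  qed simp
qed

section \<open>The Ornstein--Uhlenbeck semigroup\<close>

lemma integral_dominated_convergence_at:
  fixes s :: "'d::first_countable_topology \<Rightarrow> 'b \<Rightarrow> 'c::{banach,second_countable_topology}"
  assumes s: "\<And>t. t \<in> S \<Longrightarrow> t \<noteq> x \<Longrightarrow> s t \<in> borel_measurable M" and f: "f \<in> borel_measurable M"
    and w: "integrable M w"
    and lim: "\<And>\<omega>. \<omega> \<in> space M \<Longrightarrow> ((\<lambda>t. s t \<omega>) \<longlongrightarrow> f \<omega>) (at x within S)"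
    and bd: "\<And>t \<omega>. t \<in> S \<Longrightarrow> t \<noteq> x \<Longrightarrow> \<omega> \<in> space M \<Longrightarrow> norm (s t \<omega>) \<le> w \<omega>"
  shows "((\<lambda>t. \<integral>\<omega>. s t \<omega> \<partial>M) \<longlongrightarrow> (\<integral>\<omega>. f \<omega> \<partial>M)) (at x within S)"
  unfolding tendsto_at_iff_sequentially o_def
proof (intro allI impI)
  fix X assume X: "\<forall>i. X i \<in> S - {x}" "X \<longlonglongrightarrow> x"
  show "(\<lambda>i. \<integral>\<omega>. s (X i) \<omega> \<partial>M) \<longlonglongrightarrow> (\<integral>\<omega>. f \<omega> \<partial>M)"
  proof (rule integral_dominated_convergence[OF f _ w])
    show "AE \<omega> in M. (\<lambda>i. s (X i) \<omega>) \<longlonglongrightarrow> f \<omega>"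
      using lim X by (auto simp: tendsto_at_iff_sequentially o_def)
    show "AE \<omega> in M. norm (s (X i) \<omega>) \<le> w \<omega>" for i
      using X bd by auto
  qed (use X s in auto)
qed

lemma integral_norm_le:
  fixes f :: "'b \<Rightarrow> 'c::{banach,second_countable_topology}"
  assumes "integrable M f" "integrable M g" "\<And>x. x \<in> space M \<Longrightarrow> norm (f x) \<le> g x"
  shows "norm (\<integral>x. f x \<partial>M) \<le> (\<integral>x. g x \<partial>M)"
  by (rule order_trans[OF integral_norm_bound integral_mono]) (use assms in auto)

lemma continuous_on_integral:
  fixes f :: "'d::{first_countable_topology,t2_space} \<Rightarrow> 'b \<Rightarrow> 'c::{banach,second_countable_topology}"
  assumes "\<And>x. x \<in> S \<Longrightarrow> f x \<in> borel_measurable M" and "integrable M w"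
    and "\<And>\<omega>. \<omega> \<in> space M \<Longrightarrow> continuous_on S (\<lambda>x. f x \<omega>)"
    and "\<And>x \<omega>. x \<in> S \<Longrightarrow> \<omega> \<in> space M \<Longrightarrow> norm (f x \<omega>) \<le> w \<omega>"
  shows "continuous_on S (\<lambda>x. \<integral>\<omega>. f x \<omega> \<partial>M)"
  unfolding continuous_on_def
  using assms by (intro ballI integral_dominated_convergence_at[where w=w]) (auto simp: continuous_on_def)

lemma bcontfunD:
  assumes "f \<in> bcontfun"
  shows "continuous_on UNIV f" "\<exists>B\<ge>0. \<forall>x. norm (f x) \<le> B" "f \<in> borel_measurable borel"
proof -
  show c: "continuous_on UNIV f" using assms by (simp add: bcontfun_def)
  obtain B where "\<forall>x. norm (f x) \<le> B" using assms by (auto simp: bcontfun_def bounded_iff)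
  then show "\<exists>B\<ge>0. \<forall>x. norm (f x) \<le> B" by (metis norm_ge_zero order_trans)
  show "f \<in> borel_measurable borel" by (rule borel_measurable_continuous_onI[OF c])
qed

lemma char_fun_distr_add:
  fixes X1 :: "'b \<Rightarrow> 'a::{real_inner,second_countable_topology}" and X2 :: "'c \<Rightarrow> 'a"
  assumes "prob_space M1" "prob_space M2"
    and [measurable]: "X1 \<in> borel_measurable M1" "X2 \<in> borel_measurable M2"
  shows "char_fun (distr (M1 \<Otimes>\<^sub>M M2) borel (\<lambda>(a, b). X1 a + X2 b)) h
    = char_fun (distr M1 borel X1) h * char_fun (distr M2 borel X2) h"
proof -
  interpret M1: prob_space M1 by fact
  interpret M2: prob_space M2 by fact
  interpret P: pair_prob_space M1 M2 ..
  have "char_fun (distr (M1 \<Otimes>\<^sub>M M2) borel (\<lambda>(a, b). X1 a + X2 b)) h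
      = (CLINT p|M1 \<Otimes>\<^sub>M M2. iexp (X1 (fst p) \<bullet> h) * iexp (X2 (snd p) \<bullet> h))"
    unfolding char_fun_def
    by (subst integral_distr) (auto simp: inner_add_left exp_add algebra_simps case_prod_beta)
  also have "\<dots> = (CLINT a|M1. CLINT b|M2. iexp (X1 a \<bullet> h) * iexp (X2 b \<bullet> h))"
    by (subst P.integral_fst'[symmetric]) (auto intro!: P.integrable_const_bound[of _ 1] simp: norm_mult)
  also have "\<dots> = (CLINT a|M1. iexp (X1 a \<bullet> h)) * (CLINT b|M2. iexp (X2 b \<bullet> h))"
    by simp
  also have "\<dots> = char_fun (distr M1 borel X1) h * char_fun (distr M2 borel X2) h"
    unfolding char_fun_def by (subst (1 2) integral_distr) auto
  finally show ?thesis .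
qed

lemma op_sqrt_frame:
  fixes S :: "'a::{real_inner,banach,second_countable_topology} \<Rightarrow> 'a"
  assumes S: "bounded_linear S" "selfadjoint S" "nonneg_op S"
  shows "(norm (op_sqrt S x))\<^sup>2 = S x \<bullet> x" "op_sqrt S x \<bullet> y = x \<bullet> op_sqrt S y"
  using op_sqrt_props[OF S] by (auto simp: power2_norm_eq_inner selfadjoint_def inner_commute)

text \<open>The series is taken with \<open>v n = op_sqrt S (e n)\<close>: the squared norms add up
  to the trace, and Parseval turns the sum of (v n . h)^2 into S h . h.\<close>

lemma is_centered_gaussian_centered_gaussian:
  fixes S :: "'a::{real_inner,banach,second_countable_topology} \<Rightarrow> 'a"
  assumes S: "bounded_linear S" "selfadjoint S" "nonneg_op S" and tr: "finite_trace S"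
  shows "is_centered_gaussian (centered_gaussian S) S"
proof -
  note R = op_sqrt_frame[OF S]
  obtain e where e: "parseval_frame e" "summable (\<lambda>n::nat. S (e n) \<bullet> e n)"
    using finite_trace_frame[OF tr] linear_0[OF bounded_linear.linear[OF S(1)]] by blast
  have "summable (\<lambda>n. (norm (op_sqrt S (e n)))\<^sup>2)" using e(2) by (simp add: R)
  then obtain \<mu> :: "'a measure" where \<mu>: "prob_space \<mu>" "sets \<mu> = sets borel"
    "\<And>h s. (\<lambda>n. (op_sqrt S (e n) \<bullet> h)\<^sup>2) sums s \<Longrightarrow> char_fun \<mu> h = exp (- s / 2)"
    by (rule gaussian_series_exists) (rule that)
  have "is_centered_gaussian \<mu> S"
  proof (rule is_centered_gaussianI[OF \<mu>(1,2) bounded_linear.linear[OF S(1)] S(2,3) \<mu>(3)])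
    show "(\<lambda>n. (op_sqrt S (e n) \<bullet> h)\<^sup>2) sums (S h \<bullet> h)" for h
      using e(1) by (simp add: R(2) parseval_frame_def flip: R(1))
  qed
  then show ?thesis by (simp add: centered_gaussian_eqI)
qed

text \<open>
  The one-dimensional factor carries all the smoothing in the direction of \<open>op_sqrt S u\<close>,
  so that no Cameron--Martin formula is needed.
\<close>

lemma centered_gaussian_split:
  fixes S :: "'a::{real_inner,banach,second_countable_topology} \<Rightarrow> 'a"
  assumes S: "bounded_linear S" "selfadjoint S" "nonneg_op S" and tr: "finite_trace S"
    and u: "norm u = 1"
  obtains \<nu> :: "'a measure" where "prob_space \<nu>" "sets \<nu> = sets borel"
    "centered_gaussian S = distr (std_normal_distribution \<Otimes>\<^sub>M \<nu>) borel (\<lambda>(r, y). r *\<^sub>R op_sqrt S u + y)"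
proof -
  note R = op_sqrt_frame[OF S]
  interpret R: bounded_linear "op_sqrt S" by (rule op_sqrt_props[OF S])
  interpret N: real_distribution std_normal_distribution by (rule real_dist_normal_dist)
  obtain e where e: "parseval_frame e" "summable (\<lambda>n::nat. S (e n) \<bullet> e n)"
    using finite_trace_frame[OF tr] linear_0[OF bounded_linear.linear[OF S(1)]] by blast
  define P where "P x = x - (u \<bullet> x) *\<^sub>R u" for x
  have uu: "u \<bullet> u = 1" using u by (simp add: norm_eq_1)
  \<comment> \<open>\<open>P\<close> projects orthogonally to \<open>u\<close>. The vectors S^(1/2)
    P e_n generate the Gaussian measure whose form is S h . h - (S^(1/2) u . h)^2, and the
    independent normal multiple of S^(1/2) u restores the missing rank-one part.\<close>
  define v where "v n = op_sqrt S (P (e n))" for n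
  have vh: "(v n \<bullet> h)\<^sup>2 = (e n \<bullet> P (op_sqrt S h))\<^sup>2" for n h
    by (simp add: v_def R(2) P_def inner_diff_left inner_diff_right inner_commute[of "e n" u] mult.commute)
  have "summable (\<lambda>n. (norm (v n))\<^sup>2)"
  proof (rule summable_comparison_test')
    show "summable (\<lambda>n. 2 * (norm (op_sqrt S (e n)))\<^sup>2 + 2 * ((norm (op_sqrt S u))\<^sup>2 * (e n \<bullet> u)\<^sup>2))"
      using e by (intro summable_add summable_mult) (auto simp: R(1) parseval_frame_def sums_iff)
    fix n
    have "norm (v n) \<le> norm (op_sqrt S (e n)) + \<bar>e n \<bullet> u\<bar> * norm (op_sqrt S u)"
      unfolding v_def P_def R.diff R.scaleR
      using norm_triangle_ineq4[of "op_sqrt S (e n)" "(u \<bullet> e n) *\<^sub>R op_sqrt S u"] by (simp add: inner_commute)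
    then have "(norm (v n))\<^sup>2 \<le> (norm (op_sqrt S (e n)) + \<bar>e n \<bullet> u\<bar> * norm (op_sqrt S u))\<^sup>2"
      by (intro power_mono) auto
    also have "\<dots> \<le> 2 * (norm (op_sqrt S (e n)))\<^sup>2 + 2 * ((norm (op_sqrt S u))\<^sup>2 * (e n \<bullet> u)\<^sup>2)"
      using sum_squares_bound[of "norm (op_sqrt S (e n))" "\<bar>e n \<bullet> u\<bar> * norm (op_sqrt S u)"]
      by (simp add: power2_sum power_mult_distrib mult.commute)
    finally show "norm ((norm (v n))\<^sup>2) \<le> 2 * (norm (op_sqrt S (e n)))\<^sup>2 + 2 * ((norm (op_sqrt S u))\<^sup>2 * (e n \<bullet> u)\<^sup>2)"
      by simp
  qed
  then obtain \<nu> :: "'a measure" where \<nu>: "prob_space \<nu>" "sets \<nu> = sets borel"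
    "\<And>h s. (\<lambda>n. (v n \<bullet> h)\<^sup>2) sums s \<Longrightarrow> char_fun \<nu> h = exp (- s / 2)"
    by (rule gaussian_series_exists) (rule that)
  note [measurable_cong] = \<nu>(2)
  have c\<nu>: "char_fun \<nu> h = exp (- (S h \<bullet> h - (op_sqrt S u \<bullet> h)\<^sup>2) / 2)" for h
  proof (rule \<nu>(3))
    have "(norm (P (op_sqrt S h)))\<^sup>2 = (norm (op_sqrt S h))\<^sup>2 - (op_sqrt S u \<bullet> h)\<^sup>2"
      unfolding power2_norm_eq_inner P_def
      by (simp add: inner_diff_left inner_diff_right uu R(2)[of u h] inner_commute[of "op_sqrt S h" u] power2_eq_square)
    then have "(norm (P (op_sqrt S h)))\<^sup>2 = S h \<bullet> h - (op_sqrt S u \<bullet> h)\<^sup>2" by (simp only: R(1))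
    then show "(\<lambda>n. (v n \<bullet> h)\<^sup>2) sums (S h \<bullet> h - (op_sqrt S u \<bullet> h)\<^sup>2)"
      using e(1) unfolding vh parseval_frame_def by metis
  qed
  let ?\<mu> = "distr (std_normal_distribution \<Otimes>\<^sub>M \<nu>) borel (\<lambda>(r, y). r *\<^sub>R op_sqrt S u + y)"
  interpret \<nu>: prob_space \<nu> by fact
  interpret Pr: pair_prob_space std_normal_distribution \<nu> ..
  have cN: "char_fun (distr std_normal_distribution borel (\<lambda>r. r *\<^sub>R op_sqrt S u)) h = exp (- (op_sqrt S u \<bullet> h)\<^sup>2 / 2)" for h
  proof -
    have "char_fun (distr std_normal_distribution borel (\<lambda>r. r *\<^sub>R op_sqrt S u)) h = char std_normal_distribution (op_sqrt S u \<bullet> h)"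
      unfolding char_fun_def char_def by (subst integral_distr) (auto simp: mult.commute)
    then show ?thesis by (simp add: char_std_normal_distribution flip: exp_of_real)
  qed
  have "is_centered_gaussian ?\<mu> S"
  proof (rule is_centered_gaussianI)
    show "prob_space ?\<mu>" by (rule Pr.prob_space_distr) measurable
    fix h
    have "char_fun (distr \<nu> borel (\<lambda>y. y)) h = char_fun \<nu> h"
      using \<nu>(2) by (simp add: distr_id2)
    moreover have "char_fun ?\<mu> h = char_fun (distr std_normal_distribution borel (\<lambda>r. r *\<^sub>R op_sqrt S u)) h
        * char_fun (distr \<nu> borel (\<lambda>y. y)) h"
      by (rule char_fun_distr_add[OF N.prob_space_axioms \<nu>(1)]) auto
    moreover have "exp (- a / 2) * exp (- (q - a) / 2) = exp (- q / 2)" for a q :: real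
      unfolding exp_add[symmetric] by (rule arg_cong[where f=exp]) (simp add: field_simps)
    ultimately show "char_fun ?\<mu> h = exp (- (S h \<bullet> h) / 2)"
      unfolding cN c\<nu> by (simp only: of_real_mult[symmetric])
  qed (use S in \<open>auto intro: bounded_linear.linear\<close>)
  then show ?thesis using \<nu>(1,2) by (intro that) (auto simp: centered_gaussian_eqI)
qed

text \<open>Parseval inside the integral and Tonelli: the mean square norm is the trace of the
  covariance.\<close>

lemma centered_gaussian_second_moment:
  fixes S :: "'a::{real_inner,banach,second_countable_topology} \<Rightarrow> 'a"
  assumes \<mu>: "is_centered_gaussian \<mu> S" and e: "parseval_frame e" and s: "summable (\<lambda>n::nat. S (e n) \<bullet> e n)"
  shows "integrable \<mu> (\<lambda>y. (norm y)\<^sup>2)" "(LINT y|\<mu>. (norm y)\<^sup>2) = (\<Sum>n. S (e n) \<bullet> e n)"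
proof -
  note D = is_centered_gaussianD[OF \<mu>]
  note [measurable_cong] = D(2)
  have nn: "0 \<le> S h \<bullet> h" for h unfolding D(6)[symmetric] by simp
  have "(\<integral>\<^sup>+y. ennreal ((norm y)\<^sup>2) \<partial>\<mu>) = (\<integral>\<^sup>+y. (\<Sum>n. ennreal ((y \<bullet> e n)\<^sup>2)) \<partial>\<mu>)"
  proof (rule nn_integral_cong)
    fix y
    have "(\<lambda>n. (y \<bullet> e n)\<^sup>2) sums (norm y)\<^sup>2" using e by (simp add: parseval_frame_def inner_commute)
    then show "ennreal ((norm y)\<^sup>2) = (\<Sum>n. ennreal ((y \<bullet> e n)\<^sup>2))"
      by (subst suminf_ennreal2) (auto simp: sums_iff)
  qed
  also have "\<dots> = (\<Sum>n. \<integral>\<^sup>+y. ennreal ((y \<bullet> e n)\<^sup>2) \<partial>\<mu>)" by (rule nn_integral_suminf) measurable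
  also have "\<dots> = (\<Sum>n. ennreal (S (e n) \<bullet> e n))"
    by (simp add: nn_integral_eq_integral D(5,6))
  also have "\<dots> = ennreal (\<Sum>n. S (e n) \<bullet> e n)" by (intro suminf_ennreal2 nn s)
  finally have *: "(\<integral>\<^sup>+y. ennreal ((norm y)\<^sup>2) \<partial>\<mu>) = ennreal (\<Sum>n. S (e n) \<bullet> e n)" .
  then show "integrable \<mu> (\<lambda>y. (norm y)\<^sup>2)" by (intro integrableI_nonneg) auto
  show "(LINT y|\<mu>. (norm y)\<^sup>2) = (\<Sum>n. S (e n) \<bullet> e n)"
    by (rule integral_eq_nn_integral[THEN trans]) (auto simp: * suminf_nonneg nn s)
qed

section \<open>The semigroup law and pointwise continuity at time zero\<close>

locale ornstein_uhlenbeck = covariance_semigroup T Q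
  for T :: "real \<Rightarrow> 'a::{real_inner,banach,second_countable_topology} \<Rightarrow>\<^sub>L 'a" and Q :: "'a \<Rightarrow>\<^sub>L 'a" +
  assumes trace: "t > 0 \<Longrightarrow> finite_trace (Q_op T Q t)"
begin

abbreviation P :: "real \<Rightarrow> ('a \<Rightarrow> real) \<Rightarrow> 'a \<Rightarrow> real" where "P \<equiv> ou_semigroup T Q"

text \<open>The point mass at time 0 makes the integral formula for \<open>P\<close> and the
  convolution law valid for all t \<ge> 0 without exception.\<close>

definition \<mu> :: "real \<Rightarrow> 'a measure" where
  "\<mu> t = (if t = 0 then return borel 0 else centered_gaussian (Q_op T Q t))"

lemma \<mu>_gaussian: "t > 0 \<Longrightarrow> is_centered_gaussian (\<mu> t) (Q_op T Q t)"
  unfolding \<mu>_def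
  by (simp add: is_centered_gaussian_centered_gaussian Q_op_bounded_linear Q_op_selfadjoint Q_op_nonneg trace)

lemma \<mu>_prob: "t \<ge> 0 \<Longrightarrow> prob_space (\<mu> t)"
  using is_centered_gaussianD(1)[OF \<mu>_gaussian[of t]] by (cases "t = 0") (auto simp: \<mu>_def intro: prob_space_return)

lemma \<mu>_sets: "t \<ge> 0 \<Longrightarrow> sets (\<mu> t) = sets borel"
  using is_centered_gaussianD(2)[OF \<mu>_gaussian[of t]] by (cases "t = 0") (auto simp: \<mu>_def)

lemma \<mu>_space: "t \<ge> 0 \<Longrightarrow> space (\<mu> t) = UNIV"
  using sets_eq_imp_space_eq[OF \<mu>_sets] by simp

lemma \<mu>_char_fun:
  assumes "t \<ge> 0" shows "char_fun (\<mu> t) h = exp (- (Q_op T Q t h \<bullet> h) / 2)"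
proof (cases "t = 0")
  case True
  have "Q_op T Q 0 h = 0" by (simp add: Q_op_def)
  then show ?thesis using True by (simp add: \<mu>_def char_fun_def integral_return)
next
  case False
  then show ?thesis using is_centered_gaussianD(4)[OF \<mu>_gaussian] assms by simp
qed

lemma P_eq:
  assumes "t \<ge> 0" and [measurable]: "f \<in> borel_measurable borel"
  shows "P t f x = (\<integral>y. f (T t x + y) \<partial>\<mu> t)"
  using assms by (auto simp: ou_semigroup_def \<mu>_def integral_return T_0)

text \<open>Both sides have the same characteristic function by \<open>Q_op_add\<close>; the adjoint
  appears when T t is moved from the variable to the direction.\<close>

lemma \<mu>_add:
  assumes s: "s \<ge> 0" and t: "t \<ge> 0"
  shows "\<mu> (s + t) = distr (\<mu> s \<Otimes>\<^sub>M \<mu> t) borel (\<lambda>(y, z). T t y + z)"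
proof -
  note [measurable_cong] = \<mu>_sets[OF s] \<mu>_sets[OF t]
  interpret S: prob_space "\<mu> s" by (rule \<mu>_prob[OF s])
  interpret T: prob_space "\<mu> t" by (rule \<mu>_prob[OF t])
  interpret PP: pair_prob_space "\<mu> s" "\<mu> t" ..
  have Tm[measurable]: "blinfun_apply (T t) \<in> borel_measurable borel"
    by (intro borel_measurable_continuous_onI continuous_intros)
  show ?thesis
  proof (rule measure_eqI_char_fun)
    show "prob_space (\<mu> (s + t))" "sets (\<mu> (s + t)) = sets borel" using \<mu>_prob \<mu>_sets s t by auto
    show "prob_space (distr (\<mu> s \<Otimes>\<^sub>M \<mu> t) borel (\<lambda>(y, z). T t y + z))"
      by (rule PP.prob_space_distr) measurable
    fix h
    have "char_fun (distr (\<mu> s) borel (T t)) h = char_fun (\<mu> s) (TA t h)"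
      unfolding char_fun_def by (subst integral_distr) (auto simp: TA_inner)
    moreover have "char_fun (distr (\<mu> t) borel (\<lambda>z. z)) h = char_fun (\<mu> t) h"
      using \<mu>_sets[OF t] by (simp add: distr_id2)
    moreover have "char_fun (distr (\<mu> s \<Otimes>\<^sub>M \<mu> t) borel (\<lambda>(y, z). T t y + z)) h =
      char_fun (distr (\<mu> s) borel (T t)) h * char_fun (distr (\<mu> t) borel (\<lambda>z. z)) h"
      by (rule char_fun_distr_add) (auto simp: \<mu>_prob s t)
    ultimately show "char_fun (\<mu> (s + t)) h = char_fun (distr (\<mu> s \<Otimes>\<^sub>M \<mu> t) borel (\<lambda>(y, z). T t y + z)) h"
      using s t by (simp add: \<mu>_char_fun Q_op_add add_divide_distrib flip: of_real_mult exp_add of_real_exp)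
  qed simp
qed

lemma P_bound:
  assumes t: "t \<ge> 0" and f: "f \<in> bcontfun" and B: "\<And>x. \<bar>f x\<bar> \<le> B"
  shows "\<bar>P t f x\<bar> \<le> B"
proof -
  note [measurable] = bcontfunD(3)[OF f] note [measurable_cong] = \<mu>_sets[OF t]
  interpret prob_space "\<mu> t" by (rule \<mu>_prob[OF t])
  have "norm (P t f x) \<le> (\<integral>y. B \<partial>\<mu> t)"
    unfolding P_eq[OF t bcontfunD(3)[OF f]]
    by (intro integral_norm_le integrable_const_bound[of _ B]) (auto simp: B intro: order_trans[OF abs_ge_zero B])
  then show ?thesis by (simp add: prob_space)
qed

lemma P_integrable:
  assumes t: "t \<ge> 0" and f: "f \<in> bcontfun"
  shows "integrable (\<mu> t) (\<lambda>y. f (T t x + y) :: real)"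
proof -
  note [measurable] = bcontfunD(3)[OF f] note [measurable_cong] = \<mu>_sets[OF t]
  interpret prob_space "\<mu> t" by (rule \<mu>_prob[OF t])
  obtain B where "\<And>x. \<bar>f x\<bar> \<le> B" using bcontfunD(2)[OF f] by auto
  then show ?thesis by (intro integrable_const_bound[of _ B]) auto
qed

lemma P_bcontfun:
  assumes t: "t \<ge> 0" and f: "f \<in> bcontfun"
  shows "P t f \<in> bcontfun"
proof -
  note [measurable] = bcontfunD(3)[OF f] note [measurable_cong] = \<mu>_sets[OF t]
  interpret prob_space "\<mu> t" by (rule \<mu>_prob[OF t])
  obtain B where B: "\<And>x. \<bar>f x\<bar> \<le> B" using bcontfunD(2)[OF f] by auto
  show ?thesis
  proof (rule bcontfun_normI)
    show "continuous_on UNIV (P t f)"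
      unfolding P_eq[OF t bcontfunD(3)[OF f], abs_def]
      by (intro continuous_on_integral[where w="\<lambda>_. B"] continuous_intros continuous_on_compose2[OF bcontfunD(1)[OF f]])
        (auto simp: B)
    show "norm (P t f x) \<le> B" for x using P_bound[OF t f B] by simp
  qed
qed

lemma P_diff:
  assumes t: "t \<ge> 0" and f: "f \<in> bcontfun" and g: "g \<in> bcontfun"
  shows "P t (\<lambda>x. f x - g x) x = P t f x - P t g x"
  using P_integrable[OF t f, of x] P_integrable[OF t g, of x] bcontfunD(3)[OF f] bcontfunD(3)[OF g]
  by (simp add: P_eq[OF t])

lemma P_0: "P 0 f = f"
  by (simp add: ou_semigroup_def fun_eq_iff)

lemma P_add:
  assumes s: "s \<ge> 0" and t: "t \<ge> 0" and f: "f \<in> bcontfun"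
  shows "P (s + t) f = P s (P t f)"
proof
  fix x
  note [measurable] = bcontfunD(3)[OF f] note [measurable_cong] = \<mu>_sets[OF s] \<mu>_sets[OF t]
  interpret S: prob_space "\<mu> s" by (rule \<mu>_prob[OF s])
  interpret T: prob_space "\<mu> t" by (rule \<mu>_prob[OF t])
  interpret PP: pair_prob_space "\<mu> s" "\<mu> t" ..
  have Tm[measurable]: "blinfun_apply (T t) \<in> borel_measurable borel"
    by (intro borel_measurable_continuous_onI continuous_intros)
  obtain B where B: "\<And>x. \<bar>f x\<bar> \<le> B" using bcontfunD(2)[OF f] by auto
  have "P (s + t) f x = (\<integral>w. f (T (s + t) x + w) \<partial>\<mu> (s + t))" using s t by (simp add: P_eq)
  also have "\<dots> = (\<integral>p. f (T t (T s x + fst p) + snd p) \<partial>(\<mu> s \<Otimes>\<^sub>M \<mu> t))"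
    unfolding \<mu>_add[OF s t]
    by (subst integral_distr) (auto simp: case_prod_beta blinfun.add_right T_add[OF t s] add.commute[of s t] add.assoc)
  also have "\<dots> = (\<integral>y. \<integral>z. f (T t (T s x + y) + z) \<partial>\<mu> t \<partial>\<mu> s)"
    by (subst PP.integral_fst'[symmetric]) (auto intro!: PP.integrable_const_bound[of _ B] B)
  also have "\<dots> = P s (P t f) x"
    using bcontfunD(3)[OF P_bcontfun[OF t f]] by (simp add: P_eq[OF s] P_eq[OF t])
  finally show "P (s + t) f x = P s (P t f) x" .
qed

text \<open>The second moment is the trace of \<open>Q_op T Q t\<close>. Each diagonal entry tends
  to 0 and is dominated by the entry at time 1, because the forms increase with \<open>t\<close>;
  Tannery's theorem then applies to the series.\<close>

lemma second_moment_tendsto_0: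
  "\<forall>t. 0 < t \<and> t \<le> 1 \<longrightarrow> integrable (\<mu> t) (\<lambda>y. (norm y)\<^sup>2)"
  "((\<lambda>t. LINT y|\<mu> t. (norm y)\<^sup>2) \<longlongrightarrow> 0) (at_right 0)"
proof -
  obtain e where e: "parseval_frame e" "summable (\<lambda>n::nat. Q_op T Q 1 (e n) \<bullet> e n)"
    using finite_trace_frame[OF trace[of 1]] linear_0[OF bounded_linear.linear[OF Q_op_bounded_linear[of 1]]] by auto
  have nn: "0 \<le> Q_op T Q t x \<bullet> x" if "0 \<le> t" for t x
    using Q_op_nonneg[OF that] by (simp add: nonneg_op_def)
  have s: "summable (\<lambda>n. Q_op T Q t (e n) \<bullet> e n)" if "0 < t" "t \<le> 1" for t
    by (rule summable_comparison_test'[OF e(2)]) (use that nn[of t] Q_op_mono[of t 1] in auto)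
  show "\<forall>t. 0 < t \<and> t \<le> 1 \<longrightarrow> integrable (\<mu> t) (\<lambda>y. (norm y)\<^sup>2)"
    using centered_gaussian_second_moment(1)[OF \<mu>_gaussian e(1) s] by blast
  have small: "\<forall>\<^sub>F t in at_right 0. 0 < t \<and> t < (1::real)"
    by (auto simp: eventually_at_right_field intro: exI[of _ 1])
  have "((\<lambda>t. \<Sum>n. Q_op T Q t (e n) \<bullet> e n) \<longlongrightarrow> (\<Sum>n. 0)) (at_right 0)"
  proof (rule tannerys_theorem[OF Q_op_tendsto_0 _ e(2), THEN conjunct2, THEN conjunct2])
    show "\<forall>\<^sub>F (n, t) in at_top \<times>\<^sub>F at_right 0. norm (Q_op T Q t (e n) \<bullet> e n) \<le> Q_op T Q 1 (e n) \<bullet> e n"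
      unfolding eventually_prod_filter
      using small nn Q_op_mono[of _ 1] by (intro exI[of _ "\<lambda>_. True"] exI[of _ "\<lambda>t. 0 < t \<and> t < (1::real)"]) auto
  qed (auto simp: trivial_limit_at_right_real)
  then have "((\<lambda>t. \<Sum>n. Q_op T Q t (e n) \<bullet> e n) \<longlongrightarrow> 0) (at_right 0)" by simp
  moreover have "\<forall>\<^sub>F t in at_right 0. (\<Sum>n. Q_op T Q t (e n) \<bullet> e n) = (LINT y|\<mu> t. (norm y)\<^sup>2)"
    using small
  proof eventually_elim
    case (elim t)
    then show ?case using centered_gaussian_second_moment(2)[OF \<mu>_gaussian e(1) s, of t] by simp
  qed
  ultimately show "((\<lambda>t. LINT y|\<mu> t. (norm y)\<^sup>2) \<longlongrightarrow> 0) (at_right 0)"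
    by (rule Lim_transform_eventually)
qed

text \<open>A Chebyshev argument: near \<open>x\<close> the continuity of \<open>f\<close> is used,
  and away from it the sup bound is dominated by a multiple of norm y^2, whose mean vanishes. The
  convergence is pointwise in \<open>x\<close>.\<close>

lemma P_tendsto_0:
  assumes f: "f \<in> bcontfun"
  shows "((\<lambda>t. P t f x) \<longlongrightarrow> f x) (at_right 0)"
proof (rule tendstoI)
  fix \<epsilon> :: real assume eps: "\<epsilon> > 0"
  obtain B where B: "B \<ge> 0" "\<And>x. norm (f x) \<le> B" using bcontfunD(2)[OF f] by blast
  have "isCont f x" using bcontfunD(1)[OF f] by (simp add: continuous_on_eq_continuous_at)
  then obtain d where d: "d > 0" "\<And>y. dist y x < d \<Longrightarrow> dist (f y) (f x) < \<epsilon> / 2"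
    using eps unfolding continuous_at_eps_delta by (metis half_gt_zero)
  \<comment> \<open>Chosen so that K (d/2)^2 = 2 B, the trivial bound for the oscillation of
    \<open>f\<close>.\<close>
  define K where "K = 2 * B * 4 / d\<^sup>2"
  have K: "K \<ge> 0" using B by (simp add: K_def)
  have "((\<lambda>t. K * (LINT y|\<mu> t. (norm y)\<^sup>2)) \<longlongrightarrow> K * 0) (at_right 0)"
    by (intro tendsto_intros second_moment_tendsto_0)
  then have "\<forall>\<^sub>F t in at_right 0. K * (LINT y|\<mu> t. (norm y)\<^sup>2) < \<epsilon> / 2"
    using eps by (intro order_tendstoD) auto
  moreover have "\<forall>\<^sub>F t in at_right 0. dist (T t x) x < d / 2"
    using T_tendsto_0[of x] d by (intro tendstoD) auto
  moreover have "\<forall>\<^sub>F t in at_right 0. 0 < t \<and> t < (1::real)"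
    by (auto simp: eventually_at_right_field intro: exI[of _ 1])
  ultimately show "\<forall>\<^sub>F t in at_right 0. dist (P t f x) (f x) < \<epsilon>"
  proof eventually_elim
    case (elim t)
    then have t: "t \<ge> 0" "0 < t" "t \<le> 1" by auto
    note [measurable] = bcontfunD(3)[OF f] note [measurable_cong] = \<mu>_sets[OF t(1)]
    interpret prob_space "\<mu> t" by (rule \<mu>_prob[OF t(1)])
    have i2: "integrable (\<mu> t) (\<lambda>y. (norm y)\<^sup>2)" using second_moment_tendsto_0(1) t by blast
    have pt: "norm (f (T t x + y) - f x) \<le> \<epsilon> / 2 + K * (norm y)\<^sup>2" for y
    proof (cases "norm y < d / 2")
      case True
      have "dist (T t x + y) x < d"
        using elim(2) True norm_triangle_ineq[of "T t x - x" y] by (simp add: dist_norm algebra_simps)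
      then have "norm (f (T t x + y) - f x) < \<epsilon> / 2" using d(2) by (simp add: dist_norm)
      moreover have "0 \<le> K * (norm y)\<^sup>2" using K by simp
      ultimately show ?thesis by linarith
    next
      case False
      then have "(d / 2)\<^sup>2 \<le> (norm y)\<^sup>2" using d by (intro power_mono) auto
      then have "K * (d / 2)\<^sup>2 \<le> K * (norm y)\<^sup>2" using K by (rule mult_left_mono)
      moreover have "K * (d / 2)\<^sup>2 = 2 * B" using d(1) by (simp add: K_def field_simps power2_eq_square)
      moreover have "norm (f (T t x + y) - f x) \<le> 2 * B"
        using norm_triangle_ineq4[of "f (T t x + y)" "f x"] B(2)[of "T t x + y"] B(2)[of x] by simp
      ultimately show ?thesis using eps by linarith
    qed
    have "P t f x - f x = (\<integral>y. f (T t x + y) - f x \<partial>\<mu> t)"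
      using P_integrable[OF t(1) f, of x] by (simp add: P_eq[OF t(1)] prob_space)
    also have "norm \<dots> \<le> (\<integral>y. \<epsilon> / 2 + K * (norm y)\<^sup>2 \<partial>\<mu> t)"
      using P_integrable[OF t(1) f, of x] i2 by (intro integral_norm_le pt) auto
    also have "\<dots> = \<epsilon> / 2 + K * (LINT y|\<mu> t. (norm y)\<^sup>2)"
      using i2 by (simp add: prob_space)
    also have "\<dots> < \<epsilon>" using elim(1) by linarith
    finally show ?case by (simp add: dist_norm)
  qed
qed

end

section \<open>Directional derivatives and smoothing\<close>

text \<open>One fixed direction at all base points at once. The smoothing argument produces
  derivatives direction by direction; linearity in the direction is recovered afterwards.\<close>

definition has_dir_deriv :: "('a::real_normed_vector \<Rightarrow> real) \<Rightarrow> 'a \<Rightarrow> ('a \<Rightarrow> real) \<Rightarrow> bool" where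
  "has_dir_deriv f h g \<longleftrightarrow> (\<forall>x. ((\<lambda>s. f (x + s *\<^sub>R h)) has_real_derivative g x) (at 0))"

lemma has_dir_deriv_at:
  assumes "has_dir_deriv f h g"
  shows "((\<lambda>s. f (x + s *\<^sub>R h)) has_real_derivative g (x + s *\<^sub>R h)) (at s)"
proof -
  have "((\<lambda>r. f ((x + s *\<^sub>R h) + r *\<^sub>R h)) has_real_derivative g (x + s *\<^sub>R h)) (at 0)"
    using assms by (simp add: has_dir_deriv_def)
  then show ?thesis
    using DERIV_shift[of "\<lambda>s. f (x + s *\<^sub>R h)" "g (x + s *\<^sub>R h)" 0 s] by (simp add: algebra_simps)
qed

lemma has_dir_deriv_tendsto:
  assumes "has_dir_deriv f h g"
  shows "((\<lambda>s. (f (x + s *\<^sub>R h) - f x) / s) \<longlongrightarrow> g x) (at 0)"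
  using assms by (auto simp: has_dir_deriv_def has_field_derivative_iff)

lemma has_dir_derivI:
  assumes "\<And>x. ((\<lambda>s. (f (x + s *\<^sub>R h) - f x) / s) \<longlongrightarrow> g x) (at 0)"
  shows "has_dir_deriv f h g"
  using assms by (auto simp: has_dir_deriv_def has_field_derivative_iff)

lemma has_dir_deriv_mvt:
  assumes f: "has_dir_deriv f h g" and s: "s \<noteq> 0"
  obtains \<xi> where "\<bar>\<xi>\<bar> \<le> \<bar>s\<bar>" "f (x + s *\<^sub>R h) - f x = s * g (x + \<xi> *\<^sub>R h)"
proof (cases "s > 0")
  case True
  from MVT2[OF True, of "\<lambda>s. f (x + s *\<^sub>R h)" "\<lambda>s. g (x + s *\<^sub>R h)"] has_dir_deriv_at[OF f]
  obtain z where "0 < z" "z < s" "f (x + s *\<^sub>R h) - f x = s * g (x + z *\<^sub>R h)" by auto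
  then show ?thesis by (intro that[of z]) auto
next
  case False
  then have "s < 0" using s by simp
  from MVT2[OF this, of "\<lambda>s. f (x + s *\<^sub>R h)" "\<lambda>s. g (x + s *\<^sub>R h)"] has_dir_deriv_at[OF f]
  obtain z where z: "s < z" "z < 0" "f x - f (x + s *\<^sub>R h) = - s * g (x + z *\<^sub>R h)" by auto
  then show ?thesis by (intro that[of z]) auto
qed

lemma has_dir_deriv_increment:
  assumes f: "has_dir_deriv f h g" and B: "\<And>x. \<bar>g x\<bar> \<le> B"
  shows "\<bar>f (x + s *\<^sub>R h) - f x\<bar> \<le> \<bar>s\<bar> * B"
proof (cases "s = 0")
  case False
  then obtain \<xi> where "f (x + s *\<^sub>R h) - f x = s * g (x + \<xi> *\<^sub>R h)"
    using has_dir_deriv_mvt[OF f] by metis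
  then show ?thesis using B by (simp add: abs_mult mult_left_mono)
qed simp

lemma has_dir_deriv_scale:
  assumes "has_dir_deriv f h g"
  shows "has_dir_deriv f (c *\<^sub>R h) (\<lambda>x. c * g x)"
  unfolding has_dir_deriv_def
proof
  fix x
  have "((\<lambda>s. f (x + s *\<^sub>R h)) has_real_derivative g x) (at (0 * c))"
    using assms by (simp add: has_dir_deriv_def)
  moreover have "((\<lambda>s. s * c) has_real_derivative c) (at 0)" by (auto intro!: derivative_eq_intros)
  ultimately have "((\<lambda>s. f (x + (s * c) *\<^sub>R h)) has_real_derivative g x * c) (at 0)"
    by (rule DERIV_chain2)
  then show "((\<lambda>s. f (x + s *\<^sub>R c *\<^sub>R h)) has_real_derivative c * g x) (at 0)"
    by (simp add: mult.commute)
qed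

text \<open>Directional derivatives need not be additive in the direction. Here the move along h + k
  is split into two legs; the mean value theorem treats the second leg, and continuity of
  \<open>g'\<close> brings its intermediate point back to \<open>x\<close>.\<close>

lemma has_dir_deriv_add:
  assumes h: "has_dir_deriv f h g" and k: "has_dir_deriv f k g'" and c: "continuous_on UNIV g'"
  shows "has_dir_deriv f (h + k) (\<lambda>x. g x + g' x)"
proof (rule has_dir_derivI)
  fix x
  have "\<exists>\<xi>. s \<noteq> 0 \<longrightarrow> \<bar>\<xi>\<bar> \<le> \<bar>s\<bar> \<and> f (x + s *\<^sub>R h + s *\<^sub>R k) - f (x + s *\<^sub>R h) = s * g' (x + s *\<^sub>R h + \<xi> *\<^sub>R k)" for s
    using has_dir_deriv_mvt[OF k, of s "x + s *\<^sub>R h"] by metis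
  then obtain \<xi> where \<xi>: "\<And>s. s \<noteq> 0 \<Longrightarrow> \<bar>\<xi> s\<bar> \<le> \<bar>s\<bar>"
    "\<And>s. s \<noteq> 0 \<Longrightarrow> f (x + s *\<^sub>R h + s *\<^sub>R k) - f (x + s *\<^sub>R h) = s * g' (x + s *\<^sub>R h + \<xi> s *\<^sub>R k)" by metis
  have "(\<xi> \<longlongrightarrow> 0) (at 0)"
  proof (rule Lim_null_comparison)
    show "\<forall>\<^sub>F s in at 0. norm (\<xi> s) \<le> \<bar>s\<bar>" using \<xi>(1) by (auto simp: eventually_at intro: exI[of _ 1])
    show "((\<lambda>s. \<bar>s\<bar>) \<longlongrightarrow> (0::real)) (at 0)" by (rule tendsto_rabs_zero) (rule tendsto_ident_at)
  qed
  then have "((\<lambda>s. x + s *\<^sub>R h + \<xi> s *\<^sub>R k) \<longlongrightarrow> x + 0 *\<^sub>R h + 0 *\<^sub>R k) (at 0)" by (intro tendsto_intros)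
  moreover have "isCont g' x" using c by (simp add: continuous_on_eq_continuous_at)
  ultimately have "((\<lambda>s. g' (x + s *\<^sub>R h + \<xi> s *\<^sub>R k)) \<longlongrightarrow> g' x) (at 0)"
    by (intro isCont_tendsto_compose[of x g']) auto
  with has_dir_deriv_tendsto[OF h, of x]
  have "((\<lambda>s. (f (x + s *\<^sub>R h) - f x) / s + g' (x + s *\<^sub>R h + \<xi> s *\<^sub>R k)) \<longlongrightarrow> g x + g' x) (at 0)"
    by (rule tendsto_add)
  moreover have "\<forall>\<^sub>F s in at 0. (f (x + s *\<^sub>R h) - f x) / s + g' (x + s *\<^sub>R h + \<xi> s *\<^sub>R k) = (f (x + s *\<^sub>R (h + k)) - f x) / s"
  proof -
    have "(f (x + s *\<^sub>R h) - f x) / s + g' (x + s *\<^sub>R h + \<xi> s *\<^sub>R k) = (f (x + s *\<^sub>R (h + k)) - f x) / s" if "s \<noteq> 0" for s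
    proof -
      have "f (x + s *\<^sub>R (h + k)) - f x = (f (x + s *\<^sub>R h) - f x) + s * g' (x + s *\<^sub>R h + \<xi> s *\<^sub>R k)"
        using \<xi>(2)[OF that] by (simp add: scaleR_add_right add.assoc)
      then show ?thesis using that by (simp add: field_simps)
    qed
    then show ?thesis by (auto simp: eventually_at intro: exI[of _ 1])
  qed
  ultimately show "((\<lambda>s. (f (x + s *\<^sub>R (h + k)) - f x) / s) \<longlongrightarrow> g x + g' x) (at 0)"
    by (rule Lim_transform_eventually)
qed

section \<open>Differentiating Gaussian averages under a shift\<close>

text \<open>An integrable majorant for the derivative of the shifted density, uniform in the shift.
  The factor r - \<sigma> and the cross term r \<sigma> cost exp (abs r) each; completing the square
  in -r^2/2 + 2 abs r produces the means 2 and -2 and the factor exp 2.\<close>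

lemma normal_density_shift_bound:
  fixes r \<sigma> :: real
  assumes "\<bar>\<sigma>\<bar> \<le> 1"
  shows "\<bar>(r - \<sigma>) * std_normal_density (r - \<sigma>)\<bar> \<le> exp 2 * (normal_density 2 1 r + normal_density (-2) 1 r)"
proof -
  have "\<bar>r - \<sigma>\<bar> \<le> 1 + \<bar>r\<bar>" using assms by linarith
  also have "\<dots> \<le> exp \<bar>r\<bar>" by (rule exp_ge_add_one_self)
  finally have 1: "\<bar>r - \<sigma>\<bar> \<le> exp \<bar>r\<bar>" .
  have "\<bar>r\<bar> * \<bar>\<sigma>\<bar> \<le> \<bar>r\<bar> * 1" using assms by (intro mult_left_mono) auto
  then have "r * \<sigma> \<le> \<bar>r\<bar> * 1" using abs_ge_self[of "r * \<sigma>"] by (simp add: abs_mult)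
  moreover have "- (r - \<sigma>)\<^sup>2 / 2 = - r\<^sup>2 / 2 + r * \<sigma> - \<sigma>\<^sup>2 / 2" by (simp add: power2_diff field_simps)
  ultimately have "- (r - \<sigma>)\<^sup>2 / 2 \<le> - r\<^sup>2 / 2 + \<bar>r\<bar>" using zero_le_power2[of \<sigma>] by linarith
  then have 2: "exp (- (r - \<sigma>)\<^sup>2 / 2) \<le> exp (- r\<^sup>2 / 2 + \<bar>r\<bar>)" by simp
  have "\<bar>r - \<sigma>\<bar> * exp (- (r - \<sigma>)\<^sup>2 / 2) \<le> exp \<bar>r\<bar> * exp (- r\<^sup>2 / 2 + \<bar>r\<bar>)"
    by (intro mult_mono 1 2) auto
  also have "\<dots> = exp (- r\<^sup>2 / 2 + 2 * \<bar>r\<bar>)" by (simp flip: exp_add)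
  also have "\<dots> \<le> exp (2 - (r - 2)\<^sup>2 / 2) + exp (2 - (r + 2)\<^sup>2 / 2)"
  proof -
    have "2 - (r - 2)\<^sup>2 / 2 = - r\<^sup>2 / 2 + 2 * r" "2 - (r + 2)\<^sup>2 / 2 = - r\<^sup>2 / 2 + 2 * (- r)"
      by (simp_all add: power2_eq_square field_simps)
    then show ?thesis by (cases "r \<ge> 0") (auto intro: add_increasing add_increasing2)
  qed
  also have "\<dots> = exp 2 * (exp (- (r - 2)\<^sup>2 / 2) + exp (- (r + 2)\<^sup>2 / 2))"
    by (simp add: distrib_left flip: exp_add)
  finally have "1 / sqrt (2 * pi) * (\<bar>r - \<sigma>\<bar> * exp (- (r - \<sigma>)\<^sup>2 / 2))
      \<le> 1 / sqrt (2 * pi) * (exp 2 * (exp (- (r - 2)\<^sup>2 / 2) + exp (- (r + 2)\<^sup>2 / 2)))"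
    by (intro mult_left_mono) auto
  then show ?thesis
    by (simp add: normal_density_def abs_mult distrib_left mult_ac add_divide_distrib)
qed

text \<open>A change of variables moves the shift from \<open>g\<close> to the density, so
  boundedness and measurability of \<open>g\<close> suffice. The derivative of the density at shift
  0 is r times the density.\<close>

lemma std_normal_shift_derivative:
  fixes g :: "real \<Rightarrow> real"
  assumes [measurable]: "g \<in> borel_measurable borel" and B: "\<And>r. \<bar>g r\<bar> \<le> B"
  shows "((\<lambda>s. LINT r|std_normal_distribution. g (r + s)) has_real_derivative
    (LINT r|std_normal_distribution. r * g r)) (at 0)"
proof -
  let ?n = std_normal_density
  have B0: "B \<ge> 0" using order_trans[OF abs_ge_zero B] .
  have shift: "(LINT r|std_normal_distribution. g (r + s)) = (LINT r|lborel. ?n (r - s) * g r)" for s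
    using lborel_integral_real_affine[of 1 "\<lambda>r. ?n (r - s) * g r" s]
    by (simp add: integral_density add.commute)
  have "integrable lborel ?n" by simp
  have intn: "integrable lborel (\<lambda>r. ?n (r - s) * g r)" for s
  proof -
    have "integrable lborel (\<lambda>r. ?n (- s + r))"
      using lborel_integrable_real_affine[of ?n 1 "-s"] by simp
    then have "integrable lborel (\<lambda>r. B * ?n (r - s))" by (simp add: add.commute)
    then show ?thesis
      by (rule Bochner_Integration.integrable_bound) (auto simp: abs_mult B mult.commute mult_right_mono B0)
  qed
  have dn: "((\<lambda>s. ?n (r - s)) has_real_derivative (r - s) * ?n (r - s)) (at s)" for r s :: real
  proof -
    have "((\<lambda>s. exp (- (r - s)\<^sup>2 / 2)) has_real_derivative (r - s) * exp (- (r - s)\<^sup>2 / 2)) (at s)"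
      by (auto intro!: derivative_eq_intros simp: field_simps)
    from DERIV_cmult[OF this, of "1 / sqrt (2 * pi)"]
    show ?thesis unfolding std_normal_density_def by (simp only: mult_ac)
  qed
  let ?w = "\<lambda>r. exp 2 * (normal_density 2 1 r + normal_density (-2) 1 r)"
  have "((\<lambda>s. LINT r|lborel. (?n (r - s) - ?n r) / s * g r) \<longlongrightarrow> (LINT r|lborel. (r * ?n r) * g r)) (at 0 within {-1..1})"
  proof (rule integral_dominated_convergence_at[where w="\<lambda>r. ?w r * B"])
    show "integrable lborel (\<lambda>r. ?w r * B)" by (intro integrable_mult_left integrable_mult_right Bochner_Integration.integrable_add) auto
    fix r :: real
    have "((\<lambda>s. (?n (r - s) - ?n r) / s) \<longlongrightarrow> r * ?n r) (at 0)"
      using dn[of r 0] by (simp add: has_field_derivative_iff)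
    from tendsto_mult_right[OF this, of "g r"]
    show "((\<lambda>s. (?n (r - s) - ?n r) / s * g r) \<longlongrightarrow> (r * ?n r) * g r) (at 0 within {-1..1})"
      by (rule tendsto_within_subset) simp
    fix s :: real assume s: "s \<in> {-1..1}" "s \<noteq> 0"
    have "norm (?n (r - s) - ?n (r - 0)) \<le> ?w r * norm (s - 0)"
    proof (rule field_differentiable_bound[of "{-1..1}" "\<lambda>s. ?n (r - s)" "\<lambda>s. (r - s) * ?n (r - s)"])
      show "((\<lambda>s. ?n (r - s)) has_field_derivative (r - z) * ?n (r - z)) (at z within {- 1..1})" for z
        using dn by (rule has_field_derivative_at_within)
      show "norm ((r - z) * ?n (r - z)) \<le> ?w r" if "z \<in> {-1..1}" for z
        using normal_density_shift_bound[of z r] that by (simp add: abs_le_iff)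
    qed (use s in auto)
    then have "\<bar>(?n (r - s) - ?n r) / s\<bar> \<le> ?w r" using s by (simp add: abs_divide field_simps)
    then have "\<bar>(?n (r - s) - ?n r) / s\<bar> * \<bar>g r\<bar> \<le> ?w r * B" by (intro mult_mono B) auto
    then show "norm ((?n (r - s) - ?n r) / s * g r) \<le> ?w r * B" by (simp add: abs_mult)
  qed auto
  then have "((\<lambda>s. LINT r|lborel. (?n (r - s) - ?n r) / s * g r) \<longlongrightarrow> (LINT r|lborel. (r * ?n r) * g r)) (at 0)"
    by (simp add: at_within_Icc_at)
  moreover have "(LINT r|lborel. (?n (r - s) - ?n r) / s * g r) =
      ((LINT r|std_normal_distribution. g (r + s)) - (LINT r|std_normal_distribution. g (r + 0))) / s" for s
  proof -
    have "(LINT r|lborel. (?n (r - s) - ?n r) / s * g r) = (LINT r|lborel. (?n (r - s) * g r - ?n (r - 0) * g r) / s)"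
      by (intro Bochner_Integration.integral_cong) (auto simp: algebra_simps diff_divide_distrib)
    also have "\<dots> = ((LINT r|lborel. ?n (r - s) * g r) - (LINT r|lborel. ?n (r - 0) * g r)) / s"
      using intn[of s] intn[of 0] by simp
    finally show ?thesis unfolding shift .
  qed
  moreover have "(LINT r|lborel. (r * ?n r) * g r) = (LINT r|std_normal_distribution. r * g r)"
    by (simp add: integral_density mult_ac)
  ultimately have "((\<lambda>s. ((LINT r|std_normal_distribution. g (r + s)) - (LINT r|std_normal_distribution. g (r + 0))) / s)
      \<longlongrightarrow> (LINT r|std_normal_distribution. r * g r)) (at 0)"
    by (simp only:)
  then show ?thesis by (simp add: has_field_derivative_iff)
qed

lemma std_normal_abs_moment_le: "(LINT r|std_normal_distribution. \<bar>r\<bar>) \<le> 1" "integrable std_normal_distribution (\<lambda>r. \<bar>r\<bar>)"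
proof -
  interpret N: real_distribution std_normal_distribution by (rule real_dist_normal_dist)
  show i: "integrable std_normal_distribution (\<lambda>r. \<bar>r\<bar>)" by (intro integrable_abs std_normal_moments)
  have "\<bar>r\<bar> \<le> (1 + r\<^sup>2) / 2" for r :: real
    using sum_squares_bound[of 1 "\<bar>r\<bar>"] by simp
  then have "(LINT r|std_normal_distribution. \<bar>r\<bar>) \<le> (LINT r|std_normal_distribution. (1 + r\<^sup>2) / 2)"
    by (intro integral_mono i integrable_divide Bochner_Integration.integrable_add std_normal_moments) auto
  also have "\<dots> = 1" using N.prob_space by (simp add: std_normal_moments)
  finally show "(LINT r|std_normal_distribution. \<bar>r\<bar>) \<le> 1" .
qed

context ornstein_uhlenbeck
begin

text \<open>The bound comes out with constant 1 because the mean of abs \<xi> is at most 1 for a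
  standard normal \<xi>. For z = 0 there is no direction to normalise, but then T t h = 0 and
  \<open>P t f\<close> is constant along \<open>h\<close>.\<close>

lemma P_smoothing:
  assumes t: "t > 0" and f: "f \<in> bcontfun" and B: "\<And>x. \<bar>f x\<bar> \<le> B"
    and z: "op_sqrt (Q_op T Q t) z = T t h"
  obtains g where "g \<in> bcontfun" "has_dir_deriv (P t f) h g" "\<And>x. \<bar>g x\<bar> \<le> norm z * B"
proof (cases "z = 0")
  case True
  have "op_sqrt (Q_op T Q t) 0 = 0"
    using t by (intro linear_0 bounded_linear.linear op_sqrt_props Q_op_bounded_linear Q_op_selfadjoint Q_op_nonneg) auto
  then have h0: "T t h = 0" using z True by simp
  have "P t f (x + s *\<^sub>R h) = P t f x" for x s
    using t by (simp add: P_eq bcontfunD(3)[OF f] blinfun.add_right blinfun.scaleR_right h0)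
  then have "has_dir_deriv (P t f) h (\<lambda>x. 0)" by (simp add: has_dir_deriv_def)
  then show ?thesis using True by (intro that[of "\<lambda>x. 0"]) (auto simp: const_bcontfun)
next
  case False
  have t0: "t \<ge> 0" using t by simp
  note S = Q_op_bounded_linear[OF t0] Q_op_selfadjoint[OF t0] Q_op_nonneg[OF t0]
  define u where "u = z /\<^sub>R norm z"
  have u: "norm u = 1" using False by (simp add: u_def)
  define v where "v = op_sqrt (Q_op T Q t) u"
  have v: "norm z *\<^sub>R v = T t h"
    using linear_scale[OF bounded_linear.linear[OF op_sqrt_props(1)[OF S]], of "inverse (norm z)" z] False z
    by (simp add: v_def u_def)
  obtain \<nu> :: "'a measure" where \<nu>: "prob_space \<nu>" and s\<nu>[measurable_cong]: "sets \<nu> = sets borel"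
    and split: "centered_gaussian (Q_op T Q t) = distr (std_normal_distribution \<Otimes>\<^sub>M \<nu>) borel (\<lambda>(r, y). r *\<^sub>R v + y)"
    using centered_gaussian_split[OF S trace[OF t] u] unfolding v_def by metis
  let ?N = std_normal_distribution
  interpret N: real_distribution ?N by (rule real_dist_normal_dist)
  interpret \<nu>: prob_space \<nu> by fact
  interpret PP: pair_prob_space ?N \<nu> ..
  note [measurable] = bcontfunD(3)[OF f]
  \<comment> \<open>\<open>f\<close> averaged over the component \<nu>, leaving its dependence on
    the single normal variable \<open>r\<close>.\<close>
  define G where "G a r = (\<integral>y. f (a + r *\<^sub>R v + y) \<partial>\<nu>)" for a r
  have Gc: "continuous_on UNIV (\<lambda>p. G (p1 p) (p2 p))" if "continuous_on UNIV p1" "continuous_on UNIV p2" for p1 :: "'d::{first_countable_topology,t2_space} \<Rightarrow> 'a" and p2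
    unfolding G_def
    by (rule continuous_on_integral[where w="\<lambda>_. B"])
      (auto simp: B intro!: continuous_intros that continuous_on_compose2[OF bcontfunD(1)[OF f]])
  have G_cont: "continuous_on UNIV (G a)" for a
    using Gc[of "\<lambda>_. a" "\<lambda>r. r"] by simp
  then have Gm[measurable]: "G a \<in> borel_measurable borel" for a by (rule borel_measurable_continuous_onI)
  have GB: "\<bar>G a r\<bar> \<le> B" for a r
  proof -
    have "norm (G a r) \<le> (\<integral>y. B \<partial>\<nu>)"
      unfolding G_def by (intro integral_norm_le \<nu>.integrable_const_bound[of _ B])
        (auto simp: B intro: order_trans[OF abs_ge_zero B])
    then show ?thesis by (simp add: \<nu>.prob_space)
  qed
  \<comment> \<open>Since T t h equals norm z times \<open>v\<close>, moving \<open>x\<close> by s h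
    is the same as shifting \<open>r\<close> by s norm z.\<close>
  have PG: "P t f (x + s *\<^sub>R h) = (LINT r|?N. G (T t x) (r + s * norm z))" for x s
  proof -
    have "P t f (x + s *\<^sub>R h) = (\<integral>p. f (T t (x + s *\<^sub>R h) + (fst p *\<^sub>R v + snd p)) \<partial>(?N \<Otimes>\<^sub>M \<nu>))"
      using t by (simp add: ou_semigroup_def split integral_distr case_prod_beta)
    also have "\<dots> = (LINT r|?N. \<integral>y. f (T t (x + s *\<^sub>R h) + (r *\<^sub>R v + y)) \<partial>\<nu>)"
      by (subst PP.integral_fst'[symmetric]) (auto intro!: PP.integrable_const_bound[of _ B] B)
    also have "\<dots> = (LINT r|?N. G (T t x) (r + s * norm z))"
      unfolding G_def by (simp add: blinfun.add_right blinfun.scaleR_right flip: v) (simp add: algebra_simps)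
    finally show ?thesis .
  qed
  define g where "g x = norm z * (LINT r|?N. r * G (T t x) r)" for x
  have "has_dir_deriv (P t f) h g"
    unfolding has_dir_deriv_def
  proof
    fix x
    have "((\<lambda>s. LINT r|?N. G (T t x) (r + s)) has_real_derivative (LINT r|?N. r * G (T t x) r)) (at (0 * norm z))"
      using std_normal_shift_derivative[OF Gm GB] by simp
    moreover have "((\<lambda>s. s * norm z) has_real_derivative norm z) (at 0)" by (auto intro!: derivative_eq_intros)
    ultimately have "((\<lambda>s. LINT r|?N. G (T t x) (r + s * norm z)) has_real_derivative (LINT r|?N. r * G (T t x) r) * norm z) (at 0)"
      by (rule DERIV_chain2)
    then show "((\<lambda>s. P t f (x + s *\<^sub>R h)) has_real_derivative g x) (at 0)"
      unfolding PG g_def by (simp add: mult.commute)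
  qed
  moreover have bd: "\<bar>g x\<bar> \<le> norm z * B" for x
  proof -
    have "norm (LINT r|?N. r * G (T t x) r) \<le> (LINT r|?N. \<bar>r\<bar> * B)"
    proof (rule integral_norm_le)
      show i: "integrable ?N (\<lambda>r. \<bar>r\<bar> * B)" using std_normal_abs_moment_le(2) by simp
      show "norm (r * G (T t x) r) \<le> \<bar>r\<bar> * B" for r by (simp add: abs_mult GB mult_left_mono)
      then show "integrable ?N (\<lambda>r. r * G (T t x) r)"
        by (intro Bochner_Integration.integrable_bound[OF i]) (auto intro: order_trans[OF _ abs_ge_self])
    qed
    also have "\<dots> \<le> B"
      using mult_right_mono[OF std_normal_abs_moment_le(1), of B] order_trans[OF abs_ge_zero B] by simp
    finally show ?thesis by (simp add: g_def abs_mult mult_left_mono)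
  qed
  moreover have "g \<in> bcontfun"
  proof (rule bcontfun_normI)
    show "continuous_on UNIV g"
      unfolding g_def
    proof (rule continuous_on_mult[OF continuous_on_const continuous_on_integral[where w="\<lambda>r. \<bar>r\<bar> * B"]])
      show "continuous_on UNIV (\<lambda>x. r * G (T t x) r)" for r
        by (intro continuous_on_mult continuous_on_const Gc continuous_intros)
    qed (use std_normal_abs_moment_le(2) in \<open>auto simp: abs_mult GB mult_left_mono\<close>)
  qed (use bd in auto)
  ultimately show ?thesis by (intro that)
qed

lemma P_commute_dir_deriv:
  assumes t: "t \<ge> 0" and f: "f \<in> bcontfun" and g: "g \<in> bcontfun" and d: "has_dir_deriv f (T t h) g"
  shows "has_dir_deriv (P t f) h (P t g)"
proof (rule has_dir_derivI)
  fix x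
  note [measurable] = bcontfunD(3)[OF f] bcontfunD(3)[OF g] note [measurable_cong] = \<mu>_sets[OF t]
  interpret prob_space "\<mu> t" by (rule \<mu>_prob[OF t])
  obtain B where B: "\<And>x. \<bar>g x\<bar> \<le> B" using bcontfunD(2)[OF g] by auto
  have "((\<lambda>s. \<integral>y. (f ((T t x + y) + s *\<^sub>R T t h) - f (T t x + y)) / s \<partial>\<mu> t) \<longlongrightarrow> (\<integral>y. g (T t x + y) \<partial>\<mu> t)) (at 0)"
  proof (rule integral_dominated_convergence_at[where w="\<lambda>_. B"])
    show "norm ((f ((T t x + y) + s *\<^sub>R T t h) - f (T t x + y)) / s) \<le> B" if "s \<noteq> 0" for s y
      using has_dir_deriv_increment[OF d B, of "T t x + y" s] that by (simp add: field_simps)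
  qed (use has_dir_deriv_tendsto[OF d] in auto)
  moreover have "(\<integral>y. (f ((T t x + y) + s *\<^sub>R T t h) - f (T t x + y)) / s \<partial>\<mu> t) = (P t f (x + s *\<^sub>R h) - P t f x) / s" for s
  proof -
    have eq: "(T t x + y) + s *\<^sub>R T t h = T t (x + s *\<^sub>R h) + y" for y
      by (simp add: blinfun.add_right blinfun.scaleR_right)
    show ?thesis
      unfolding eq using P_integrable[OF t f, of x] P_integrable[OF t f, of "x + s *\<^sub>R h"]
      by (simp add: P_eq[OF t])
  qed
  ultimately show "((\<lambda>s. (P t f (x + s *\<^sub>R h) - P t f x) / s) \<longlongrightarrow> P t g x) (at 0)"
    by (simp only: P_eq[OF t bcontfunD(3)[OF g]])
qed

end

section \<open>Iterated derivatives\<close>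

lemma has_dir_deriv_sum:
  assumes "has_dir_deriv f h g" "has_dir_deriv f' h g'"
  shows "has_dir_deriv (\<lambda>x. f x + f' x) h (\<lambda>x. g x + g' x)"
  using assms by (auto simp: has_dir_deriv_def intro!: derivative_intros)

lemma has_dir_deriv_cmult:
  assumes "has_dir_deriv f h g"
  shows "has_dir_deriv (\<lambda>x. c * f x) h (\<lambda>x. c * g x)"
  using assms by (auto simp: has_dir_deriv_def intro!: DERIV_cmult)

text \<open>\<open>Lim\<close> returns an unspecified value when no limit exists; a proven
  directional derivative is what allows an iterated derivative to be evaluated.\<close>

lemma iter_deriv_Cons_eq:
  assumes "has_dir_deriv (iter_deriv f hs) h g"
  shows "iter_deriv f (h # hs) = g"
  using has_dir_deriv_tendsto[OF assms] by (auto simp: fun_eq_iff intro!: tendsto_Lim)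

text \<open>The second clause says that the limits in \<open>iter_deriv\<close> are genuine; the
  continuity in the first is what makes the derivatives additive in each direction.\<close>

definition smooth_to :: "nat \<Rightarrow> ('a::real_normed_vector \<Rightarrow> real) \<Rightarrow> bool" where
  "smooth_to n f \<longleftrightarrow>
     (\<forall>hs. length hs \<le> n \<longrightarrow> iter_deriv f hs \<in> bcontfun) \<and>
     (\<forall>hs h. length hs < n \<longrightarrow> has_dir_deriv (iter_deriv f hs) h (iter_deriv f (h # hs)))"

lemma smooth_toD:
  assumes "smooth_to n f"
  shows "length hs \<le> n \<Longrightarrow> iter_deriv f hs \<in> bcontfun"
    and "length hs < n \<Longrightarrow> has_dir_deriv (iter_deriv f hs) h (iter_deriv f (h # hs))"
  using assms by (auto simp: smooth_to_def)

lemma iter_deriv_sum: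
  assumes f: "smooth_to n f" and g: "smooth_to n g" and "length hs \<le> n"
  shows "iter_deriv (\<lambda>x. f x + g x) hs = (\<lambda>x. iter_deriv f hs x + iter_deriv g hs x)"
  using assms(3)
proof (induction hs)
  case (Cons h hs)
  have "iter_deriv (\<lambda>x. f x + g x) hs = (\<lambda>x. iter_deriv f hs x + iter_deriv g hs x)" using Cons by simp
  then show ?case
    using has_dir_deriv_sum[OF smooth_toD(2)[OF f, of hs h] smooth_toD(2)[OF g, of hs h]] Cons.prems
    by (intro iter_deriv_Cons_eq) (simp del: iter_deriv.simps)
qed simp

text \<open>In the outermost slot this is additivity and homogeneity of directional derivatives; in
  a deeper slot the linear identity holds by induction and is differentiated along the outer
  direction.\<close>

lemma iter_deriv_linear:
  assumes f: "smooth_to n f" and "length hs \<le> n" "i < length hs"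
  shows "linear (\<lambda>h. iter_deriv f (hs[i := h]) x)"
proof -
  have "(iter_deriv f (hs[i := a + b]) = (\<lambda>x. iter_deriv f (hs[i := a]) x + iter_deriv f (hs[i := b]) x)) \<and>
      (iter_deriv f (hs[i := c *\<^sub>R a]) = (\<lambda>x. c * iter_deriv f (hs[i := a]) x))" for a b c
    using assms(2,3)
  proof (induction hs arbitrary: i)
    case (Cons h0 hs)
    note dd = smooth_toD(2)[OF f]
    show ?case
    proof (cases i)
      case 0
      have l: "length hs < n" using Cons.prems by simp
      have "continuous_on UNIV (iter_deriv f (b # hs))"
        using Cons.prems by (intro bcontfunD smooth_toD(1)[OF f]) simp
      from has_dir_deriv_add[OF dd[OF l, of a] dd[OF l, of b] this] has_dir_deriv_scale[OF dd[OF l, of a], of c]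
      show ?thesis using 0 by (auto dest!: iter_deriv_Cons_eq simp del: iter_deriv.simps)
    next
      case (Suc j)
      have l: "length (hs[j := v]) < n" for v using Cons.prems by simp
      from Cons.IH[of j] Cons.prems Suc
      have IH: "iter_deriv f (hs[j := a + b]) = (\<lambda>x. iter_deriv f (hs[j := a]) x + iter_deriv f (hs[j := b]) x)"
        "iter_deriv f (hs[j := c *\<^sub>R a]) = (\<lambda>x. c * iter_deriv f (hs[j := a]) x)" by auto
      have "has_dir_deriv (iter_deriv f (hs[j := a + b])) h0 (\<lambda>x. iter_deriv f (h0 # hs[j := a]) x + iter_deriv f (h0 # hs[j := b]) x)"
        unfolding IH by (intro has_dir_deriv_sum dd l)
      moreover have "has_dir_deriv (iter_deriv f (hs[j := c *\<^sub>R a])) h0 (\<lambda>x. c * iter_deriv f (h0 # hs[j := a]) x)"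
        unfolding IH by (intro has_dir_deriv_cmult dd l)
      ultimately show ?thesis
        using Suc by (auto dest!: iter_deriv_Cons_eq simp del: iter_deriv.simps)
    qed
  qed simp
  then show ?thesis by (intro linearI) (auto simp: fun_eq_iff)
qed

abbreviation norm_prod :: "'a::real_normed_vector list \<Rightarrow> real" where
  "norm_prod hs \<equiv> prod_list (map norm hs)"

lemma norm_prod_nonneg: "0 \<le> norm_prod hs"
  by (induction hs) auto

text \<open>The witness is the inf-convolution of \<open>f\<close> with \<open>N \<epsilon>\<^sup>\<alpha>\<^sup>-\<^sup>1 \<parallel>\<cdot>\<parallel>\<close>.\<close>

lemma holder_lipschitz_approximation:
  fixes f :: "'a::real_normed_vector \<Rightarrow> real"
  assumes \<alpha>: "0 < \<alpha>" "\<alpha> < 1" and N: "N \<ge> 0" and B: "\<And>x. \<bar>f x\<bar> \<le> N"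
    and hol: "\<And>x h. h \<noteq> 0 \<Longrightarrow> \<bar>f (x + h) - f x\<bar> \<le> N * norm h powr \<alpha>"
    and eps: "\<epsilon> > 0"
  obtains g where "\<And>x h. \<bar>g (x + h) - g x\<bar> \<le> N * \<epsilon> powr (\<alpha> - 1) * norm h"
    "\<And>x. \<bar>f x - g x\<bar> \<le> N * \<epsilon> powr \<alpha>" "g \<in> bcontfun"
proof -
  \<comment> \<open>The slope at which Hoelder growth r^\<alpha> meets K r, namely at r =
    \<epsilon>.\<close>
  define K where "K = N * \<epsilon> powr (\<alpha> - 1)"
  have K: "K \<ge> 0" using N by (simp add: K_def)
  define g where "g x = (INF z. f z + K * norm (x - z))" for x
  have bdd: "bdd_below (range (\<lambda>z. f z + K * norm (x - z)))" for x
  proof (rule bdd_belowI[of _ "- N"])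
    fix r assume "r \<in> range (\<lambda>z. f z + K * norm (x - z))"
    then obtain z where "r = f z + K * norm (x - z)" by auto
    moreover have "- N \<le> f z" using B[of z] by simp
    moreover have "0 \<le> K * norm (x - z)" using K by simp
    ultimately show "- N \<le> r" by linarith
  qed
  have le: "g x \<le> f z + K * norm (x - z)" for x z
    unfolding g_def by (rule cINF_lower[OF bdd]) simp
  have half: "g (x + h) \<le> g x + K * norm h" for x h
  proof -
    have "g (x + h) - K * norm h \<le> g x"
      unfolding g_def[of x]
    proof (rule cINF_greatest)
      fix z
      have "K * norm (x + h - z) \<le> K * (norm h + norm (x - z))"
        using K norm_triangle_ineq[of h "x - z"] by (intro mult_left_mono) (auto simp: algebra_simps)
      then show "g (x + h) - K * norm h \<le> f z + K * norm (x - z)"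
        using le[of "x + h" z] by (simp add: algebra_simps)
    qed simp
    then show ?thesis by simp
  qed
  have lip: "\<bar>g (x + h) - g x\<bar> \<le> K * norm h" for x h
    using half[of x h] half[of "x + h" "- h"] by simp
  have app: "\<bar>f x - g x\<bar> \<le> N * \<epsilon> powr \<alpha>" for x
  proof -
    have "f x - N * \<epsilon> powr \<alpha> \<le> g x"
      unfolding g_def
    proof (rule cINF_greatest)
      fix z
      have "f x - f z \<le> N * \<epsilon> powr \<alpha> + K * norm (x - z)"
      proof (cases "x = z")
        case False
        define r where "r = norm (x - z)"
        have r: "r > 0" using False by (simp add: r_def)
        have "f x - f z \<le> N * r powr \<alpha>" using hol[of "x - z" z] False by (simp add: r_def)
        \<comment> \<open>Up to distance \<epsilon> the Hoelder bound is at most its value at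
          \<epsilon>; beyond it, r^\<alpha> = r^(\<alpha>-1) r is at most \<epsilon>^(\<alpha>-1) r,
          which the cone absorbs.\<close>
        also have "\<dots> \<le> N * \<epsilon> powr \<alpha> + K * r"
        proof (cases "r \<le> \<epsilon>")
          case True
          then have "N * r powr \<alpha> \<le> N * \<epsilon> powr \<alpha>"
            using N r \<alpha> by (intro mult_left_mono powr_mono2) auto
          moreover have "0 \<le> K * r" using K r by simp
          ultimately show ?thesis by linarith
        next
          case False
          then have "r powr (\<alpha> - 1) \<le> \<epsilon> powr (\<alpha> - 1)" using eps \<alpha> by (intro powr_mono2') auto
          then have "N * (r powr (\<alpha> - 1) * r) \<le> N * (\<epsilon> powr (\<alpha> - 1) * r)"
            using N r by (intro mult_left_mono mult_right_mono) auto
          moreover have "r powr (\<alpha> - 1) * r = r powr \<alpha>" using r by (simp add: powr_diff)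
          moreover have "0 \<le> N * \<epsilon> powr \<alpha>" using N by simp
          ultimately show ?thesis by (simp add: K_def mult.assoc)
        qed
        finally show ?thesis by (simp add: r_def)
      qed (use N in simp)
      then show "f x - N * \<epsilon> powr \<alpha> \<le> f z + K * norm (x - z)" by simp
    qed simp
    moreover have "g x \<le> f x" using le[of x x] by simp
    ultimately show ?thesis by simp
  qed
  have "continuous_on UNIV g"
  proof (rule lipschitz_on_continuous_on)
    show "K-lipschitz_on UNIV g"
    proof (rule lipschitz_onI)
      show "dist (g x) (g y) \<le> K * dist x y" for x y
        using lip[of y "x - y"] by (simp add: dist_norm)
    qed (rule K)
  qed
  moreover have "norm (g x) \<le> N + N * \<epsilon> powr \<alpha>" for x
    using app[of x] B[of x] by simp
  ultimately have "g \<in> bcontfun" by (rule bcontfun_normI)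
  then show ?thesis using lip app by (intro that[of g]) (auto simp: K_def)
qed

section \<open>Iterated derivatives of the semigroup for times up to 1\<close>

text \<open>The two standing assumptions in the form used below: some preimage \<open>z\<close> with
  a norm bound replaces the pseudo-inverse, and on (0,1] the exponential growth factor is part of
  \<Gamma>.\<close>

locale ou_smoothing = ornstein_uhlenbeck T Q
  for T :: "real \<Rightarrow> 'a::{real_inner,banach,second_countable_topology} \<Rightarrow>\<^sub>L 'a" and Q :: "'a \<Rightarrow>\<^sub>L 'a" +
  fixes \<theta> \<Gamma> :: real
  assumes \<theta>: "\<theta> > 0" and \<Gamma>: "\<Gamma> \<ge> 0"
    and smoothing: "0 < t \<Longrightarrow> t \<le> 1 \<Longrightarrow>
      \<exists>z. op_sqrt (Q_op T Q t) z = T t h \<and> norm z \<le> \<Gamma> * t powr (- \<theta>) * norm h"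
begin

definition TM :: real where "TM = (SOME M. M \<ge> 1 \<and> (\<forall>t\<in>{0..1}. norm (T t) \<le> M))"

lemma TM: "TM \<ge> 1" "0 \<le> t \<Longrightarrow> t \<le> 1 \<Longrightarrow> norm (T t x) \<le> TM * norm x"
proof -
  have "\<exists>M. M \<ge> 1 \<and> (\<forall>t\<in>{0..1}. norm (T t) \<le> M)"
    using C0_semigroup_locally_bounded[OF C0, of 1] by (metis atLeastAtMost_iff)
  then have M: "TM \<ge> 1 \<and> (\<forall>t\<in>{0..1}. norm (T t) \<le> TM)" unfolding TM_def by (rule someI_ex)
  then show "TM \<ge> 1" by blast
  show "norm (T t x) \<le> TM * norm x" if "0 \<le> t" "t \<le> 1"
    using order_trans[OF norm_blinfun mult_right_mono[of "norm (T t)" TM "norm x"]] M that by simp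
qed

lemma P_dir_deriv:
  assumes t: "0 < t" "t \<le> 1" and f: "f \<in> bcontfun" and B: "\<And>x. \<bar>f x\<bar> \<le> B"
  obtains g where "g \<in> bcontfun" "has_dir_deriv (P t f) h g" "\<And>x. \<bar>g x\<bar> \<le> \<Gamma> * t powr (- \<theta>) * norm h * B"
proof -
  obtain z where z: "op_sqrt (Q_op T Q t) z = T t h" "norm z \<le> \<Gamma> * t powr (- \<theta>) * norm h"
    using smoothing[OF t] by blast
  obtain g where g: "g \<in> bcontfun" "has_dir_deriv (P t f) h g" "\<And>x. \<bar>g x\<bar> \<le> norm z * B"
    using P_smoothing[OF t(1) f B z(1)] by blast
  show ?thesis
    by (rule that[OF g(1,2) order_trans[OF g(3) mult_right_mono[OF z(2) order_trans[OF abs_ge_zero B]]]])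
qed

lemma iter_deriv_P:
  assumes "length hs = n"
  shows "(\<forall>t f. 0 < t \<longrightarrow> t \<le> 1 \<longrightarrow> f \<in> bcontfun \<longrightarrow> iter_deriv (P t f) hs \<in> bcontfun)"
    and "(\<forall>t f h. 0 < t \<longrightarrow> t \<le> 1 \<longrightarrow> f \<in> bcontfun \<longrightarrow>
        has_dir_deriv (iter_deriv (P t f) hs) h (iter_deriv (P t f) (h # hs)))"
    and "(\<forall>t f s. 0 < t \<longrightarrow> t \<le> 1 \<longrightarrow> f \<in> bcontfun \<longrightarrow> 0 \<le> s \<longrightarrow>
        iter_deriv (P (s + t) f) hs = P s (iter_deriv (P t f) (map (T s) hs)))"
  using assms
proof (induction n arbitrary: hs)
  case 0
  {
    case 1 then show ?case using 0 by (auto intro: P_bcontfun)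
  next
    case 2
    show ?case
    proof (intro allI impI)
      fix t f h assume t: "0 < (t::real)" "t \<le> 1" and f: "f \<in> (bcontfun :: ('a \<Rightarrow> real) set)"
      obtain B where "\<And>x. \<bar>f x\<bar> \<le> B" using bcontfunD(2)[OF f] by auto
      from P_dir_deriv[OF t f this, of h] obtain g where g: "has_dir_deriv (P t f) h g" by blast
      then show "has_dir_deriv (iter_deriv (P t f) hs) h (iter_deriv (P t f) (h # hs))"
        using iter_deriv_Cons_eq[of "P t f" "[]" h g] 2 by (simp del: iter_deriv.simps(2))
    qed
  next
    case 3 then show ?case using 0 by (auto simp: P_add)
  }
next
  case (Suc n)
  have i: "iter_deriv (P t f) hs \<in> bcontfun" if hs: "length hs = Suc n" and t: "0 < t" "t \<le> 1" and f: "f \<in> bcontfun" for t f hs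
  proof -
    obtain h' hs' where hs': "hs = h' # hs'" "length hs' = n" using hs by (cases hs) auto
    have t2: "0 < t / 2" "t / 2 \<le> 1" using t by auto
    let ?k = "iter_deriv (P (t / 2) f) (map (T (t / 2)) hs')"
    have eq: "iter_deriv (P t f) hs' = P (t / 2) ?k"
      using Suc.IH(3)[OF hs'(2), rule_format, OF t2 f, of "t / 2"] t by simp
    have k: "?k \<in> bcontfun" using Suc.IH(1)[of "map (T (t / 2)) hs'"] hs' t2 f by simp
    obtain B where "\<And>x. \<bar>?k x\<bar> \<le> B" using bcontfunD(2)[OF k] by auto
    from P_dir_deriv[OF t2 k this, of h'] obtain g where g: "g \<in> bcontfun" "has_dir_deriv (P (t / 2) ?k) h' g" by blast
    then show ?thesis using iter_deriv_Cons_eq[of "P t f" hs' h' g] unfolding hs'(1) eq by (simp del: iter_deriv.simps)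
  qed
  have iii: "iter_deriv (P (s + t) f) hs = P s (iter_deriv (P t f) (map (T s) hs))"
    if hs: "length hs = Suc n" and t: "0 < t" "t \<le> 1" and f: "f \<in> bcontfun" and s: "0 \<le> s" for t f hs s
  proof -
    obtain h' hs' where hs': "hs = h' # hs'" "length hs' = n" using hs by (cases hs) auto
    let ?K = "iter_deriv (P t f) (map (T s) hs')"
    have eq: "iter_deriv (P (s + t) f) hs' = P s ?K"
      using Suc.IH(3)[OF hs'(2)] t f s by blast
    have "has_dir_deriv ?K (T s h') (iter_deriv (P t f) (map (T s) hs))"
      using Suc.IH(2)[of "map (T s) hs'"] hs' t f by (simp del: iter_deriv.simps)
    moreover have "?K \<in> bcontfun" using Suc.IH(1)[of "map (T s) hs'"] hs' t f by simp
    moreover have "iter_deriv (P t f) (map (T s) hs) \<in> bcontfun" by (rule i) (use hs t f in auto)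
    ultimately have "has_dir_deriv (P s ?K) h' (P s (iter_deriv (P t f) (map (T s) hs)))"
      by (intro P_commute_dir_deriv s)
    then show ?thesis unfolding hs'(1) by (intro iter_deriv_Cons_eq) (simp only: eq)
  qed
  have ii: "has_dir_deriv (iter_deriv (P t f) hs) h (iter_deriv (P t f) (h # hs))"
    if hs: "length hs = Suc n" and t: "0 < t" "t \<le> 1" and f: "f \<in> bcontfun" for t f hs h
  proof -
    have t2: "0 < t / 2" "t / 2 \<le> 1" using t by auto
    let ?k = "iter_deriv (P (t / 2) f) (map (T (t / 2)) hs)"
    have eq: "iter_deriv (P t f) hs = P (t / 2) ?k"
      using iii[OF hs t2 f, of "t / 2"] t by simp
    have k: "?k \<in> bcontfun" using i[of "map (T (t / 2)) hs"] hs t2 f by simp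
    obtain B where "\<And>x. \<bar>?k x\<bar> \<le> B" using bcontfunD(2)[OF k] by auto
    from P_dir_deriv[OF t2 k this, of h] obtain g where g: "has_dir_deriv (iter_deriv (P t f) hs) h g"
      unfolding eq by blast
    then show ?thesis using iter_deriv_Cons_eq[OF g] by (simp only:)
  qed
  {
    case 1 then show ?case using i by blast
  next
    case 2 then show ?case using ii by blast
  next
    case 3 then show ?case using iii by blast
  }
qed

lemma P_split_time:
  assumes "t > 1" "f \<in> bcontfun"
  shows "P t f = P 1 (P (t - 1) f)"
  using P_add[of 1 "t - 1" f] assms by simp

lemma smooth_to_P:
  assumes t: "t > 0" and f: "f \<in> bcontfun"
  shows "smooth_to n (P t f)"
proof (cases "t \<le> 1")
  case True
  then show ?thesis using iter_deriv_P(1,2) t f unfolding smooth_to_def by blast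
next
  case False
  then have "P t f = P 1 (P (t - 1) f)" "P (t - 1) f \<in> bcontfun"
    using f by (auto intro: P_split_time P_bcontfun)
  then show ?thesis using iter_deriv_P(1,2) unfolding smooth_to_def by simp
qed

text \<open>The singularity exponent is kept independent of the order: bounded data start at order 0
  and Lipschitz data at order 1, both with exponent 0.\<close>

definition deriv_bound :: "nat \<Rightarrow> real \<Rightarrow> real \<Rightarrow> ('a \<Rightarrow> real) \<Rightarrow> bool" where
  "deriv_bound n \<gamma> B f \<longleftrightarrow> (\<forall>t hs x. 0 < t \<longrightarrow> t \<le> 1 \<longrightarrow> length hs = n \<longrightarrow>
     \<bar>iter_deriv (P t f) hs x\<bar> \<le> B * t powr (- \<gamma>) * norm_prod hs)"

text \<open>Half the time is used for the \<open>n\<close> known derivatives and half for one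
  smoothing step. \<Gamma> comes from the smoothing, \<open>TM ^ n\<close> from the directions
  transported by T (t/2), and the power of 2 from replacing t by t/2.\<close>

lemma deriv_bound_Suc:
  assumes f: "f \<in> bcontfun" and b: "deriv_bound n \<gamma> B f" and B: "B \<ge> 0"
  shows "deriv_bound (Suc n) (\<gamma> + \<theta>) (\<Gamma> * TM ^ n * 2 powr (\<gamma> + \<theta>) * B) f"
  unfolding deriv_bound_def
proof (intro allI impI)
  fix t :: real and hs :: "'a list" and x :: 'a assume t: "0 < (t::real)" "t \<le> 1" and hs: "length hs = Suc n"
  obtain h' hs' where hs': "hs = h' # hs'" "length hs' = n" using hs by (cases hs) auto
  have t2: "0 < t / 2" "t / 2 \<le> 1" using t by auto
  let ?k = "iter_deriv (P (t / 2) f) (map (T (t / 2)) hs')"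
  have eq: "iter_deriv (P t f) hs' = P (t / 2) ?k"
    using iter_deriv_P(3)[OF hs'(2), rule_format, OF t2 f, of "t / 2"] t by simp
  have k: "?k \<in> bcontfun" using iter_deriv_P(1)[of "map (T (t / 2)) hs'"] hs' t2 f by simp
  have np: "norm_prod (map (T (t / 2)) hs') \<le> TM ^ n * norm_prod hs'"
    unfolding hs'(2)[symmetric]
  proof (induction hs')
    case (Cons a hs')
    have "norm (T (t / 2) a) * norm_prod (map (T (t / 2)) hs') \<le> (TM * norm a) * (TM ^ length hs' * norm_prod hs')"
      using TM(1) t2 by (intro mult_mono Cons TM(2)) (auto simp: norm_prod_nonneg simp del: map_map)
    then show ?case by (simp add: algebra_simps)
  qed simp
  define A where "A = B * (t / 2) powr (- \<gamma>) * (TM ^ n * norm_prod hs')"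
  have kB: "\<bar>?k y\<bar> \<le> A" for y
  proof -
    have "\<bar>?k y\<bar> \<le> B * (t / 2) powr (- \<gamma>) * norm_prod (map (T (t / 2)) hs')"
      using b t2 hs' unfolding deriv_bound_def by (metis length_map)
    also have "\<dots> \<le> A" unfolding A_def using B by (intro mult_left_mono np) auto
    finally show ?thesis .
  qed
  obtain g where g: "has_dir_deriv (P (t / 2) ?k) h' g" "\<And>x. \<bar>g x\<bar> \<le> \<Gamma> * (t / 2) powr (- \<theta>) * norm h' * A"
    using P_dir_deriv[OF t2 k kB, of h'] by blast
  have "iter_deriv (P t f) hs = g"
    unfolding hs'(1) by (rule iter_deriv_Cons_eq) (simp only: eq g)
  then have "\<bar>iter_deriv (P t f) hs x\<bar> \<le> \<Gamma> * (t / 2) powr (- \<theta>) * norm h' * A" using g by simp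
  also have "\<dots> = \<Gamma> * TM ^ n * ((t / 2) powr (- \<theta>) * (t / 2) powr (- \<gamma>)) * B * norm_prod hs"
    by (simp add: A_def hs' algebra_simps)
  also have "(t / 2) powr (- \<theta>) * (t / 2) powr (- \<gamma>) = 2 powr (\<gamma> + \<theta>) * t powr (- (\<gamma> + \<theta>))"
  proof -
    have "(t / 2) powr (- \<theta>) * (t / 2) powr (- \<gamma>) = (t / 2) powr (- (\<gamma> + \<theta>))"
      unfolding powr_add[symmetric] by (rule arg_cong[of _ _ "(powr) (t / 2)"]) simp
    also have "\<dots> = 2 powr (\<gamma> + \<theta>) * t powr (- (\<gamma> + \<theta>))"
      using t by (subst powr_divide) (auto simp only: powr_minus[of 2] divide_inverse inverse_inverse_eq mult.commute)
    finally show ?thesis .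
  qed
  finally show "\<bar>iter_deriv (P t f) hs x\<bar> \<le> \<Gamma> * TM ^ n * 2 powr (\<gamma> + \<theta>) * B * t powr (- (\<gamma> + \<theta>)) * norm_prod hs"
    by (simp add: algebra_simps)
qed

text \<open>Each further order costs t^(-\<theta>). The starting order \<open>n0\<close> is 0 for
  bounded and 1 for Lipschitz functions.\<close>

lemma deriv_bound_add:
  assumes "n0 \<le> n"
  shows "\<exists>C\<ge>0. \<forall>f B. f \<in> bcontfun \<longrightarrow> B \<ge> 0 \<longrightarrow> deriv_bound n0 0 B f \<longrightarrow> deriv_bound n (real (n - n0) * \<theta>) (C * B) f"
  using assms
proof (induction n rule: dec_induct)
  case base
  then show ?case by (intro exI[of _ 1]) auto
next
  case (step n)
  then obtain C where C: "C \<ge> 0" "\<And>f B. f \<in> bcontfun \<Longrightarrow> B \<ge> 0 \<Longrightarrow> deriv_bound n0 0 B f \<Longrightarrow> deriv_bound n (real (n - n0) * \<theta>) (C * B) f"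
    by blast
  let ?\<gamma> = "real (n - n0) * \<theta>"
  show ?case
  proof (intro exI[of _ "\<Gamma> * TM ^ n * 2 powr (?\<gamma> + \<theta>) * C"] conjI allI impI)
    show "0 \<le> \<Gamma> * TM ^ n * 2 powr (?\<gamma> + \<theta>) * C" using \<Gamma> TM(1) C(1) by simp
    fix f :: "'a \<Rightarrow> real" and B assume *: "f \<in> bcontfun" "B \<ge> 0" "deriv_bound n0 0 B f"
    have "deriv_bound (Suc n) (?\<gamma> + \<theta>) (\<Gamma> * TM ^ n * 2 powr (?\<gamma> + \<theta>) * (C * B)) f"
      using * C(1) by (intro deriv_bound_Suc C(2)) auto
    moreover have "real (Suc n - n0) * \<theta> = ?\<gamma> + \<theta>"
      using step.hyps by (simp add: of_nat_diff algebra_simps)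
    ultimately show "deriv_bound (Suc n) (real (Suc n - n0) * \<theta>) (\<Gamma> * TM ^ n * 2 powr (?\<gamma> + \<theta>) * C * B) f"
      by (simp only: mult.assoc)
  qed
qed

lemma deriv_bound_0:
  assumes f: "f \<in> bcontfun" and B: "\<And>x. \<bar>f x\<bar> \<le> B"
  shows "deriv_bound 0 0 B f"
  using P_bound[OF _ f B] by (auto simp: deriv_bound_def)

text \<open>Transporting the increment by T t costs a factor \<open>TM\<close>. Exponents are not
  confined to (0,1): exponent 1 gives the Lipschitz case.\<close>

lemma P_increment:
  assumes f: "f \<in> bcontfun" and t: "0 \<le> t" "t \<le> 1" and \<alpha>: "\<alpha> \<ge> 0" and N: "N \<ge> 0"
    and hol: "\<And>x h. h \<noteq> 0 \<Longrightarrow> \<bar>f (x + h) - f x\<bar> \<le> N * norm h powr \<alpha>" and h: "h \<noteq> 0"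
  shows "\<bar>P t f (x + h) - P t f x\<bar> \<le> N * (TM * norm h) powr \<alpha>"
proof -
  note [measurable] = bcontfunD(3)[OF f] note [measurable_cong] = \<mu>_sets[OF t(1)]
  interpret prob_space "\<mu> t" by (rule \<mu>_prob[OF t(1)])
  let ?C = "N * (TM * norm h) powr \<alpha>"
  have pt: "norm (f (T t (x + h) + y) - f (T t x + y)) \<le> ?C" for y
  proof (cases "T t h = 0")
    case False
    have "\<bar>f ((T t x + y) + T t h) - f (T t x + y)\<bar> \<le> N * norm (T t h) powr \<alpha>" by (rule hol[OF False])
    also have "\<dots> \<le> ?C" using N \<alpha> by (intro mult_left_mono powr_mono2 TM(2) t) auto
    finally show ?thesis by (simp add: blinfun.add_right algebra_simps)
  qed (use N in \<open>simp add: blinfun.add_right\<close>)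
  have "P t f (x + h) - P t f x = (\<integral>y. f (T t (x + h) + y) - f (T t x + y) \<partial>\<mu> t)"
    using P_integrable[OF t(1) f, of x] P_integrable[OF t(1) f, of "x + h"] by (simp add: P_eq[OF t(1)])
  also have "norm \<dots> \<le> (\<integral>y. ?C \<partial>\<mu> t)"
    using P_integrable[OF t(1) f, of x] P_integrable[OF t(1) f, of "x + h"] by (intro integral_norm_le pt) auto
  finally show ?thesis by (simp add: prob_space)
qed

text \<open>Difference quotients inherit the Lipschitz constant, so the first derivative of a
  Lipschitz function's evolution shows no singularity at t = 0.\<close>

lemma deriv_bound_1:
  assumes f: "f \<in> bcontfun" and K: "K \<ge> 0" and lip: "\<And>x h. \<bar>f (x + h) - f x\<bar> \<le> K * norm h"
  shows "deriv_bound 1 0 (K * TM) f"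
  unfolding deriv_bound_def
proof (intro allI impI)
  fix t :: real and hs :: "'a list" and x :: 'a assume t: "0 < (t::real)" "t \<le> 1" and "length hs = 1"
  then obtain h where hs: "hs = [h]" by (cases hs) auto
  have "has_dir_deriv (P t f) h (iter_deriv (P t f) [h])"
    using smooth_toD(2)[OF smooth_to_P[OF t(1) f, of 1], of "[]" h] by simp
  from has_dir_deriv_tendsto[OF this, of x]
  have "((\<lambda>s. \<bar>(P t f (x + s *\<^sub>R h) - P t f x) / s\<bar>) \<longlongrightarrow> \<bar>iter_deriv (P t f) [h] x\<bar>) (at 0)"
    by (rule tendsto_rabs)
  moreover have "\<forall>\<^sub>F s in at 0. \<bar>(P t f (x + s *\<^sub>R h) - P t f x) / s\<bar> \<le> K * TM * norm h"
  proof -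
    have "\<bar>(P t f (x + s *\<^sub>R h) - P t f x) / s\<bar> \<le> K * TM * norm h" if "s \<noteq> 0" for s
    proof (cases "h = 0")
      case False
      have "\<bar>P t f (x + s *\<^sub>R h) - P t f x\<bar> \<le> K * (TM * norm (s *\<^sub>R h)) powr 1"
        using False that t lip by (intro P_increment[OF f _ _ _ K]) auto
      also have "\<dots> = K * TM * norm h * \<bar>s\<bar>" using TM(1) by simp
      finally show ?thesis using that by (simp add: field_simps)
    qed simp
    then show ?thesis by (auto simp: eventually_at intro: exI[of _ 1])
  qed
  ultimately have "\<bar>iter_deriv (P t f) [h] x\<bar> \<le> K * TM * norm h"
    by (rule tendsto_upperbound) simp
  then show "\<bar>iter_deriv (P t f) hs x\<bar> \<le> K * TM * t powr - 0 * norm_prod hs"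
    using t by (simp add: hs del: iter_deriv.simps)
qed

text \<open>The approximant is chosen anew for each \<open>t\<close>. The error f - g contributes
  t^(\<alpha>\<theta>) t^(-n\<theta>) and the Lipschitz part, whose first derivative is free,
  contributes t^((\<alpha>-1)\<theta>) t^(-(n-1)\<theta>); both are
  t^(-(n-\<alpha>)\<theta>).\<close>

lemma deriv_bound_holder:
  assumes n: "n \<ge> 1" and \<alpha>: "0 < \<alpha>" "\<alpha> < 1"
  shows "\<exists>C\<ge>0. \<forall>f N. f \<in> bcontfun \<longrightarrow> N \<ge> 0 \<longrightarrow> (\<forall>x. \<bar>f x\<bar> \<le> N) \<longrightarrow>
    (\<forall>x h. h \<noteq> 0 \<longrightarrow> \<bar>f (x + h) - f x\<bar> \<le> N * norm h powr \<alpha>) \<longrightarrow> deriv_bound n ((n - \<alpha>) * \<theta>) (C * N) f"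
proof -
  obtain C0 where C0: "C0 \<ge> 0" "\<And>f B. f \<in> bcontfun \<Longrightarrow> B \<ge> 0 \<Longrightarrow> deriv_bound 0 0 B f \<Longrightarrow> deriv_bound n (real n * \<theta>) (C0 * B) f"
    using deriv_bound_add[of 0 n] by auto
  obtain C1 where C1: "C1 \<ge> 0" "\<And>f B. f \<in> bcontfun \<Longrightarrow> B \<ge> 0 \<Longrightarrow> deriv_bound 1 0 B f \<Longrightarrow> deriv_bound n (real (n - 1) * \<theta>) (C1 * B) f"
    using deriv_bound_add[of 1 n] n by auto
  show ?thesis
  proof (intro exI[of _ "C0 + C1 * TM"] conjI allI impI)
    show "0 \<le> C0 + C1 * TM" using C0 C1 TM(1) by simp
    fix f :: "'a \<Rightarrow> real" and N assume f: "f \<in> bcontfun" and N: "N \<ge> 0" and B: "\<forall>x. \<bar>f x\<bar> \<le> N"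
      and hol: "\<forall>x h. h \<noteq> 0 \<longrightarrow> \<bar>f (x + h) - f x\<bar> \<le> N * norm h powr \<alpha>"
    show "deriv_bound n ((n - \<alpha>) * \<theta>) ((C0 + C1 * TM) * N) f"
      unfolding deriv_bound_def
    proof (intro allI impI)
      fix t :: real and hs :: "'a list" and x :: 'a assume t: "0 < (t::real)" "t \<le> 1" and hs: "length hs = n"
      obtain g where g: "\<And>x h. \<bar>g (x + h) - g x\<bar> \<le> N * (t powr \<theta>) powr (\<alpha> - 1) * norm h"
        "\<And>x. \<bar>f x - g x\<bar> \<le> N * (t powr \<theta>) powr \<alpha>" "g \<in> bcontfun"
        using holder_lipschitz_approximation[OF \<alpha> N, of f "t powr \<theta>"] B hol t by auto
      define e where "e x = f x - g x" for x
      have e: "e \<in> bcontfun" unfolding e_def by (rule minus_cont[OF f g(3)])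
      have "P t f = (\<lambda>x. P t e x + P t g x)"
        using P_diff[of t f g] t f g(3) by (simp add: fun_eq_iff e_def[abs_def])
      then have split: "iter_deriv (P t f) hs x = iter_deriv (P t e) hs x + iter_deriv (P t g) hs x"
        using iter_deriv_sum[OF smooth_to_P[OF t(1) e, of n] smooth_to_P[OF t(1) g(3), of n], of hs] hs by simp
      let ?E = "t powr (- ((n - \<alpha>) * \<theta>))"
      have "deriv_bound n (real n * \<theta>) (C0 * (N * (t powr \<theta>) powr \<alpha>)) e"
        using N g(2) by (intro C0(2) e deriv_bound_0) (auto simp: e_def)
      then have "\<bar>iter_deriv (P t e) hs x\<bar> \<le> C0 * (N * (t powr \<theta>) powr \<alpha>) * t powr (- (real n * \<theta>)) * norm_prod hs"
        using t hs by (simp add: deriv_bound_def)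
      also have "\<dots> = C0 * N * ((t powr \<theta>) powr \<alpha> * t powr (- (real n * \<theta>))) * norm_prod hs"
        by (simp only: mult_ac)
      also have "(t powr \<theta>) powr \<alpha> * t powr (- (real n * \<theta>)) = ?E"
        unfolding powr_powr powr_add[symmetric] by (simp add: algebra_simps)
      finally have be: "\<bar>iter_deriv (P t e) hs x\<bar> \<le> C0 * N * ?E * norm_prod hs" .
      have "deriv_bound n (real (n - 1) * \<theta>) (C1 * (N * (t powr \<theta>) powr (\<alpha> - 1) * TM)) g"
        using N TM(1) by (intro C1(2) g deriv_bound_1) auto
      then have "\<bar>iter_deriv (P t g) hs x\<bar> \<le> C1 * (N * (t powr \<theta>) powr (\<alpha> - 1) * TM) * t powr (- (real (n - 1) * \<theta>)) * norm_prod hs"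
        using t hs by (simp add: deriv_bound_def)
      also have "\<dots> = C1 * N * TM * ((t powr \<theta>) powr (\<alpha> - 1) * t powr (- (real (n - 1) * \<theta>))) * norm_prod hs"
        by (simp only: mult_ac)
      also have "(t powr \<theta>) powr (\<alpha> - 1) * t powr (- (real (n - 1) * \<theta>)) = ?E"
        unfolding powr_powr powr_add[symmetric] using n by (simp add: of_nat_diff algebra_simps)
      finally have bg: "\<bar>iter_deriv (P t g) hs x\<bar> \<le> C1 * N * TM * ?E * norm_prod hs" .
      have "\<bar>iter_deriv (P t f) hs x\<bar> \<le> C0 * N * ?E * norm_prod hs + C1 * N * TM * ?E * norm_prod hs"
        unfolding split by (rule abs_triangle_ineq[THEN order_trans, OF add_mono[OF be bg]])
      then show "\<bar>iter_deriv (P t f) hs x\<bar> \<le> (C0 + C1 * TM) * N * t powr (- ((n - \<alpha>) * \<theta>)) * norm_prod hs"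
        by (simp add: algebra_simps)
    qed
  qed
qed

end

section \<open>The resolvent and the generator\<close>

lemma integrable_product:
  fixes f :: "'b \<Rightarrow> real" and g :: "'c \<Rightarrow> real"
  assumes "sigma_finite_measure M1" "sigma_finite_measure M2" and f: "integrable M1 f" and g: "integrable M2 g"
  shows "integrable (M1 \<Otimes>\<^sub>M M2) (\<lambda>p. f (fst p) * g (snd p))"
proof -
  interpret M1: sigma_finite_measure M1 by fact
  interpret M2: sigma_finite_measure M2 by fact
  interpret P: pair_sigma_finite M1 M2 ..
  note [measurable] = borel_measurable_integrable[OF f] borel_measurable_integrable[OF g]
  show ?thesis
    using f g by (intro P.Fubini_integrable) (auto simp: abs_mult)
qed

text \<open>The Laplace kernel extended by 0 to negative times, so that time integrals, translations
  and convolutions run over the whole line.\<close>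

definition exp_weight :: "real \<Rightarrow> real \<Rightarrow> real" where
  "exp_weight l t = indicator {0..} t * exp (- l * t)"

lemma exp_weight_measurable[measurable]: "exp_weight l \<in> borel_measurable borel"
  unfolding exp_weight_def by measurable

lemma exp_weight_nonneg: "0 \<le> exp_weight l t"
  by (simp add: exp_weight_def)

lemma exp_weight_integral:
  assumes l: "l > 0"
  shows "integrable lborel (exp_weight l)" "(LINT t|lborel. exp_weight l t) = 1 / l"
proof -
  interpret E: prob_space "density lborel (exponential_density l)" by (rule prob_space_exponential_density[OF l])
  have eq: "exponential_density l t = l * exp_weight l t" for t
    by (auto simp: exponential_density_def exp_weight_def mult.commute)
  have "(\<integral>\<^sup>+t. ennreal (l * exp_weight l t) \<partial>lborel) = 1"
    using E.emeasure_space_1 by (simp add: emeasure_density eq)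
  then have "has_bochner_integral lborel (\<lambda>t. l * exp_weight l t) 1"
    using l by (intro has_bochner_integral_nn_integral) (auto simp: exp_weight_nonneg)
  from has_bochner_integral_mult_right[OF this, of "1 / l"] l
  have "has_bochner_integral lborel (exp_weight l) (1 / l)" by simp
  then show "integrable lborel (exp_weight l)" "(LINT t|lborel. exp_weight l t) = 1 / l"
    by (auto simp: has_bochner_integral_iff)
qed

text \<open>The resolvent identity at the level of the kernels.\<close>

lemma exp_weight_convolution:
  assumes "l \<noteq> m"
  shows "(LINT t|lborel. exp_weight l t * exp_weight m (r - t)) = (exp_weight m r - exp_weight l r) / (l - m)"
proof (cases "r \<ge> 0")
  case True
  define c where "c = m - l"
  have c: "c \<noteq> 0" using assms by (simp add: c_def)
  have "(LINT t|lborel. exp_weight l t * exp_weight m (r - t)) = (LINT t|lborel. indicator {0..r} t *\<^sub>R (exp (- m * r) * exp (c * t)))"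
    by (intro Bochner_Integration.integral_cong) (auto simp: exp_weight_def indicator_def c_def algebra_simps simp flip: exp_add)
  also have "\<dots> = exp (- m * r) * exp (c * r) / c - exp (- m * r) * exp (c * 0) / c"
    using True c
    by (intro integral_FTC_Icc) (auto intro!: derivative_eq_intros continuous_intros simp: has_real_derivative_iff_has_vector_derivative[symmetric])
  also have "\<dots> = (exp_weight m r - exp_weight l r) / (l - m)"
  proof -
    have "exp (- m * r) * exp (c * r) = exp (- l * r)" by (simp add: c_def algebra_simps flip: exp_add)
    then have "exp (- m * r) * exp (c * r) / c - exp (- m * r) * exp (c * 0) / c = (exp (- l * r) - exp (- m * r)) / c"
      by (simp add: diff_divide_distrib)
    also have "\<dots> = (exp (- m * r) - exp (- l * r)) / (l - m)"
      using c by (simp add: c_def divide_simps) (simp add: algebra_simps)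
    finally show ?thesis using True by (simp add: exp_weight_def)
  qed
  finally show ?thesis .
next
  case False
  then have "exp_weight l t * exp_weight m (r - t) = 0" for t by (auto simp: exp_weight_def indicator_def)
  then have "(LINT t|lborel. exp_weight l t * exp_weight m (r - t)) = 0" by (simp only: Bochner_Integration.integral_zero)
  then show ?thesis using False by (simp add: exp_weight_def)
qed

section \<open>The resolvent as a Laplace transform\<close>

context ornstein_uhlenbeck
begin

text \<open>\<open>P (t + s) f = P t (P s f)\<close>, and P s f tends to \<open>f\<close> pointwise
  and boundedly. This reasoning produces right limits, which is why measurability in time is drawn
  from right continuity.\<close>

lemma P_right_continuous:
  assumes t: "t \<ge> 0" and f: "f \<in> bcontfun"
  shows "((\<lambda>s. P (t + s) f x) \<longlongrightarrow> P t f x) (at_right 0)"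
proof -
  note [measurable] = bcontfunD(3)[OF f] note [measurable_cong] = \<mu>_sets[OF t]
  interpret prob_space "\<mu> t" by (rule \<mu>_prob[OF t])
  obtain B where B: "\<And>x. \<bar>f x\<bar> \<le> B" using bcontfunD(2)[OF f] by auto
  have "((\<lambda>s. \<integral>y. P s f (T t x + y) \<partial>\<mu> t) \<longlongrightarrow> (\<integral>y. f (T t x + y) \<partial>\<mu> t)) (at_right 0)"
  proof (rule integral_dominated_convergence_at[where w="\<lambda>_. B"])
    fix s :: real assume "s \<in> {0<..}"
    then have s: "s \<ge> 0" by simp
    note [measurable] = bcontfunD(3)[OF P_bcontfun[OF s f]]
    show "(\<lambda>y. P s f (T t x + y)) \<in> borel_measurable (\<mu> t)" by measurable
    show "norm (P s f (T t x + y)) \<le> B" for y using P_bound[OF s f B] by simp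
  qed (auto intro: P_tendsto_0[OF f])
  moreover have "\<forall>\<^sub>F s in at_right 0. (\<integral>y. P s f (T t x + y) \<partial>\<mu> t) = P (t + s) f x"
    using bcontfunD(3)[OF P_bcontfun[OF _ f]]
    by (auto simp: eventually_at_right_field P_add[OF t _ f] P_eq[OF t] intro!: exI[of _ 1])
  ultimately have "((\<lambda>s. P (t + s) f x) \<longlongrightarrow> (\<integral>y. f (T t x + y) \<partial>\<mu> t)) (at_right 0)"
    by (rule Lim_transform_eventually)
  then show ?thesis by (simp add: P_eq[OF t])
qed

text \<open>A right-continuous function of \<open>t\<close> is the limit of its values on a grid just to the right of \<open>t\<close>.\<close>

lemma P_measurable:
  assumes f: "f \<in> bcontfun"
  shows "(\<lambda>(t, x). P (max 0 t) f x) \<in> borel_measurable (borel \<Otimes>\<^sub>M borel)"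
proof -
  define G where "G n k x = P (max 0 ((real_of_int k + 1) / Suc n)) f x" for n k x
  have [measurable]: "G n k \<in> borel_measurable borel" for n k
    unfolding G_def by (intro bcontfunD P_bcontfun f) simp
  show ?thesis
  proof (rule borel_measurable_LIMSEQ_real)
    show "(\<lambda>p :: real \<times> 'a. G n \<lfloor>max 0 (fst p) * real (Suc n)\<rfloor> (snd p)) \<in> borel_measurable (borel \<Otimes>\<^sub>M borel)" for n
      by (rule measurable_compose_countable[where g="\<lambda>p. \<lfloor>max 0 (fst p) * real (Suc n)\<rfloor>" and f="\<lambda>k p. G n k (snd p)"]) measurable
    fix p :: "real \<times> 'a"
    obtain t x where p: "p = (t, x)" by force
    define u where "u = max 0 t"
    have u: "u \<ge> 0" by (simp add: u_def)
    \<comment> \<open>Rounding down and adding 1 places the grid point strictly to the right of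
      \<open>u\<close>, as a limit at \<open>at_right 0\<close> demands.\<close>
    define s where "s n = (real_of_int \<lfloor>u * Suc n\<rfloor> + 1) / Suc n - u" for n
    have s: "0 < s n" "s n \<le> inverse (Suc n)" for n
    proof -
      define N where "N = real (Suc n)"
      have N: "N > 0" by (simp add: N_def)
      have "u * N < real_of_int \<lfloor>u * N\<rfloor> + 1" "real_of_int \<lfloor>u * N\<rfloor> \<le> u * N" by linarith+
      then have "u < (real_of_int \<lfloor>u * N\<rfloor> + 1) / N" "real_of_int \<lfloor>u * N\<rfloor> / N \<le> u"
        using N by (simp_all add: pos_less_divide_eq pos_divide_le_eq)
      then show "0 < s n" "s n \<le> inverse (Suc n)"
        unfolding s_def N_def[symmetric] by (auto simp: add_divide_distrib inverse_eq_divide)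
    qed
    have "s \<longlonglongrightarrow> 0"
      by (rule tendsto_sandwich[OF _ _ tendsto_const LIMSEQ_inverse_real_of_nat])
        (use s in \<open>auto intro!: always_eventually less_imp_le\<close>)
    then have "filterlim s (at_right 0) sequentially"
      using s(1) by (auto simp: filterlim_at intro!: always_eventually) (metis less_irrefl)
    from filterlim_compose[OF P_right_continuous[OF u f, of x] this]
    have "(\<lambda>n. P (u + s n) f x) \<longlonglongrightarrow> P u f x" .
    moreover have "u + s n = max 0 ((real_of_int \<lfloor>u * Suc n\<rfloor> + 1) / Suc n)" for n
      using u s(1)[of n] by (simp add: s_def)
    ultimately show "(\<lambda>n. G n \<lfloor>max 0 (fst p) * real (Suc n)\<rfloor> (snd p)) \<longlonglongrightarrow> (case p of (t, x) \<Rightarrow> P (max 0 t) f x)"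
      by (simp only: p G_def u_def[symmetric] prod.case fst_conv snd_conv)
  qed
qed

lemma P_measurable_time:
  assumes f: "f \<in> bcontfun"
  shows "(\<lambda>t. P (max 0 t) f x) \<in> borel_measurable borel"
  using measurable_compose[OF _ P_measurable[OF f], of "\<lambda>t. (t, x)" borel] by simp

text \<open>\<open>max 0 t\<close> gives the integrand a meaning at negative times, where the kernel
  vanishes anyway.\<close>

definition resolvent :: "real \<Rightarrow> ('a \<Rightarrow> real) \<Rightarrow> 'a \<Rightarrow> real" where
  "resolvent l f x = (LINT t|lborel. exp_weight l t * P (max 0 t) f x)"

lemma resolvent_eq_LBINT: "(LBINT t:{0..}. exp (- l * t) * P t f x) = resolvent l f x"
  unfolding resolvent_def set_lebesgue_integral_def
  by (intro Bochner_Integration.integral_cong) (auto simp: exp_weight_def indicator_def)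

lemma exp_weight_P_integrable:
  assumes l: "l > 0" and f: "f \<in> bcontfun"
  shows "integrable lborel (\<lambda>t. exp_weight l t * P (max 0 t) f x)"
proof -
  note [measurable] = P_measurable_time[OF f]
  obtain B where B: "\<And>x. \<bar>f x\<bar> \<le> B" using bcontfunD(2)[OF f] by auto
  have "integrable lborel (\<lambda>t. exp_weight l t * B)" using exp_weight_integral(1)[OF l] by simp
  then show ?thesis
    by (rule Bochner_Integration.integrable_bound)
      (auto simp: abs_mult exp_weight_nonneg intro!: mult_left_mono order_trans[OF P_bound[OF _ f B] abs_ge_self])
qed

lemma resolvent_bcontfun:
  assumes l: "l > 0" and f: "f \<in> bcontfun"
  shows "resolvent l f \<in> bcontfun"
    and "(\<And>x. \<bar>f x\<bar> \<le> B) \<Longrightarrow> \<bar>resolvent l f x\<bar> \<le> B / l"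
proof -
  note [measurable] = P_measurable_time[OF f]
  have bd: "\<bar>resolvent l f x\<bar> \<le> B / l" if B: "\<And>x. \<bar>f x\<bar> \<le> B" for B x
  proof -
    have "norm (resolvent l f x) \<le> (LINT t|lborel. exp_weight l t * B)"
      unfolding resolvent_def using exp_weight_integral(1)[OF l]
      by (intro integral_norm_le exp_weight_P_integrable[OF l f])
        (auto simp: abs_mult exp_weight_nonneg intro!: mult_left_mono P_bound[OF _ f B])
    then show ?thesis by (simp add: exp_weight_integral(2)[OF l])
  qed
  then show "(\<And>x. \<bar>f x\<bar> \<le> B) \<Longrightarrow> \<bar>resolvent l f x\<bar> \<le> B / l" .
  obtain B where B: "\<And>x. \<bar>f x\<bar> \<le> B" using bcontfunD(2)[OF f] by auto
  show "resolvent l f \<in> bcontfun"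
  proof (rule bcontfun_normI)
    show "continuous_on UNIV (resolvent l f)"
      unfolding resolvent_def[abs_def]
    proof (rule continuous_on_integral[where w="\<lambda>t. exp_weight l t * B"])
      show "continuous_on UNIV (\<lambda>x. exp_weight l t * P (max 0 t) f x)" for t
        by (intro continuous_on_mult continuous_on_const bcontfunD(1)[OF P_bcontfun] f) simp
      show "norm (exp_weight l t * P (max 0 t) f x) \<le> exp_weight l t * B" for t x
        by (auto simp: abs_mult exp_weight_nonneg intro!: mult_left_mono P_bound[OF _ f B])
    qed (use exp_weight_integral(1)[OF l] in auto)
    show "norm (resolvent l f x) \<le> B / l" for x using bd[OF B] by simp
  qed
qed

lemma P_resolvent:
  assumes l: "l > 0" and f: "f \<in> bcontfun" and t: "t \<ge> 0"
  shows "P t (resolvent l f) x = (LINT s|lborel. exp_weight l s * P (t + max 0 s) f x)"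
proof -
  note [measurable_cong] = \<mu>_sets[OF t]
  have [measurable]: "(\<lambda>p. P (max 0 (snd p)) f (T t x + fst p)) \<in> borel_measurable (\<mu> t \<Otimes>\<^sub>M lborel)"
    using measurable_compose[OF _ P_measurable[OF f], of "\<lambda>p. (snd p, T t x + fst p)" "\<mu> t \<Otimes>\<^sub>M lborel"] by simp
  interpret M: prob_space "\<mu> t" by (rule \<mu>_prob[OF t])
  interpret PP: pair_sigma_finite "\<mu> t" lborel ..
  obtain B where B: "\<And>x. \<bar>f x\<bar> \<le> B" using bcontfunD(2)[OF f] by auto
  have int: "integrable (\<mu> t \<Otimes>\<^sub>M lborel) (\<lambda>p. exp_weight l (snd p) * P (max 0 (snd p)) f (T t x + fst p))"
  proof (rule Bochner_Integration.integrable_bound)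
    show "integrable (\<mu> t \<Otimes>\<^sub>M lborel) (\<lambda>p. B * exp_weight l (snd p))"
      by (rule integrable_product) (auto simp: exp_weight_integral[OF l] M.sigma_finite_measure_axioms lborel.sigma_finite_measure_axioms)
    show "AE p in \<mu> t \<Otimes>\<^sub>M lborel. norm (exp_weight l (snd p) * P (max 0 (snd p)) f (T t x + fst p)) \<le> norm (B * exp_weight l (snd p))"
      by (auto simp: abs_mult exp_weight_nonneg mult.commute[of B] intro!: AE_I2 mult_left_mono order_trans[OF P_bound[OF _ f B] abs_ge_self])
  qed measurable
  have "P t (resolvent l f) x = (\<integral>y. (LINT s|lborel. exp_weight l s * P (max 0 s) f (T t x + y)) \<partial>\<mu> t)"
    using bcontfunD(3)[OF resolvent_bcontfun(1)[OF l f]] by (simp add: P_eq[OF t] resolvent_def)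
  also have "\<dots> = (LINT s|lborel. (\<integral>y. exp_weight l s * P (max 0 s) f (T t x + y) \<partial>\<mu> t))"
    by (rule PP.Fubini_integral[symmetric]) (use int in \<open>simp add: case_prod_unfold\<close>)
  also have "\<dots> = (LINT s|lborel. exp_weight l s * P (t + max 0 s) f x)"
    using bcontfunD(3)[OF P_bcontfun[OF _ f]]
    by (intro Bochner_Integration.integral_cong) (auto simp: P_add[OF t _ f] P_eq[OF t])
  finally show ?thesis .
qed

text \<open>By the semigroup law the iterated resolvent is a double time integral of P at t + s;
  substituting r = t + s and exchanging the integrals leaves the convolution of the two
  kernels.\<close>

lemma resolvent_identity:
  assumes l: "l > 0" and m: "m > 0" and f: "f \<in> bcontfun"
  shows "resolvent m f x - resolvent l f x = (l - m) * resolvent l (resolvent m f) x"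
proof (cases "l = m")
  case False
  note [measurable] = P_measurable_time[OF f]
  define p where "p r = P (max 0 r) f x" for r
  have [measurable]: "p \<in> borel_measurable borel" unfolding p_def by measurable
  obtain B where "\<And>x. \<bar>f x\<bar> \<le> B" using bcontfunD(2)[OF f] by auto
  then have B: "\<bar>p r\<bar> \<le> B" for r unfolding p_def by (intro P_bound f) auto
  have "resolvent l (resolvent m f) x = (LINT t|lborel. exp_weight l t * (LINT s|lborel. exp_weight m s * p (t + s)))"
    unfolding resolvent_def[of l]
    by (intro Bochner_Integration.integral_cong refl)
      (auto simp: exp_weight_def indicator_def P_resolvent[OF m f] p_def intro!: Bochner_Integration.integral_cong)
  also have "\<dots> = (LINT t|lborel. exp_weight l t * (LINT r|lborel. exp_weight m (r - t) * p r))"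
  proof -
    have "(LINT s|lborel. exp_weight m s * p (t + s)) = (LINT r|lborel. exp_weight m (r - t) * p r)" for t
      using lborel_integral_real_affine[of 1 "\<lambda>r. exp_weight m (r - t) * p r" t] by simp
    then show ?thesis by simp
  qed
  also have "\<dots> = (LINT t|lborel. (LINT r|lborel. exp_weight l t * (exp_weight m (r - t) * p r)))"
    by simp
  also have "\<dots> = (LINT r|lborel. (LINT t|lborel. exp_weight l t * (exp_weight m (r - t) * p r)))"
  proof (rule lborel_pair.Fubini_integral[symmetric])
    \<comment> \<open>Half of the smaller rate: for 0 \<le> t \<le> r one has l t + m (r - t) \<ge>
      2 k r \<ge> k t + k r, so a product of two integrable kernels dominates.\<close>
    define k where "k = min l m / 2"
    have k: "k > 0" "2 * k \<le> l" "2 * k \<le> m" using l m by (auto simp: k_def)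
    have "integrable (lborel \<Otimes>\<^sub>M lborel) (\<lambda>q. (B * exp_weight k (fst q)) * exp_weight k (snd q))"
      by (rule integrable_product) (auto simp: exp_weight_integral[OF k(1)] lborel.sigma_finite_measure_axioms)
    then show "integrable (lborel \<Otimes>\<^sub>M lborel) (\<lambda>(t, r). exp_weight l t * (exp_weight m (r - t) * p r))"
    proof (rule Bochner_Integration.integrable_bound)
      have *: "norm (exp_weight l t * (exp_weight m (r - t) * p r)) \<le> (B * exp_weight k t) * exp_weight k r" for t r
      proof (cases "0 \<le> t \<and> t \<le> r")
        case True
        have "2 * k * t \<le> l * t" "2 * k * (r - t) \<le> m * (r - t)" "k * t \<le> k * r"
          using True k by (intro mult_right_mono mult_left_mono; simp)+
        then have "- l * t + - m * (r - t) \<le> - k * t + - k * r" by (simp add: algebra_simps)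
        then have "exp (- l * t) * exp (- m * (r - t)) \<le> exp (- k * t) * exp (- k * r)"
          unfolding exp_add[symmetric] by simp
        then have "exp (- l * t) * exp (- m * (r - t)) * \<bar>p r\<bar> \<le> exp (- k * t) * exp (- k * r) * B"
          by (rule mult_mono[OF _ B]) auto
        then show ?thesis using True by (simp add: exp_weight_def abs_mult mult_ac)
      next
        case False
        then have "exp_weight l t * exp_weight m (r - t) = 0" by (auto simp: exp_weight_def indicator_def)
        moreover have "0 \<le> B" using order_trans[OF abs_ge_zero B] .
        ultimately show ?thesis by (auto simp: exp_weight_nonneg)
      qed
      show "AE q in lborel \<Otimes>\<^sub>M lborel. norm (case q of (t, r) \<Rightarrow> exp_weight l t * (exp_weight m (r - t) * p r)) \<le> norm ((B * exp_weight k (fst q)) * exp_weight k (snd q))"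
        using * by (auto intro!: AE_I2 order_trans[OF _ abs_ge_self])
    qed measurable
  qed
  also have "\<dots> = (LINT r|lborel. (exp_weight m r - exp_weight l r) / (l - m) * p r)"
    by (simp add: mult.assoc[symmetric] exp_weight_convolution[OF False])
  also have "\<dots> = (LINT r|lborel. (exp_weight m r * p r - exp_weight l r * p r) / (l - m))"
    by (simp add: left_diff_distrib)
  also have "\<dots> = (resolvent m f x - resolvent l f x) / (l - m)"
    using exp_weight_P_integrable[OF l f, of x] exp_weight_P_integrable[OF m f, of x]
    by (simp add: resolvent_def p_def)
  finally show ?thesis using False by simp
qed simp

text \<open>Rescaling time turns n R(n) f into the mean of P (t/n) f under the fixed kernel exp
  (-t), and continuity at time 0 applies under the integral. It serves to prove injectivity of the
  resolvent.\<close>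

lemma resolvent_tendsto:
  assumes f: "f \<in> bcontfun"
  shows "(\<lambda>n. real (Suc n) * resolvent (Suc n) f x) \<longlonglongrightarrow> f x"
proof -
  note [measurable] = P_measurable_time[OF f]
  obtain B where B: "\<And>x. \<bar>f x\<bar> \<le> B" using bcontfunD(2)[OF f] by auto
  have eq: "real (Suc n) * resolvent (Suc n) f x = (LINT t|lborel. exp_weight 1 t * P (max 0 (t / Suc n)) f x)" for n
  proof -
    have "resolvent (Suc n) f x = (1 / Suc n) * (LINT t|lborel. exp_weight (Suc n) (t / Suc n) * P (max 0 (t / Suc n)) f x)"
      unfolding resolvent_def
      using lborel_integral_real_affine[of "1 / Suc n" "\<lambda>t. exp_weight (Suc n) t * P (max 0 t) f x" 0] by simp
    moreover have "exp_weight (Suc n) (t / Suc n) = exp_weight 1 t" for t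
      by (auto simp: exp_weight_def indicator_def zero_le_divide_iff field_simps)
    ultimately show ?thesis by simp
  qed
  have "(\<lambda>n. LINT t|lborel. exp_weight 1 t * P (max 0 (t / Suc n)) f x) \<longlonglongrightarrow> (LINT t|lborel. exp_weight 1 t * f x)"
  proof (rule integral_dominated_convergence[where w="\<lambda>t. exp_weight 1 t * B"])
    show "AE t in lborel. (\<lambda>n. exp_weight 1 t * P (max 0 (t / Suc n)) f x) \<longlonglongrightarrow> exp_weight 1 t * f x"
    proof (rule AE_I2)
      fix t :: real
      have "(\<lambda>n. P (max 0 (t / Suc n)) f x) \<longlonglongrightarrow> f x"
      proof (cases "t > 0")
        case True
        have "(\<lambda>n. t / Suc n) \<longlonglongrightarrow> 0"
          using tendsto_mult_right[OF LIMSEQ_inverse_real_of_nat, of t] by (simp add: divide_inverse mult.commute)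
        then have "filterlim (\<lambda>n. t / Suc n) (at_right 0) sequentially"
          using True by (auto simp: filterlim_at intro!: always_eventually)
        from filterlim_compose[OF P_tendsto_0[OF f, of x] this]
        show ?thesis using True by (simp add: max_def)
      next
        case False
        then have "max 0 (t / Suc n) = 0" for n by (simp add: max_def divide_le_0_iff zero_le_divide_iff)
        then show ?thesis by (simp add: P_0)
      qed
      then show "(\<lambda>n. exp_weight 1 t * P (max 0 (t / Suc n)) f x) \<longlonglongrightarrow> exp_weight 1 t * f x"
        by (intro tendsto_intros)
    qed
    show "(\<lambda>t. exp_weight 1 t * P (max 0 (t / Suc n)) f x) \<in> borel_measurable lborel" for n
      using measurable_compose[OF _ P_measurable_time[OF f], of "\<lambda>t. t / Suc n" lborel] by simp
    show "AE t in lborel. norm (exp_weight 1 t * P (max 0 (t / Suc n)) f x) \<le> exp_weight 1 t * B" for n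
      by (auto simp: abs_mult exp_weight_nonneg intro!: AE_I2 mult_left_mono P_bound[OF _ f B])
  qed (use exp_weight_integral[of 1] in auto)
  then show ?thesis unfolding eq using exp_weight_integral(2)[of 1] by simp
qed

section \<open>The generator and its resolvents\<close>

definition resolvent_op :: "real \<Rightarrow> ('a \<Rightarrow>\<^sub>C real) \<Rightarrow> ('a \<Rightarrow>\<^sub>C real)" where
  "resolvent_op l f = Bcontfun (resolvent l (apply_bcontfun f))"

lemma resolvent_op_apply: "l > 0 \<Longrightarrow> apply_bcontfun (resolvent_op l f) = resolvent l (apply_bcontfun f)"
  unfolding resolvent_op_def by (intro Bcontfun_inverse resolvent_bcontfun(1) apply_bcontfun)

lemma resolvent_op_linear:
  assumes l: "l > 0"
  shows "bounded_linear (resolvent_op l)"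
proof (rule bounded_linear_intro)
  note int = exp_weight_P_integrable[OF l apply_bcontfun]
  have P_lin: "P t (\<lambda>x. apply_bcontfun f x + apply_bcontfun g x) x = P t (apply_bcontfun f) x + P t (apply_bcontfun g) x"
    "P t (\<lambda>x. r * apply_bcontfun f x) x = r * P t (apply_bcontfun f) x" if "t \<ge> 0" for t f g x r
    using P_integrable[OF that apply_bcontfun[of f], of x] P_integrable[OF that apply_bcontfun[of g], of x]
      bcontfunD(3)[OF apply_bcontfun[of f]] bcontfunD(3)[OF apply_bcontfun[of g]]
    by (simp_all add: P_eq[OF that])
  show "resolvent_op l (f + g) = resolvent_op l f + resolvent_op l g" for f g
  proof (rule bcontfun_eqI)
    show "apply_bcontfun (resolvent_op l (f + g)) x = apply_bcontfun (resolvent_op l f + resolvent_op l g) x" for x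
      using int by (simp add: resolvent_op_apply[OF l] resolvent_def plus_bcontfun.rep_eq P_lin distrib_left)
  qed
  show "resolvent_op l (r *\<^sub>R f) = r *\<^sub>R resolvent_op l f" for r f
  proof (rule bcontfun_eqI)
    show "apply_bcontfun (resolvent_op l (r *\<^sub>R f)) x = apply_bcontfun (r *\<^sub>R resolvent_op l f) x" for x
      by (simp add: resolvent_op_apply[OF l] resolvent_def scaleR_bcontfun.rep_eq P_lin mult.left_commute)
  qed
  show "norm (resolvent_op l f) \<le> norm f * (1 / l)" for f
  proof (rule norm_bound)
    show "norm (apply_bcontfun (resolvent_op l f) x) \<le> norm f * (1 / l)" for x
      using resolvent_bcontfun(2)[OF l apply_bcontfun[of f], of "norm f" x] norm_bounded[of f]
      by (simp add: resolvent_op_apply[OF l])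
  qed
qed

lemma resolvent_op_identity:
  assumes l: "l > 0" and m: "m > 0"
  shows "resolvent_op m f - resolvent_op l f = (l - m) *\<^sub>R resolvent_op l (resolvent_op m f)"
  using resolvent_identity[OF l m apply_bcontfun[of f]]
  by (intro bcontfun_eqI) (simp add: minus_bcontfun.rep_eq scaleR_bcontfun.rep_eq resolvent_op_apply l m)

text \<open>If one resolvent kills \<open>f\<close>, the resolvent identity makes all of them kill
  \<open>f\<close>, and \<open>resolvent_tendsto\<close> recovers f = 0. This is what makes the
  graph of the generator single-valued.\<close>

lemma resolvent_op_inj:
  assumes f: "resolvent_op 1 f = 0"
  shows "f = 0"
proof (rule bcontfun_eqI)
  fix x
  have "resolvent_op (Suc n) f = 0" for n
    using resolvent_op_identity[of "Suc n" 1 f] f linear_0[OF bounded_linear.linear[OF resolvent_op_linear[of "Suc n"]]] by simp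
  then have "resolvent (Suc n) (apply_bcontfun f) x = 0" for n
    using resolvent_op_apply[of "Suc n" f] by (simp add: zero_bcontfun.rep_eq fun_eq_iff)
  then show "apply_bcontfun f x = apply_bcontfun 0 x"
    using LIMSEQ_unique[OF resolvent_tendsto[OF apply_bcontfun[of f], of x]] by (simp add: zero_bcontfun.rep_eq)
qed

text \<open>The graph of the generator, \<open>{(R f, R f - f)}\<close> for the resolvent \<open>R\<close> at \<open>1\<close>.\<close>

definition generator_graph :: "(('a \<Rightarrow>\<^sub>C real) \<times> ('a \<Rightarrow>\<^sub>C real)) set" where
  "generator_graph = {p. resolvent_op 1 (fst p - snd p) = fst p}"

lemma generator_graph_closed: "closed_operator generator_graph"
proof -
  interpret R: bounded_linear "resolvent_op 1" by (rule resolvent_op_linear) simp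
  have "subspace generator_graph"
    unfolding subspace_def generator_graph_def
    by (auto simp: R.zero R.add R.diff R.scaleR algebra_simps)
  moreover have "single_valued generator_graph"
  proof (rule single_valuedI)
    fix u g g' assume "(u, g) \<in> generator_graph" "(u, g') \<in> generator_graph"
    then have "resolvent_op 1 u - resolvent_op 1 g = resolvent_op 1 u - resolvent_op 1 g'"
      by (simp add: generator_graph_def R.diff)
    then have "resolvent_op 1 (g - g') = 0" by (simp add: R.diff)
    then show "g = g'" using resolvent_op_inj by force
  qed
  moreover have "closed generator_graph"
    unfolding generator_graph_def
    by (intro closed_Collect_eq continuous_intros R.continuous_on)
  ultimately show ?thesis by (simp add: closed_operator_def)
qed

lemma generator_graph_resolvent:
  assumes l: "l > 0"
  shows "is_resolvent generator_graph l (resolvent_op l)"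
proof -
  interpret R: bounded_linear "resolvent_op 1" by (rule resolvent_op_linear) simp
  interpret L: bounded_linear "resolvent_op l" by (rule resolvent_op_linear[OF l])
  have "resolvent_op 1 (resolvent_op l f - (l *\<^sub>R resolvent_op l f - f)) = resolvent_op l f" for f
  proof -
    have "resolvent_op l f - resolvent_op 1 f = (1 - l) *\<^sub>R resolvent_op 1 (resolvent_op l f)"
      by (rule resolvent_op_identity) (use l in auto)
    then show ?thesis by (simp add: R.diff R.add R.scaleR algebra_simps)
  qed
  moreover have "resolvent_op l (l *\<^sub>R u - g) = u" if "resolvent_op 1 (u - g) = u" for u g
  proof -
    have "resolvent_op 1 (u - g) - resolvent_op l (u - g) = (l - 1) *\<^sub>R resolvent_op l (resolvent_op 1 (u - g))"
      by (rule resolvent_op_identity) (use l in auto)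
    then have "u - resolvent_op l (u - g) = (l - 1) *\<^sub>R resolvent_op l u" by (simp only: that)
    then show ?thesis by (simp add: L.diff L.scaleR algebra_simps)
  qed
  ultimately show ?thesis
    unfolding is_resolvent_def generator_graph_def using resolvent_op_linear[OF l] by auto
qed

text \<open>Existence holds by the resolvent identity, which carries the inverse from \<lambda> = 1
  to every \<lambda> > 0. Uniqueness holds because the resolvent at 1 alone already determines the
  graph.\<close>

lemma ou_generator_eq: "ou_generator T Q = generator_graph"
  unfolding ou_generator_def resolvent_eq_LBINT
proof (rule the_equality)
  show "closed_operator generator_graph \<and> (\<forall>lam>0. \<exists>R. is_resolvent generator_graph lam R \<and>
      (\<forall>f x. apply_bcontfun (R f) x = resolvent lam (apply_bcontfun f) x))"
    using generator_graph_closed generator_graph_resolvent resolvent_op_apply by metis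
next
  fix L assume L: "closed_operator L \<and> (\<forall>lam>0. \<exists>R. is_resolvent L lam R \<and>
      (\<forall>f x. apply_bcontfun (R f) x = resolvent lam (apply_bcontfun f) x))"
  then obtain R where R: "is_resolvent L 1 R" "\<And>f x. apply_bcontfun (R f) x = resolvent 1 (apply_bcontfun f) x"
    by (meson zero_less_one)
  have "R = resolvent_op 1"
    by (intro ext bcontfun_eqI) (simp add: R(2) resolvent_op_apply)
  then have R1: "(resolvent_op 1 f, 1 *\<^sub>R resolvent_op 1 f - f) \<in> L" "\<And>u g. (u, g) \<in> L \<Longrightarrow> resolvent_op 1 (1 *\<^sub>R u - g) = u" for f
    using R(1) unfolding is_resolvent_def by auto
  show "L = generator_graph"
  proof (intro set_eqI iffI)
    fix p assume "p \<in> L"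
    then show "p \<in> generator_graph" using R1(2)[of "fst p" "snd p"] by (simp add: generator_graph_def)
  next
    fix p assume "p \<in> generator_graph"
    then show "p \<in> L" using R1(1)[of "fst p - snd p"] by (simp add: generator_graph_def)
  qed
qed

text \<open>The resolvent is a two-sided inverse, which contains both existence and uniqueness of
  the solution.\<close>

lemma solves_iff:
  assumes l: "l > 0"
  shows "solves (ou_generator T Q) l f u \<longleftrightarrow> u = resolvent_op l f"
  using generator_graph_resolvent[OF l] unfolding ou_generator_eq solves_def is_resolvent_def
  by (auto intro!: exI[of _ "l *\<^sub>R u - f"])

end

section \<open>Decay of the derivatives of the semigroup\<close>

lemma has_bochner_integral_powr_from_0:
  fixes a c :: real
  assumes a: "a > -1" and c: "c \<ge> 0"
  shows "has_bochner_integral lborel (\<lambda>t. indicator {0..c} t * t powr a) (c powr (a + 1) / (a + 1))"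
proof (rule has_bochner_integral_nn_integral)
  have "((\<lambda>t. indicator {0..c} t * t powr a) has_integral (c powr (a + 1) / (a + 1))) UNIV"
  proof -
    have "(\<lambda>t. indicator {0..c} t * t powr a) = (\<lambda>t. if t \<in> {0..c} then t powr a else 0)"
      by (auto simp: fun_eq_iff indicator_def)
    then show ?thesis using has_integral_powr_from_0[OF a c] by (simp only: has_integral_restrict_UNIV)
  qed
  then show "(\<integral>\<^sup>+ t. ennreal (indicator {0..c} t * t powr a) \<partial>lborel) = ennreal (c powr (a + 1) / (a + 1))"
    by (intro nn_integral_has_integral_lborel) auto
qed (use a in \<open>auto simp: divide_nonneg_pos\<close>)

lemma has_bochner_integral_powr_to_inf:
  fixes a e :: real
  assumes e: "e < -1" and a: "a > 0"
  shows "has_bochner_integral lborel (\<lambda>t. indicator {a..} t * t powr e) (- (a powr (e + 1)) / (e + 1))"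
proof (rule has_bochner_integral_nn_integral)
  have "((\<lambda>t. indicator {a..} t * t powr e) has_integral (- (a powr (e + 1)) / (e + 1))) UNIV"
  proof -
    have "(\<lambda>t. indicator {a..} t * t powr e) = (\<lambda>t. if t \<in> {a..} then t powr e else 0)"
      by (auto simp: fun_eq_iff indicator_def)
    then show ?thesis using has_integral_powr_to_inf[OF e a] by (simp only: has_integral_restrict_UNIV)
  qed
  then show "(\<integral>\<^sup>+ t. ennreal (indicator {a..} t * t powr e) \<partial>lborel) = ennreal (- (a powr (e + 1)) / (e + 1))"
    by (intro nn_integral_has_integral_lborel) auto
  show "0 \<le> - (a powr (e + 1)) / (e + 1)" using e by (intro divide_nonpos_neg) auto
qed auto

text \<open>t^\<gamma> exp (-l t) is largest at t = \<gamma>/l; the factor exp (-\<gamma>) of the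
  maximum is dropped.\<close>

lemma exp_le_powr:
  fixes l \<gamma> t :: real
  assumes l: "l > 0" and g: "\<gamma> > 0" and t: "t > 0"
  shows "exp (- l * t) \<le> (\<gamma> / l) powr \<gamma> * t powr (- \<gamma>)"
proof -
  have "ln (l * t / \<gamma>) \<le> l * t / \<gamma> - 1" using assms by (intro ln_le_minus_one) auto
  then have "\<gamma> * ln (l * t / \<gamma>) \<le> \<gamma> * (l * t / \<gamma> - 1)" using g by (intro mult_left_mono) auto
  also have "\<dots> \<le> l * t" using g by (simp add: field_simps)
  finally have "\<gamma> * ln (l * t / \<gamma>) \<le> l * t" .
  moreover have "ln (l * t / \<gamma>) = ln t - ln (\<gamma> / l)" using assms by (simp add: ln_mult ln_div)
  ultimately have "- l * t \<le> \<gamma> * ln (\<gamma> / l) + (- \<gamma>) * ln t" by (simp add: algebra_simps)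
  then have "exp (- l * t) \<le> exp (\<gamma> * ln (\<gamma> / l)) * exp ((- \<gamma>) * ln t)" by (simp flip: exp_add)
  then show ?thesis using assms by (simp add: powr_def)
qed

lemma has_dir_deriv_shift:
  assumes "has_dir_deriv f h g"
  shows "has_dir_deriv (\<lambda>x. f (x + k)) h (\<lambda>x. g (x + k))"
  unfolding has_dir_deriv_def
proof
  fix x
  have "((\<lambda>s. f ((x + k) + s *\<^sub>R h)) has_real_derivative g (x + k)) (at 0)"
    using assms by (simp add: has_dir_deriv_def)
  then show "((\<lambda>s. f (x + s *\<^sub>R h + k)) has_real_derivative g (x + k)) (at 0)"
    by (simp add: algebra_simps)
qed

lemma has_dir_deriv_second_difference:
  assumes g: "has_dir_deriv g h g1" and g1: "has_dir_deriv g1 h g2" and B: "\<And>x. \<bar>g2 x\<bar> \<le> B"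
  shows "\<bar>g (x + 2 *\<^sub>R h) - 2 * g (x + h) + g x\<bar> \<le> B"
proof -
  have "has_dir_deriv (\<lambda>y. g (y + h) + (- 1) * g y) h (\<lambda>y. g1 (y + h) + (- 1) * g1 y)"
    by (intro has_dir_deriv_sum has_dir_deriv_shift has_dir_deriv_cmult g)
  moreover have "\<bar>g1 (y + h) + (- 1) * g1 y\<bar> \<le> B" for y
    using has_dir_deriv_increment[OF g1 B, of y 1] by simp
  ultimately have "\<bar>(g ((x + 1 *\<^sub>R h) + h) + (- 1) * g (x + 1 *\<^sub>R h)) - (g (x + h) + (- 1) * g x)\<bar> \<le> \<bar>1\<bar> * B"
    by (rule has_dir_deriv_increment)
  then show ?thesis by (simp add: scaleR_2 algebra_simps)
qed

section \<open>Derivative bounds for all positive times\<close>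

context ou_smoothing
begin

text \<open>The singularity at t = 0 in the bound for the derivative of order \<open>k\<close>. It
  is 1 at order 0, where the sup norm suffices, and for t > 1, where the derivatives stay
  bounded.\<close>

definition decay_weight :: "real \<Rightarrow> nat \<Rightarrow> real \<Rightarrow> real" where
  "decay_weight \<beta> k t = (if k = 0 \<or> t > 1 then 1 else t powr (- ((real k - \<beta>) * \<theta>)))"

text \<open>Everything that the regularity argument needs to know about \<open>f\<close>. The
  increment clause is the low-order estimate when no derivative is taken: for \<beta> = 0 it is a
  sup bound, for \<beta> = \<alpha> the Hoelder bound uniformly in time.\<close>

definition decay :: "nat \<Rightarrow> real \<Rightarrow> ('a \<Rightarrow> real) \<Rightarrow> real \<Rightarrow> bool" where
  "decay K \<beta> f N \<longleftrightarrow> (\<forall>x. \<bar>f x\<bar> \<le> N) \<and>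
     (\<forall>t x h. 0 < t \<longrightarrow> h \<noteq> 0 \<longrightarrow> \<bar>P t f (x + h) - P t f x\<bar> \<le> N * norm h powr \<beta>) \<and>
     (\<forall>t hs x. 0 < t \<longrightarrow> 1 \<le> length hs \<longrightarrow> length hs \<le> K \<longrightarrow>
        \<bar>iter_deriv (P t f) hs x\<bar> \<le> N * decay_weight \<beta> (length hs) t * norm_prod hs)"

text \<open>Times beyond 1 are handled by applying the bound at time 1 to P (t - 1) f, which has the
  same sup bound as \<open>f\<close>. The maximum with 1 covers order 0.\<close>

lemma iter_deriv_P_bounded:
  "\<exists>C. \<forall>n::nat. C n \<ge> 0 \<and> (\<forall>f B t hs x. f \<in> bcontfun \<longrightarrow> (\<forall>x. \<bar>f x\<bar> \<le> B) \<longrightarrow> 0 < t \<longrightarrow> length hs = n \<longrightarrow>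
     \<bar>iter_deriv (P t f) hs x\<bar> \<le> C n * B * decay_weight 0 n t * norm_prod hs)"
proof (intro choice allI)
  fix n :: nat
  obtain C where C: "C \<ge> 0" "\<And>f B. f \<in> bcontfun \<Longrightarrow> B \<ge> 0 \<Longrightarrow> deriv_bound 0 0 B f \<Longrightarrow> deriv_bound n (real n * \<theta>) (C * B) f"
    using deriv_bound_add[of 0 n] by auto
  have "\<bar>iter_deriv (P t f) hs x\<bar> \<le> max 1 C * B * decay_weight 0 n t * norm_prod hs"
    if f: "f \<in> bcontfun" and B: "\<And>x. \<bar>f x\<bar> \<le> B" and t: "0 < t" and hs: "length hs = n" for f B t hs x
  proof (cases "n = 0")
    case True
    have B0: "B \<ge> 0" using order_trans[OF abs_ge_zero B] .
    have "1 * B \<le> max 1 C * B" by (intro mult_right_mono B0) simp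
    then show ?thesis using True hs P_bound[OF _ f B, of t x] t by (simp add: decay_weight_def)
  next
    case False
    have B0: "B \<ge> 0" using order_trans[OF abs_ge_zero B] .
    have le: "C * B \<le> max 1 C * B" by (intro mult_right_mono B0) simp
    show ?thesis
    proof (cases "t \<le> 1")
      case True
      have "\<bar>iter_deriv (P t f) hs x\<bar> \<le> C * B * t powr (- (real n * \<theta>)) * norm_prod hs"
        using C(2)[OF f B0 deriv_bound_0[OF f B]] True t hs unfolding deriv_bound_def by blast
      also have "\<dots> \<le> max 1 C * B * t powr (- (real n * \<theta>)) * norm_prod hs"
        by (intro mult_right_mono le norm_prod_nonneg) auto
      finally show ?thesis using True False by (simp add: decay_weight_def)
    next
      case t1: False
      have f': "P (t - 1) f \<in> bcontfun" "\<And>x. \<bar>P (t - 1) f x\<bar> \<le> B"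
        using t1 by (auto intro!: P_bcontfun P_bound f B)
      have "\<bar>iter_deriv (P 1 (P (t - 1) f)) hs x\<bar> \<le> C * B * 1 powr (- (real n * \<theta>)) * norm_prod hs"
        using C(2)[OF f'(1) B0 deriv_bound_0[OF f'], unfolded deriv_bound_def, rule_format, of 1 hs x] hs by simp
      also have "\<dots> \<le> max 1 C * B * norm_prod hs"
        by (simp, intro mult_right_mono le norm_prod_nonneg)
      finally show ?thesis using t1 P_split_time[OF _ f, of t] by (simp add: decay_weight_def)
    qed
  qed
  then show "\<exists>C\<ge>0. \<forall>f B t hs x. f \<in> bcontfun \<longrightarrow> (\<forall>x. \<bar>f x\<bar> \<le> B) \<longrightarrow> 0 < t \<longrightarrow> length hs = n \<longrightarrow>
     \<bar>iter_deriv (P t f) hs x\<bar> \<le> C * B * decay_weight 0 n t * norm_prod hs"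
    by (intro exI[of _ "max 1 C"]) auto
qed

lemma decay_weight_nonneg: "0 \<le> decay_weight \<beta> k t"
  by (simp add: decay_weight_def)

lemma decay_bounded:
  "\<exists>C>0. \<forall>f B. f \<in> bcontfun \<longrightarrow> (\<forall>x. \<bar>f x\<bar> \<le> B) \<longrightarrow> decay K 0 f (C * B)"
proof -
  obtain C where C: "\<And>n::nat. C n \<ge> 0" "\<And>n f B t hs x. f \<in> bcontfun \<Longrightarrow> (\<forall>x. \<bar>f x\<bar> \<le> B) \<Longrightarrow> 0 < t \<Longrightarrow> length hs = n \<Longrightarrow>
     \<bar>iter_deriv (P t f) hs x\<bar> \<le> C n * B * decay_weight 0 n t * norm_prod hs"
    using iter_deriv_P_bounded by blast
  \<comment> \<open>The summand 2 pays for the increment clause, where two values of size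
    \<open>B\<close> are subtracted.\<close>
  define D where "D = 2 + sum C {..K}"
  have D: "D \<ge> 2" "D > 0" using C(1) by (auto simp: D_def sum_nonneg intro!: add_pos_nonneg)
  have CD: "C n \<le> D" if "n \<le> K" for n
    using member_le_sum[of n "{..K}" C] that C(1) by (simp add: D_def)
  have "decay K 0 f (D * B)" if f: "f \<in> bcontfun" and B: "\<forall>x. \<bar>f x\<bar> \<le> B" for f B
    unfolding decay_def
  proof (intro conjI allI impI)
    have B0: "B \<ge> 0" using order_trans[OF abs_ge_zero B[rule_format]] .
    have DB: "2 * B \<le> D * B" using D B0 by (intro mult_right_mono) auto
    show "\<bar>f x\<bar> \<le> D * B" for x using B[rule_format, of x] DB B0 by linarith
    show "\<bar>P t f (x + h) - P t f x\<bar> \<le> D * B * norm h powr 0" if "0 < t" "h \<noteq> 0" for t x h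
    proof -
      have "\<bar>P t f (x + h)\<bar> \<le> B" "\<bar>P t f x\<bar> \<le> B" using that B by (auto intro!: P_bound f)
      then show ?thesis using DB that by simp
    qed
    show "\<bar>iter_deriv (P t f) hs x\<bar> \<le> D * B * decay_weight 0 (length hs) t * norm_prod hs"
      if "0 < t" "1 \<le> length hs" "length hs \<le> K" for t hs x
    proof -
      have "\<bar>iter_deriv (P t f) hs x\<bar> \<le> C (length hs) * B * decay_weight 0 (length hs) t * norm_prod hs"
        by (rule C(2)[OF f B that(1) refl])
      also have "\<dots> \<le> D * B * decay_weight 0 (length hs) t * norm_prod hs"
        by (intro mult_right_mono CD that B0 decay_weight_nonneg norm_prod_nonneg)
      finally show ?thesis .
    qed
  qed
  then show ?thesis using D by blast
qed

lemma decay_holder: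
  assumes \<alpha>: "0 < \<alpha>" "\<alpha> < 1"
  shows "\<exists>C>0. \<forall>f N. f \<in> bcontfun \<longrightarrow> (\<forall>x. \<bar>f x\<bar> \<le> N) \<longrightarrow>
    (\<forall>x h. h \<noteq> 0 \<longrightarrow> \<bar>f (x + h) - f x\<bar> \<le> N * norm h powr \<alpha>) \<longrightarrow> decay K \<alpha> f (C * N)"
proof -
  obtain C where C: "\<And>n::nat. C n \<ge> 0" "\<And>n f B t hs x. f \<in> bcontfun \<Longrightarrow> (\<forall>x. \<bar>f x\<bar> \<le> B) \<Longrightarrow> 0 < t \<Longrightarrow> length hs = n \<Longrightarrow>
     \<bar>iter_deriv (P t f) hs x\<bar> \<le> C n * B * decay_weight 0 n t * norm_prod hs"
    using iter_deriv_P_bounded by blast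
  have "\<forall>n. \<exists>C\<ge>0. 1 \<le> n \<longrightarrow> (\<forall>f N. f \<in> bcontfun \<longrightarrow> N \<ge> 0 \<longrightarrow> (\<forall>x. \<bar>f x\<bar> \<le> N) \<longrightarrow>
    (\<forall>x h. h \<noteq> 0 \<longrightarrow> \<bar>f (x + h) - f x\<bar> \<le> N * norm h powr \<alpha>) \<longrightarrow> deriv_bound n ((n - \<alpha>) * \<theta>) (C * N) f)"
    using deriv_bound_holder[OF _ \<alpha>] by (metis order_refl)
  then obtain E where E: "\<And>n::nat. E n \<ge> 0" "\<And>n f N. 1 \<le> n \<Longrightarrow> f \<in> bcontfun \<Longrightarrow> N \<ge> 0 \<Longrightarrow> (\<forall>x. \<bar>f x\<bar> \<le> N) \<Longrightarrow>
    (\<forall>x h. h \<noteq> 0 \<longrightarrow> \<bar>f (x + h) - f x\<bar> \<le> N * norm h powr \<alpha>) \<Longrightarrow> deriv_bound n ((n - \<alpha>) * \<theta>) (E n * N) f"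
    by metis
  \<comment> \<open>One constant for all clauses: TM^\<alpha> for increments at t \<le> 1,
    \<open>C 1\<close> for short and 2 for long increments at t > 1, and the sums of
    \<open>E\<close> and \<open>C\<close> for derivatives before and after time 1.
    \<open>C 1\<close> stands apart because \<open>K\<close> may be 0.\<close>
  define D where "D = 2 + TM powr \<alpha> + C 1 + sum C {..K} + sum E {..K}"
  have nn: "0 \<le> sum C {..K}" "0 \<le> sum E {..K}" "0 \<le> C 1" "0 \<le> TM powr \<alpha>" using C(1) E(1) by (auto simp: sum_nonneg)
  have D: "D \<ge> 2" "D > 0" "D \<ge> TM powr \<alpha>" "D \<ge> C 1" using nn unfolding D_def by linarith+
  have CD: "C n \<le> D" "E n \<le> D" if "n \<le> K" for n
  proof -
    have "C n \<le> sum C {..K}" "E n \<le> sum E {..K}"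
      using that C(1) E(1) by (auto intro!: member_le_sum)
    then show "C n \<le> D" "E n \<le> D" using nn unfolding D_def by linarith+
  qed
  have "decay K \<alpha> f (D * N)" if f: "f \<in> bcontfun" and B: "\<forall>x. \<bar>f x\<bar> \<le> N"
    and hol: "\<forall>x h. h \<noteq> 0 \<longrightarrow> \<bar>f (x + h) - f x\<bar> \<le> N * norm h powr \<alpha>" for f N
    unfolding decay_def
  proof (intro conjI allI impI)
    have N0: "N \<ge> 0" using order_trans[OF abs_ge_zero B[rule_format]] .
    have DB: "2 * N \<le> D * N" "TM powr \<alpha> * N \<le> D * N" "C 1 * N \<le> D * N" using D N0 by (auto intro!: mult_right_mono)
    show "\<bar>f x\<bar> \<le> D * N" for x using B[rule_format, of x] DB N0 by linarith
    show "\<bar>P t f (x + h) - P t f x\<bar> \<le> D * N * norm h powr \<alpha>" if t: "0 < t" and h: "h \<noteq> 0" for t x h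
    proof (cases "t \<le> 1")
      case True
      have "\<bar>P t f (x + h) - P t f x\<bar> \<le> N * (TM * norm h) powr \<alpha>"
        using t True \<alpha> N0 hol h by (intro P_increment f) auto
      also have "\<dots> = (TM powr \<alpha> * N) * norm h powr \<alpha>" using TM(1) by (simp add: powr_mult)
      also have "\<dots> \<le> D * N * norm h powr \<alpha>" by (intro mult_right_mono DB) auto
      finally show ?thesis .
    next
      \<comment> \<open>\<open>TM\<close> controls T only up to time 1. Later, short increments are
        bounded through the first derivative, using norm h \<le> (norm h)^\<alpha>, and long ones by
        twice the sup bound.\<close>
      case t1: False
      show ?thesis
      proof (cases "norm h \<le> 1")
        case True
        have "has_dir_deriv (P t f) h (iter_deriv (P t f) [h])"
          using smooth_toD(2)[OF smooth_to_P[OF t f, of 1], of "[]" h] by simp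
        moreover have "\<bar>iter_deriv (P t f) [h] y\<bar> \<le> C 1 * N * norm h" for y
          using C(2)[OF f B t, of "[h]" 1 y] t1 by (simp add: decay_weight_def del: iter_deriv.simps)
        ultimately have "\<bar>P t f (x + 1 *\<^sub>R h) - P t f x\<bar> \<le> \<bar>1\<bar> * (C 1 * N * norm h)"
          by (rule has_dir_deriv_increment)
        also have "\<dots> \<le> D * N * norm h powr \<alpha>"
        proof -
          have "norm h powr 1 \<le> norm h powr \<alpha>" using True h \<alpha> by (intro powr_mono') auto
          then show ?thesis using DB h N0 D by (simp, intro mult_mono) auto
        qed
        finally show ?thesis by simp
      next
        case False
        have "\<bar>P t f (x + h)\<bar> \<le> N" "\<bar>P t f x\<bar> \<le> N" using t B by (auto intro!: P_bound f)
        then have "\<bar>P t f (x + h) - P t f x\<bar> \<le> D * N * 1" using DB by simp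
        also have "\<dots> \<le> D * N * norm h powr \<alpha>"
          using False D N0 \<alpha> by (intro mult_left_mono ge_one_powr_ge_zero) auto
        finally show ?thesis .
      qed
    qed
    show "\<bar>iter_deriv (P t f) hs x\<bar> \<le> D * N * decay_weight \<alpha> (length hs) t * norm_prod hs"
      if t: "0 < t" and hs: "1 \<le> length hs" "length hs \<le> K" for t hs x
    proof (cases "t \<le> 1")
      case True
      have "\<bar>iter_deriv (P t f) hs x\<bar> \<le> E (length hs) * N * t powr (- ((real (length hs) - \<alpha>) * \<theta>)) * norm_prod hs"
        using E(2)[OF hs(1) f N0 B hol] t True unfolding deriv_bound_def by blast
      also have "\<dots> \<le> D * N * t powr (- ((real (length hs) - \<alpha>) * \<theta>)) * norm_prod hs"
        by (intro mult_right_mono CD hs N0 norm_prod_nonneg) auto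
      finally show ?thesis using True hs by (auto simp: decay_weight_def)
    next
      case False
      have "\<bar>iter_deriv (P t f) hs x\<bar> \<le> C (length hs) * N * decay_weight 0 (length hs) t * norm_prod hs"
        by (rule C(2)[OF f B t refl])
      also have "\<dots> \<le> D * N * decay_weight 0 (length hs) t * norm_prod hs"
        by (intro mult_right_mono CD hs N0 decay_weight_nonneg norm_prod_nonneg)
      finally show ?thesis using False by (simp add: decay_weight_def)
    qed
  qed
  then show ?thesis using D(2) by blast
qed

end

section \<open>Regularity of the resolvent\<close>

lemma form_norm_le:
  assumes "\<And>hs. length hs = k \<Longrightarrow> \<bar>F hs\<bar> \<le> c * norm_prod hs" and c: "c \<ge> 0"
  shows "form_norm k F \<le> ennreal c"
  unfolding form_norm_def
proof (rule SUP_least)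
  fix hs :: "'a list" assume hs: "hs \<in> {hs. length hs = k \<and> (\<forall>h\<in>set hs. norm h \<le> 1)}"
  have "norm_prod hs \<le> 1" if "\<forall>h\<in>set hs. norm h \<le> 1" for hs :: "'a list"
    using that by (induction hs) (auto intro!: mult_le_one norm_prod_nonneg)
  then have "c * norm_prod hs \<le> c * 1" using c hs by (intro mult_left_mono) auto
  then show "ennreal \<bar>F hs\<bar> \<le> ennreal c" using assms(1)[of hs] hs by (intro ennreal_leI) auto
qed

context ou_smoothing
begin

text \<open>Chosen such that kernel times weight is at most this constant times t^(-\<gamma>) for
  all t > 0: the 1 serves t \<le> 1, the other entry lets the exponential supply the decay for t >
  1.\<close>

definition weight_const :: "real \<Rightarrow> real \<Rightarrow> real" where
  "weight_const l \<gamma> = max 1 ((\<gamma> / l) powr \<gamma>)"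

lemma decay_weight_measurable[measurable]: "decay_weight \<beta> k \<in> borel_measurable borel"
  unfolding decay_weight_def by measurable

lemma weight_le:
  assumes l: "l > 0" and k: "k \<ge> 1" and \<beta>: "\<beta> < 1" and t: "t > 0"
  shows "exp_weight l t * decay_weight \<beta> k t \<le> weight_const l ((real k - \<beta>) * \<theta>) * t powr (- ((real k - \<beta>) * \<theta>))"
proof -
  let ?\<gamma> = "(real k - \<beta>) * \<theta>"
  have g: "?\<gamma> > 0" using k \<beta> \<theta> by simp
  show ?thesis
  proof (cases "t \<le> 1")
    case True
    have "exp_weight l t * t powr (- ?\<gamma>) \<le> weight_const l ?\<gamma> * t powr (- ?\<gamma>)"
      using l t by (intro mult_right_mono) (auto simp: exp_weight_def weight_const_def le_max_iff_disj)
    then show ?thesis using True k by (simp add: decay_weight_def)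
  next
    case False
    have "exp (- l * t) \<le> (?\<gamma> / l) powr ?\<gamma> * t powr (- ?\<gamma>)" by (rule exp_le_powr[OF l g t])
    also have "\<dots> \<le> weight_const l ?\<gamma> * t powr (- ?\<gamma>)"
      by (intro mult_right_mono) (auto simp: weight_const_def)
    finally show ?thesis using False t by (simp add: decay_weight_def exp_weight_def)
  qed
qed

lemma weight_integrable:
  assumes l: "l > 0" and k: "(real k - \<beta>) * \<theta> < 1"
  shows "integrable lborel (\<lambda>t. exp_weight l t * decay_weight \<beta> k t)"
proof (cases "k = 0")
  case True
  then show ?thesis using exp_weight_integral(1)[OF l] by (simp add: decay_weight_def)
next
  case False
  let ?a = "- ((real k - \<beta>) * \<theta>)"
  have "integrable lborel (\<lambda>t. indicator {0..1} t * t powr ?a + exp_weight l t)"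
    using has_bochner_integral_powr_from_0[of ?a 1] k exp_weight_integral(1)[OF l]
    by (intro Bochner_Integration.integrable_add) (auto simp: has_bochner_integral_iff)
  then show ?thesis
  proof (rule Bochner_Integration.integrable_bound)
    have "exp_weight l t * decay_weight \<beta> k t \<le> indicator {0..1} t * t powr ?a + exp_weight l t" for t
    proof (cases "0 \<le> t \<and> t \<le> 1")
      case True
      then have "exp_weight l t \<le> 1" using l by (simp add: exp_weight_def)
      then have "exp_weight l t * t powr ?a \<le> 1 * t powr ?a" by (intro mult_right_mono) auto
      then show ?thesis using True False exp_weight_nonneg[of l t] by (simp add: decay_weight_def)
    qed (auto simp: exp_weight_def decay_weight_def)
    then show "AE t in lborel. norm (exp_weight l t * decay_weight \<beta> k t) \<le> norm (indicator {0..1} t * t powr ?a + exp_weight l t)"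
      by (auto simp: exp_weight_nonneg decay_weight_nonneg intro!: AE_I2)
  qed measurable
qed

definition weight_total :: "real \<Rightarrow> real \<Rightarrow> nat \<Rightarrow> real" where
  "weight_total l \<beta> k = (LINT t|lborel. exp_weight l t * decay_weight \<beta> k t)"

lemma weight_total_nonneg: "0 \<le> weight_total l \<beta> k"
  unfolding weight_total_def by (intro Bochner_Integration.integral_nonneg) (auto simp: exp_weight_nonneg decay_weight_nonneg)

text \<open>The two summands are the constants of the integrals of t^(-\<gamma>) over (0,\<tau>) and
  over (\<tau>,\<infinity>), with \<gamma> = (n - \<beta>) \<theta> < 1 and \<gamma> = (n + j -
  \<beta>) \<theta> > 1. At order 0 the first integrand is constant in time.\<close>

definition split_const :: "real \<Rightarrow> real \<Rightarrow> nat \<Rightarrow> nat \<Rightarrow> real" where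
  "split_const l \<beta> n j =
     (if n = 0 then 1 else weight_const l ((real n - \<beta>) * \<theta>) / (1 - (real n - \<beta>) * \<theta>)) +
     weight_const l ((real (n + j) - \<beta>) * \<theta>) / ((real (n + j) - \<beta>) * \<theta> - 1)"

text \<open>
  The time integral is cut at \<open>\<tau> = \<parallel>h\<parallel>\<^sup>1\<^sup>/\<^sup>\<theta>\<close>, where the low-order and the high-order bound balance.
\<close>

lemma split_bound:
  assumes l: "l > 0" and \<beta>: "\<beta> < 1" and lo: "(real n - \<beta>) * \<theta> < 1" and hi: "(real (n + j) - \<beta>) * \<theta> > 1"
    and j: "j \<ge> 1" and r: "r > 0" and V: "V \<ge> 0"
    and int: "integrable lborel (\<lambda>t. exp_weight l t * \<phi> t)"
    and \<phi>0: "\<And>t. t \<le> 0 \<Longrightarrow> \<phi> t = 0"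
    and \<phi>1: "\<And>t. t > 0 \<Longrightarrow> \<bar>\<phi> t\<bar> \<le> V * (if n = 0 then r powr \<beta> else decay_weight \<beta> n t)"
    and \<phi>2: "\<And>t. t > 0 \<Longrightarrow> \<bar>\<phi> t\<bar> \<le> V * (r ^ j * decay_weight \<beta> (n + j) t)"
  shows "\<bar>LINT t|lborel. exp_weight l t * \<phi> t\<bar> \<le> V * (split_const l \<beta> n j * r powr (\<beta> + 1 / \<theta> - real n))"
proof -
  define \<gamma>1 where "\<gamma>1 = (real n - \<beta>) * \<theta>"
  define \<gamma>2 where "\<gamma>2 = (real (n + j) - \<beta>) * \<theta>"
  define \<tau> where "\<tau> = r powr (1 / \<theta>)"
  \<comment> \<open>At n = 0 the short-time bound is r^\<beta> with exponent 0 in \<open>t\<close>;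
    otherwise it is the weight of order \<open>n\<close>, which does not depend on
    \<open>r\<close>.\<close>
  define A where "A = (if n = 0 then r powr \<beta> else weight_const l \<gamma>1)"
  define a where "a = (if n = 0 then 0 else - \<gamma>1)"
  define E where "E = weight_const l \<gamma>2 * r ^ j"
  have \<tau>: "\<tau> > 0" using r by (simp add: \<tau>_def)
  have a: "a > -1" using lo by (simp add: a_def \<gamma>1_def)
  have g2: "- \<gamma>2 < -1" using hi by (simp add: \<gamma>2_def)
  have A0: "A \<ge> 0" "E \<ge> 0" using r by (auto simp: A_def E_def weight_const_def)
  have hb1: "has_bochner_integral lborel (\<lambda>t. A * (indicator {0..\<tau>} t * t powr a)) (A * (\<tau> powr (a + 1) / (a + 1)))"
    using \<tau> by (intro has_bochner_integral_mult_right has_bochner_integral_powr_from_0[OF a]) auto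
  have hb2: "has_bochner_integral lborel (\<lambda>t. E * (indicator {\<tau>..} t * t powr (- \<gamma>2))) (E * (- (\<tau> powr (- \<gamma>2 + 1)) / (- \<gamma>2 + 1)))"
    by (intro has_bochner_integral_mult_right has_bochner_integral_powr_to_inf[OF g2 \<tau>])
  define g where "g t = A * (indicator {0..\<tau>} t * t powr a) + E * (indicator {\<tau>..} t * t powr (- \<gamma>2))" for t
  have hbg: "has_bochner_integral lborel (\<lambda>t. V * g t) (V * (A * (\<tau> powr (a + 1) / (a + 1)) + E * (- (\<tau> powr (- \<gamma>2 + 1)) / (- \<gamma>2 + 1))))"
    unfolding g_def by (intro has_bochner_integral_mult_right has_bochner_integral_add hb1 hb2)
  have le: "norm (exp_weight l t * \<phi> t) \<le> V * g t" for t
  proof -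
    consider "t \<le> 0" | "0 < t" "t \<le> \<tau>" | "\<tau> < t" by linarith
    then show ?thesis
    proof cases
      case 1
      then show ?thesis using \<phi>0[OF 1] V A0 by (simp add: g_def)
    next
      case 2
      have "exp_weight l t * (if n = 0 then r powr \<beta> else decay_weight \<beta> n t) \<le> A * t powr a"
      proof (cases "n = 0")
        case True
        have "exp_weight l t \<le> 1" using 2 l by (simp add: exp_weight_def)
        then have "exp_weight l t * r powr \<beta> \<le> 1 * r powr \<beta>" by (intro mult_right_mono) auto
        then show ?thesis using True 2 by (simp add: A_def a_def)
      next
        case False
        then show ?thesis using weight_le[OF l _ \<beta> 2(1), of n] by (simp add: A_def a_def \<gamma>1_def)
      qed
      then have 1: "V * (exp_weight l t * (if n = 0 then r powr \<beta> else decay_weight \<beta> n t)) \<le> V * (A * t powr a)"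
        by (rule mult_left_mono[OF _ V])
      have "norm (exp_weight l t * \<phi> t) \<le> exp_weight l t * (V * (if n = 0 then r powr \<beta> else decay_weight \<beta> n t))"
        unfolding real_norm_def abs_mult using \<phi>1[OF 2(1)] by (simp only: abs_of_nonneg[OF exp_weight_nonneg] mult_left_mono exp_weight_nonneg)
      also have "\<dots> \<le> V * (A * t powr a)" using 1 by (simp only: mult.left_commute)
      also have "\<dots> \<le> V * g t" using 2 V A0 by (intro mult_left_mono) (auto simp: g_def)
      finally show ?thesis .
    next
      case 3
      then have t: "t > 0" using \<tau> by simp
      have "exp_weight l t * decay_weight \<beta> (n + j) t \<le> weight_const l \<gamma>2 * t powr (- \<gamma>2)"
        using weight_le[OF l _ \<beta> t, of "n + j"] j by (simp add: \<gamma>2_def)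
      then have "r ^ j * (exp_weight l t * decay_weight \<beta> (n + j) t) \<le> r ^ j * (weight_const l \<gamma>2 * t powr (- \<gamma>2))"
        by (rule mult_left_mono) (use r in simp)
      then have 1: "V * (r ^ j * (exp_weight l t * decay_weight \<beta> (n + j) t)) \<le> V * (r ^ j * (weight_const l \<gamma>2 * t powr (- \<gamma>2)))"
        by (rule mult_left_mono[OF _ V])
      have "norm (exp_weight l t * \<phi> t) \<le> exp_weight l t * (V * (r ^ j * decay_weight \<beta> (n + j) t))"
        unfolding real_norm_def abs_mult using \<phi>2[OF t] by (simp only: abs_of_nonneg[OF exp_weight_nonneg] mult_left_mono exp_weight_nonneg)
      also have "\<dots> = V * (r ^ j * (exp_weight l t * decay_weight \<beta> (n + j) t))" by (simp only: mult_ac)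
      also have "\<dots> \<le> V * (r ^ j * (weight_const l \<gamma>2 * t powr (- \<gamma>2)))" by (rule 1)
      also have "\<dots> = V * (E * t powr (- \<gamma>2))" by (simp only: E_def mult_ac)
      also have "\<dots> \<le> V * g t" using 3 V A0 by (intro mult_left_mono) (auto simp: g_def)
      finally show ?thesis .
    qed
  qed
  have "norm (LINT t|lborel. exp_weight l t * \<phi> t) \<le> (LINT t|lborel. V * g t)"
    using hbg by (intro integral_norm_le int le) (auto simp: has_bochner_integral_iff)
  also have "\<dots> = V * (A * (\<tau> powr (a + 1) / (a + 1)) + E * (- (\<tau> powr (- \<gamma>2 + 1)) / (- \<gamma>2 + 1)))"
    using hbg by (simp only: has_bochner_integral_iff)
  also have "A * (\<tau> powr (a + 1) / (a + 1)) = (if n = 0 then 1 else weight_const l \<gamma>1 / (1 - \<gamma>1)) * r powr (\<beta> + 1 / \<theta> - real n)"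
  proof (cases "n = 0")
    case True
    then show ?thesis using r by (simp add: A_def a_def \<tau>_def powr_powr flip: powr_add)
  next
    case False
    have "(1 / \<theta>) * (- \<gamma>1 + 1) = \<beta> + 1 / \<theta> - real n" using \<theta> by (simp add: \<gamma>1_def field_simps)
    then have "\<tau> powr (- \<gamma>1 + 1) = r powr (\<beta> + 1 / \<theta> - real n)" by (simp add: \<tau>_def powr_powr)
    then show ?thesis using False by (simp add: A_def a_def)
  qed
  also have "E * (- (\<tau> powr (- \<gamma>2 + 1)) / (- \<gamma>2 + 1)) = weight_const l \<gamma>2 / (\<gamma>2 - 1) * r powr (\<beta> + 1 / \<theta> - real n)"
  proof -
    have "real j + (1 / \<theta>) * (- \<gamma>2 + 1) = \<beta> + 1 / \<theta> - real n" using \<theta> by (simp add: \<gamma>2_def field_simps)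
    then have p: "r ^ j * \<tau> powr (- \<gamma>2 + 1) = r powr (\<beta> + 1 / \<theta> - real n)"
      using r by (simp add: \<tau>_def powr_powr flip: powr_realpow powr_add)
    have "- (\<tau> powr (- \<gamma>2 + 1)) / (- \<gamma>2 + 1) = \<tau> powr (- \<gamma>2 + 1) / (\<gamma>2 - 1)"
      using g2 by (simp add: divide_simps) (simp add: algebra_simps)
    then have "E * (- (\<tau> powr (- \<gamma>2 + 1)) / (- \<gamma>2 + 1)) = weight_const l \<gamma>2 * (r ^ j * \<tau> powr (- \<gamma>2 + 1)) / (\<gamma>2 - 1)"
      by (simp add: E_def)
    then show ?thesis unfolding p by simp
  qed
  also have "(if n = 0 then 1 else weight_const l \<gamma>1 / (1 - \<gamma>1)) * r powr (\<beta> + 1 / \<theta> - real n) +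
      weight_const l \<gamma>2 / (\<gamma>2 - 1) * r powr (\<beta> + 1 / \<theta> - real n) = split_const l \<beta> n j * r powr (\<beta> + 1 / \<theta> - real n)"
    unfolding split_const_def \<gamma>1_def[symmetric] \<gamma>2_def[symmetric] by (simp only: distrib_right)
  finally show ?thesis by simp
qed

lemma split_const_nonneg:
  assumes "(real n - \<beta>) * \<theta> < 1" "(real (n + j) - \<beta>) * \<theta> > 1"
  shows "split_const l \<beta> n j \<ge> 0"
  using assms by (auto simp: split_const_def weight_const_def intro!: add_nonneg_nonneg divide_nonneg_nonneg)

end

section \<open>Derivatives of the solution up to order n\<close>

text \<open>\<open>n\<close> is an order at which the weight is still integrable in time. Decay is
  required up to n + 2 because first differences of the n-th derivative use order n + 1 and second
  differences order n + 2.\<close>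

locale resolvent_regularity = ou_smoothing T Q \<theta> \<Gamma>
  for T :: "real \<Rightarrow> 'a::{real_inner,banach,second_countable_topology} \<Rightarrow>\<^sub>L 'a" and Q :: "'a \<Rightarrow>\<^sub>L 'a"
    and \<theta> \<Gamma> :: real +
  fixes l \<beta> N :: real and n :: nat and f :: "'a \<Rightarrow>\<^sub>C real"
  assumes l: "l > 0" and \<beta>: "0 \<le> \<beta>" "\<beta> < 1"
    and decay: "decay (n + 2) \<beta> (apply_bcontfun f) N"
    and n: "(real n - \<beta>) * \<theta> < 1"
begin

lemma N_nonneg: "N \<ge> 0"
proof -
  have "\<bar>apply_bcontfun f 0\<bar> \<le> N" using decay unfolding decay_def by blast
  then show ?thesis by linarith
qed

lemma admissible: "k \<le> n \<Longrightarrow> (real k - \<beta>) * \<theta> < 1"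
  using n \<theta> by (intro le_less_trans[OF mult_right_mono n]) auto

text \<open>Extended by 0 to t \<le> 0, since at time 0 the semigroup returns \<open>f\<close>,
  which need not be differentiable.\<close>

definition D :: "'a list \<Rightarrow> 'a \<Rightarrow> real \<Rightarrow> real" where
  "D hs x t = (if t > 0 then iter_deriv (P t (apply_bcontfun f)) hs x else 0)"

definition I :: "'a list \<Rightarrow> 'a \<Rightarrow> real" where
  "I hs x = (LINT t|lborel. exp_weight l t * D hs x t)"

lemma D_dir_deriv: "has_dir_deriv (\<lambda>x. D hs x t) h (\<lambda>x. D (h # hs) x t)"
proof (cases "t > 0")
  case True
  then show ?thesis
    using smooth_toD(2)[OF smooth_to_P[OF True apply_bcontfun[of f], of "Suc (length hs)"], of hs h]
    by (simp add: D_def del: iter_deriv.simps)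
qed (simp add: D_def has_dir_deriv_def)

lemma D_continuous: "continuous_on UNIV (\<lambda>x. D hs x t)"
proof (cases "t > 0")
  case True
  then show ?thesis
    using bcontfunD(1)[OF smooth_toD(1)[OF smooth_to_P[OF True apply_bcontfun[of f], of "length hs"], of hs]]
    by (simp add: D_def)
qed (simp add: D_def)

lemma D_measurable[measurable]: "D hs x \<in> borel_measurable borel"
proof (induction hs arbitrary: x)
  case Nil
  have "(\<lambda>t. indicator {0<..} t * P (max 0 t) (apply_bcontfun f) x) \<in> borel_measurable borel"
    using P_measurable_time[OF apply_bcontfun[of f], of x] by measurable
  also have "(\<lambda>t. indicator {0<..} t * P (max 0 t) (apply_bcontfun f) x) = D [] x"
    by (auto simp: D_def fun_eq_iff)
  finally show ?case .
next
  case (Cons h hs)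
  show ?case
  proof (rule borel_measurable_LIMSEQ_real)
    show "(\<lambda>t. (D hs (x + inverse (Suc i) *\<^sub>R h) t - D hs x t) / inverse (Suc i)) \<in> borel_measurable borel" for i
      using Cons[of "x + inverse (Suc i) *\<^sub>R h"] Cons[of x] by measurable
    fix t
    have "filterlim (\<lambda>i. inverse (real (Suc i))) (at 0) sequentially"
      unfolding filterlim_at by (intro conjI LIMSEQ_inverse_real_of_nat always_eventually allI) auto
    from filterlim_compose[OF has_dir_deriv_tendsto[OF D_dir_deriv, of hs x h t] this]
    show "(\<lambda>i. (D hs (x + inverse (Suc i) *\<^sub>R h) t - D hs x t) / inverse (Suc i)) \<longlonglongrightarrow> D (h # hs) x t" .
  qed
qed

lemma D_bound:
  assumes "length hs \<le> n + 2"
  shows "\<bar>D hs x t\<bar> \<le> N * decay_weight \<beta> (length hs) t * norm_prod hs"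
proof (cases "t > 0")
  case True
  show ?thesis
  proof (cases "length hs = 0")
    case True
    have "\<bar>P t (apply_bcontfun f) x\<bar> \<le> N"
      using \<open>t > 0\<close> decay by (intro P_bound apply_bcontfun) (auto simp: decay_def)
    then show ?thesis using True \<open>t > 0\<close> by (simp add: D_def decay_weight_def)
  next
    case False
    then have "1 \<le> length hs" by linarith
    then show ?thesis using \<open>t > 0\<close> assms decay by (simp add: D_def decay_def)
  qed
next
  case False
  then show ?thesis
    by (simp add: D_def) (intro mult_nonneg_nonneg N_nonneg decay_weight_nonneg norm_prod_nonneg)
qed

lemma weighted_D_bound:
  assumes "length hs \<le> n + 2"
  shows "norm (exp_weight l t * D hs x t) \<le> N * norm_prod hs * (exp_weight l t * decay_weight \<beta> (length hs) t)"
proof -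
  have "exp_weight l t * \<bar>D hs x t\<bar> \<le> exp_weight l t * (N * decay_weight \<beta> (length hs) t * norm_prod hs)"
    by (intro mult_left_mono D_bound assms exp_weight_nonneg)
  then show ?thesis by (simp add: abs_mult exp_weight_nonneg mult_ac)
qed

lemma bound_integrable:
  assumes "length hs \<le> n"
  shows "integrable lborel (\<lambda>t. N * norm_prod hs * (exp_weight l t * decay_weight \<beta> (length hs) t))"
  by (intro integrable_mult_right weight_integrable l admissible assms)

lemma D_integrable:
  assumes "length hs \<le> n"
  shows "integrable lborel (\<lambda>t. exp_weight l t * D hs x t)"
  by (rule Bochner_Integration.integrable_bound[OF bound_integrable[OF assms]])
    (use assms weighted_D_bound[of hs] in \<open>auto intro!: AE_I2 order_trans[OF _ abs_ge_self]\<close>)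

lemma I_bound:
  assumes "length hs \<le> n"
  shows "\<bar>I hs x\<bar> \<le> N * weight_total l \<beta> (length hs) * norm_prod hs"
proof -
  have "norm (I hs x) \<le> (LINT t|lborel. N * norm_prod hs * (exp_weight l t * decay_weight \<beta> (length hs) t))"
    unfolding I_def using assms by (intro integral_norm_le D_integrable bound_integrable weighted_D_bound) auto
  also have "\<dots> = N * norm_prod hs * weight_total l \<beta> (length hs)"
    by (simp only: integral_mult_right_zero weight_total_def)
  finally show ?thesis by (simp add: mult_ac)
qed

lemma I_bcontfun:
  assumes "length hs \<le> n"
  shows "I hs \<in> bcontfun"
proof (rule bcontfun_normI)
  show "continuous_on UNIV (I hs)"
    unfolding I_def[abs_def]
    by (rule continuous_on_integral[OF _ bound_integrable[OF assms]])
      (use assms in \<open>auto intro!: continuous_intros D_continuous weighted_D_bound[unfolded real_norm_def]\<close>)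
  show "norm (I hs x) \<le> N * weight_total l \<beta> (length hs) * norm_prod hs" for x
    using I_bound[OF assms] by simp
qed

lemma D_increment:
  assumes "length hs < n + 2"
  shows "\<bar>D hs (x + h) t - D hs x t\<bar> \<le> N * norm_prod hs * (norm h * decay_weight \<beta> (Suc (length hs)) t)"
proof -
  have "\<bar>D hs (x + 1 *\<^sub>R h) t - D hs x t\<bar> \<le> \<bar>1\<bar> * (N * decay_weight \<beta> (length (h # hs)) t * norm_prod (h # hs))"
    using assms by (intro has_dir_deriv_increment[OF D_dir_deriv D_bound]) simp
  then show ?thesis by (simp add: mult_ac)
qed

text \<open>Bound for the error of a difference quotient, the same for all remaining directions. The
  term with order k + 1 is integrable, the one with order k + 2 tends to 0 with \<open>s\<close> but
  may fail to be integrable at time 0; their minimum has both properties.\<close>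

definition remainder :: "'a \<Rightarrow> nat \<Rightarrow> real \<Rightarrow> real" where
  "remainder h k s = (LINT t|lborel. exp_weight l t *
     min (2 * decay_weight \<beta> (Suc k) t) (\<bar>s\<bar> * norm h * decay_weight \<beta> (Suc (Suc k)) t))"

lemma remainder_integrable:
  assumes "k < n"
  shows "integrable lborel (\<lambda>t. exp_weight l t * min (2 * decay_weight \<beta> (Suc k) t) (\<bar>s\<bar> * norm h * decay_weight \<beta> (Suc (Suc k)) t))"
proof (rule Bochner_Integration.integrable_bound)
  show "integrable lborel (\<lambda>t. 2 * (exp_weight l t * decay_weight \<beta> (Suc k) t))"
    using assms by (intro integrable_mult_right weight_integrable l admissible) auto
  show "AE t in lborel. norm (exp_weight l t * min (2 * decay_weight \<beta> (Suc k) t) (\<bar>s\<bar> * norm h * decay_weight \<beta> (Suc (Suc k)) t))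
      \<le> norm (2 * (exp_weight l t * decay_weight \<beta> (Suc k) t))"
    by (auto simp: abs_mult exp_weight_nonneg decay_weight_nonneg mult.left_commute[of 2] intro!: AE_I2 mult_left_mono)
qed measurable

lemma remainder_nonneg: "0 \<le> remainder h k s"
  unfolding remainder_def
  by (intro Bochner_Integration.integral_nonneg mult_nonneg_nonneg exp_weight_nonneg) (auto simp: decay_weight_nonneg)

lemma remainder_tendsto_0:
  assumes "k < n"
  shows "(remainder h k \<longlongrightarrow> 0) (at 0)"
proof -
  have "((\<lambda>s. LINT t|lborel. exp_weight l t * min (2 * decay_weight \<beta> (Suc k) t) (\<bar>s\<bar> * norm h * decay_weight \<beta> (Suc (Suc k)) t))
      \<longlongrightarrow> (LINT t|(lborel :: real measure). 0)) (at (0::real))"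
  proof (rule integral_dominated_convergence_at)
    show "integrable lborel (\<lambda>t. 2 * (exp_weight l t * decay_weight \<beta> (Suc k) t))"
      using assms by (intro integrable_mult_right weight_integrable l admissible) auto
    show "norm (exp_weight l t * min (2 * decay_weight \<beta> (Suc k) t) (\<bar>s\<bar> * norm h * decay_weight \<beta> (Suc (Suc k)) t))
      \<le> 2 * (exp_weight l t * decay_weight \<beta> (Suc k) t)" for s t :: real
      by (auto simp: abs_mult exp_weight_nonneg decay_weight_nonneg mult.left_commute[of 2] intro!: mult_left_mono)
    show "((\<lambda>s. exp_weight l t * min (2 * decay_weight \<beta> (Suc k) t) (\<bar>s\<bar> * norm h * decay_weight \<beta> (Suc (Suc k)) t)) \<longlongrightarrow> 0) (at (0::real))" for t :: real
    proof -
      have "((\<lambda>s. exp_weight l t * min (2 * decay_weight \<beta> (Suc k) t) (\<bar>s\<bar> * norm h * decay_weight \<beta> (Suc (Suc k)) t))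
          \<longlongrightarrow> exp_weight l t * min (2 * decay_weight \<beta> (Suc k) t) (\<bar>0\<bar> * norm h * decay_weight \<beta> (Suc (Suc k)) t)) (at (0::real))"
        by (intro tendsto_intros)
      moreover have "min (2 * decay_weight \<beta> (Suc k) t) (\<bar>0\<bar> * norm h * decay_weight \<beta> (Suc (Suc k)) t) = 0"
        using decay_weight_nonneg by (simp add: min_def order_antisym)
      ultimately show ?thesis by (simp only: mult_zero_right)
    qed
  qed measurable
  then show ?thesis by (simp add: remainder_def[abs_def])
qed

text \<open>The error splits off \<open>norm_prod hs\<close>, so it tends to 0 in the norm of forms.
  This uniformity is what Gateaux differentiability into the space of forms demands beyond
  directional derivatives of numbers.\<close>

lemma I_difference_quotient:
  assumes hs: "length hs < n" and s: "s \<noteq> 0"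
  shows "\<bar>(I hs (x + s *\<^sub>R h) - I hs x) / s - I (h # hs) x\<bar> \<le> N * norm h * remainder h (length hs) s * norm_prod hs"
proof -
  let ?k = "length hs"
  let ?q = "\<lambda>t. (D hs (x + s *\<^sub>R h) t - D hs x t) / s - D (h # hs) x t"
  have int: "integrable lborel (\<lambda>t. exp_weight l t * D hs (x + s *\<^sub>R h) t)" "integrable lborel (\<lambda>t. exp_weight l t * D hs x t)"
    "integrable lborel (\<lambda>t. exp_weight l t * D (h # hs) x t)"
    using hs by (auto intro!: D_integrable)
  have q: "\<bar>?q t\<bar> \<le> N * norm h * norm_prod hs * min (2 * decay_weight \<beta> (Suc ?k) t) (\<bar>s\<bar> * norm h * decay_weight \<beta> (Suc (Suc ?k)) t)" for t
  proof -
    obtain \<xi> where \<xi>: "\<bar>\<xi>\<bar> \<le> \<bar>s\<bar>" "D hs (x + s *\<^sub>R h) t - D hs x t = s * D (h # hs) (x + \<xi> *\<^sub>R h) t"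
      using has_dir_deriv_mvt[OF D_dir_deriv s] by blast
    have eq: "?q t = D (h # hs) (x + \<xi> *\<^sub>R h) t - D (h # hs) x t" using s by (simp add: \<xi>(2))
    have "\<bar>D (h # hs) y t\<bar> \<le> N * decay_weight \<beta> (Suc ?k) t * (norm h * norm_prod hs)" for y
      using D_bound[of "h # hs" y t] hs by simp
    from add_mono[OF this[of "x + \<xi> *\<^sub>R h"] this[of x]]
    have 1: "\<bar>?q t\<bar> \<le> N * norm h * norm_prod hs * (2 * decay_weight \<beta> (Suc ?k) t)"
      unfolding eq by (simp add: mult_ac)
    have "\<bar>D (h # hs) (x + \<xi> *\<^sub>R h) t - D (h # hs) x t\<bar> \<le> \<bar>\<xi>\<bar> * (N * decay_weight \<beta> (length (h # h # hs)) t * norm_prod (h # h # hs))"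
      using hs by (intro has_dir_deriv_increment[OF D_dir_deriv D_bound]) auto
    also have "\<dots> \<le> \<bar>s\<bar> * (N * decay_weight \<beta> (length (h # h # hs)) t * norm_prod (h # h # hs))"
      by (intro mult_right_mono \<xi> mult_nonneg_nonneg N_nonneg decay_weight_nonneg norm_prod_nonneg)
    finally have 2: "\<bar>?q t\<bar> \<le> N * norm h * norm_prod hs * (\<bar>s\<bar> * norm h * decay_weight \<beta> (Suc (Suc ?k)) t)"
      unfolding eq by (simp add: mult_ac)
    show ?thesis using 1 2 by (simp add: min_def)
  qed
  have "(I hs (x + s *\<^sub>R h) - I hs x) / s - I (h # hs) x = (LINT t|lborel. (exp_weight l t * D hs (x + s *\<^sub>R h) t - exp_weight l t * D hs x t) / s - exp_weight l t * D (h # hs) x t)"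
    unfolding I_def using int by simp
  also have "\<dots> = (LINT t|lborel. exp_weight l t * ?q t)"
    by (intro Bochner_Integration.integral_cong) (auto simp: right_diff_distrib)
  finally have eq: "(I hs (x + s *\<^sub>R h) - I hs x) / s - I (h # hs) x = (LINT t|lborel. exp_weight l t * ?q t)" .
  have "norm (LINT t|lborel. exp_weight l t * ?q t) \<le> (LINT t|lborel. N * norm h * norm_prod hs *
      (exp_weight l t * min (2 * decay_weight \<beta> (Suc ?k) t) (\<bar>s\<bar> * norm h * decay_weight \<beta> (Suc (Suc ?k)) t)))"
  proof (rule integral_norm_le)
    have "integrable lborel (\<lambda>t. (exp_weight l t * D hs (x + s *\<^sub>R h) t - exp_weight l t * D hs x t) / s - exp_weight l t * D (h # hs) x t)"
      using int by (intro Bochner_Integration.integrable_diff integrable_divide)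
    then show "integrable lborel (\<lambda>t. exp_weight l t * ?q t)"
      by (rule Bochner_Integration.integrable_cong[THEN iffD1, rotated 2]) (auto simp: right_diff_distrib)
    show "integrable lborel (\<lambda>t. N * norm h * norm_prod hs *
      (exp_weight l t * min (2 * decay_weight \<beta> (Suc ?k) t) (\<bar>s\<bar> * norm h * decay_weight \<beta> (Suc (Suc ?k)) t)))"
      by (intro integrable_mult_right remainder_integrable hs)
    fix t
    have "norm (exp_weight l t * ?q t) = exp_weight l t * \<bar>?q t\<bar>" by (simp add: abs_mult exp_weight_nonneg)
    also have "\<dots> \<le> exp_weight l t * (N * norm h * norm_prod hs * min (2 * decay_weight \<beta> (Suc ?k) t) (\<bar>s\<bar> * norm h * decay_weight \<beta> (Suc (Suc ?k)) t))"
      by (intro mult_left_mono q exp_weight_nonneg)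
    finally show "norm (exp_weight l t * ?q t) \<le> N * norm h * norm_prod hs *
      (exp_weight l t * min (2 * decay_weight \<beta> (Suc ?k) t) (\<bar>s\<bar> * norm h * decay_weight \<beta> (Suc (Suc ?k)) t))"
      by (simp only: mult.left_commute)
  qed
  also have "\<dots> = N * norm h * remainder h ?k s * norm_prod hs" by (simp add: remainder_def)
  finally show ?thesis unfolding eq by simp
qed

lemma I_dir_deriv:
  assumes hs: "length hs < n"
  shows "has_dir_deriv (I hs) h (I (h # hs))"
proof (rule has_dir_derivI)
  fix x
  have "((\<lambda>s. (I hs (x + s *\<^sub>R h) - I hs x) / s - I (h # hs) x) \<longlongrightarrow> 0) (at 0)"
  proof (rule Lim_null_comparison)
    show "\<forall>\<^sub>F s in at 0. norm ((I hs (x + s *\<^sub>R h) - I hs x) / s - I (h # hs) x) \<le> N * norm h * remainder h (length hs) s * norm_prod hs"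
      using I_difference_quotient[OF hs] by (auto simp: eventually_at intro: exI[of _ 1])
    have "((\<lambda>s. N * norm h * remainder h (length hs) s * norm_prod hs) \<longlongrightarrow> N * norm h * 0 * norm_prod hs) (at 0)"
      by (intro tendsto_intros remainder_tendsto_0 hs)
    then show "((\<lambda>s. N * norm h * remainder h (length hs) s * norm_prod hs) \<longlongrightarrow> 0) (at 0)" by simp
  qed
  then show "((\<lambda>s. (I hs (x + s *\<^sub>R h) - I hs x) / s) \<longlongrightarrow> I (h # hs) x) (at 0)"
    by (simp add: LIM_zero_iff)
qed

abbreviation u :: "'a \<Rightarrow>\<^sub>C real" where "u \<equiv> resolvent_op l f"

lemma iter_deriv_u: "length hs \<le> n \<Longrightarrow> iter_deriv (apply_bcontfun u) hs = I hs"
proof (induction hs)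
  case Nil
  have "apply_bcontfun u x = I [] x" for x
    unfolding resolvent_op_apply[OF l] resolvent_def I_def
  proof (rule integral_cong_AE)
    \<comment> \<open>The two integrands can differ at t = 0 alone, where \<open>D\<close> is 0 and
      the semigroup gives f x.\<close>
    show "AE t in lborel. exp_weight l t * P (max 0 t) (apply_bcontfun f) x = exp_weight l t * D [] x t"
      using AE_lborel_singleton[of "0::real"]
      by eventually_elim (auto simp: D_def exp_weight_def indicator_def)
    show "(\<lambda>t. exp_weight l t * P (max 0 t) (apply_bcontfun f) x) \<in> borel_measurable lborel"
      using exp_weight_P_integrable[OF l apply_bcontfun[of f], of x] by (rule borel_measurable_integrable)
  qed measurable
  then show ?case by auto
next
  case (Cons h hs)
  then show ?case using I_dir_deriv[of hs h] by (intro iter_deriv_Cons_eq) simp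
qed

lemma smooth_to_u: "smooth_to n (apply_bcontfun u)"
  unfolding smooth_to_def
proof (intro conjI allI impI)
  show "iter_deriv (apply_bcontfun u) hs \<in> bcontfun" if "length hs \<le> n" for hs
    using that by (simp add: iter_deriv_u I_bcontfun)
  show "has_dir_deriv (iter_deriv (apply_bcontfun u) hs) h (iter_deriv (apply_bcontfun u) (h # hs))" if "length hs < n" for hs h
    using that by (simp add: iter_deriv_u I_dir_deriv del: iter_deriv.simps)
qed

lemma form_norm_D_u:
  assumes "k \<le> n"
  shows "form_norm k (D_form (apply_bcontfun u) x) \<le> ennreal (N * weight_total l \<beta> k)"
  using assms I_bound by (intro form_norm_le) (auto simp: iter_deriv_u N_nonneg weight_total_nonneg)

lemma u_in_Cb: "u \<in> Cb n"
proof -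
  have "gateaux_differentiable n (apply_bcontfun u)"
    unfolding gateaux_differentiable_def
  proof (intro allI impI conjI)
    fix k x assume k: "k < n"
    show "continuous_form (Suc k) (D_form (apply_bcontfun u) x)"
      unfolding continuous_form_def
    proof (intro conjI allI impI)
      show "linear (\<lambda>h. D_form (apply_bcontfun u) x (hs[i := h]))" if "length hs = Suc k \<and> i < Suc k" for hs i
        using that k by (intro iter_deriv_linear[OF smooth_to_u]) auto
      show "form_norm (Suc k) (D_form (apply_bcontfun u) x) < \<infinity>"
        using form_norm_D_u[of "Suc k" x] k by (auto intro: le_less_trans)
    qed
    fix h
    have "((\<lambda>s. ennreal (N * norm h * remainder h k s)) \<longlongrightarrow> ennreal (N * norm h * 0)) (at 0)"
      by (intro tendsto_ennrealI tendsto_intros remainder_tendsto_0 k)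
    then have lim: "((\<lambda>s. ennreal (N * norm h * remainder h k s)) \<longlongrightarrow> 0) (at 0)" by simp
    show "((\<lambda>t. form_norm k (\<lambda>hs. (D_form (apply_bcontfun u) (x + t *\<^sub>R h) hs - D_form (apply_bcontfun u) x hs) / t
          - D_form (apply_bcontfun u) x (h # hs))) \<longlongrightarrow> 0) (at 0)"
    proof (rule tendsto_sandwich[OF _ _ tendsto_const lim])
      show "\<forall>\<^sub>F t in at 0. form_norm k (\<lambda>hs. (D_form (apply_bcontfun u) (x + t *\<^sub>R h) hs - D_form (apply_bcontfun u) x hs) / t
          - D_form (apply_bcontfun u) x (h # hs)) \<le> ennreal (N * norm h * remainder h k t)"
      proof -
        have "form_norm k (\<lambda>hs. (D_form (apply_bcontfun u) (x + t *\<^sub>R h) hs - D_form (apply_bcontfun u) x hs) / t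
          - D_form (apply_bcontfun u) x (h # hs)) \<le> ennreal (N * norm h * remainder h k t)" if "t \<noteq> 0" for t
          using k I_difference_quotient[OF _ that, of _ x h]
          by (intro form_norm_le) (auto simp: iter_deriv_u N_nonneg remainder_nonneg simp del: iter_deriv.simps)
        then show ?thesis by (auto simp: eventually_at intro: exI[of _ 1])
      qed
    qed auto
  qed
  moreover have "continuous_on UNIV (iter_deriv (apply_bcontfun u) hs) \<and> bounded (range (iter_deriv (apply_bcontfun u) hs))" if "length hs \<le> n" for hs
    using I_bcontfun[OF that] by (simp add: iter_deriv_u[OF that] bcontfun_def)
  ultimately show ?thesis by (simp add: Cb_def)
qed

lemma Cb_norm_u: "Cb_norm n u \<le> ennreal ((1 / l + (\<Sum>k=1..n. weight_total l \<beta> k)) * N)"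
proof -
  have "norm u \<le> N / l"
  proof (rule norm_bound)
    show "norm (apply_bcontfun u x) \<le> N / l" for x
      using resolvent_bcontfun(2)[OF l apply_bcontfun[of f], of N x] decay by (simp add: resolvent_op_apply[OF l] decay_def)
  qed
  then have "ennreal (norm u) \<le> ennreal (N / l)" by (rule ennreal_leI)
  moreover have "(\<Sum>k=1..n. SUP x. form_norm k (D_form (apply_bcontfun u) x)) \<le> (\<Sum>k=1..n. ennreal (N * weight_total l \<beta> k))"
    by (intro sum_mono SUP_least form_norm_D_u) auto
  moreover have "(\<Sum>k=1..n. ennreal (N * weight_total l \<beta> k)) = ennreal (\<Sum>k=1..n. N * weight_total l \<beta> k)"
    by (intro sum_ennreal) (auto simp: N_nonneg weight_total_nonneg)
  ultimately have "Cb_norm n u \<le> ennreal (N / l) + ennreal (\<Sum>k=1..n. N * weight_total l \<beta> k)"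
    unfolding Cb_norm_def by (metis add_mono)
  also have "\<dots> = ennreal (N / l + (\<Sum>k=1..n. N * weight_total l \<beta> k))"
    using l N_nonneg by (intro ennreal_plus[symmetric]) (auto intro!: sum_nonneg mult_nonneg_nonneg weight_total_nonneg)
  finally show ?thesis by (simp add: sum_distrib_left algebra_simps)
qed

section \<open>Differences of the n-th derivative\<close>

lemma D_increment_low:
  assumes "length hs = n" "t > 0" "h \<noteq> 0"
  shows "\<bar>D hs (x + h) t - D hs x t\<bar> \<le> 2 * N * norm_prod hs * (if n = 0 then norm h powr \<beta> else decay_weight \<beta> n t)"
proof (cases "n = 0")
  case True
  then have "\<bar>D hs (x + h) t - D hs x t\<bar> \<le> N * norm h powr \<beta>"
    using assms decay by (simp add: D_def decay_def)
  also have "\<dots> \<le> 2 * N * norm h powr \<beta>" using N_nonneg by (intro mult_right_mono) auto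
  finally show ?thesis using True assms by simp
next
  case False
  have "\<bar>D hs y t\<bar> \<le> N * decay_weight \<beta> n t * norm_prod hs" for y using D_bound[of hs y t] assms by simp
  from this[of "x + h"] this[of x]
  have "\<bar>D hs (x + h) t - D hs x t\<bar> \<le> 2 * (N * decay_weight \<beta> n t * norm_prod hs)" by linarith
  then show ?thesis using False by (simp add: mult_ac)
qed

lemma holder_increment:
  assumes hi: "(real (n + 1) - \<beta>) * \<theta> > 1" and hs: "length hs = n" and h: "h \<noteq> 0"
  shows "\<bar>I hs (x + h) - I hs x\<bar> \<le> 2 * split_const l \<beta> n 1 * N * norm h powr (\<beta> + 1 / \<theta> - real n) * norm_prod hs"
proof -
  let ?\<phi> = "\<lambda>t. D hs (x + h) t - D hs x t"
  have int: "integrable lborel (\<lambda>t. exp_weight l t * D hs y t)" for y using hs by (intro D_integrable) auto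
  have "\<bar>LINT t|lborel. exp_weight l t * ?\<phi> t\<bar> \<le> (2 * N * norm_prod hs) * (split_const l \<beta> n 1 * norm h powr (\<beta> + 1 / \<theta> - real n))"
  proof (rule split_bound[OF l \<beta>(2) n hi])
    show "integrable lborel (\<lambda>t. exp_weight l t * ?\<phi> t)"
      using int[of "x + h"] int[of x] by (simp add: right_diff_distrib)
    show "\<bar>?\<phi> t\<bar> \<le> 2 * N * norm_prod hs * (norm h ^ 1 * decay_weight \<beta> (n + 1) t)" for t
    proof -
      have "\<bar>?\<phi> t\<bar> \<le> 1 * (N * norm_prod hs * (norm h * decay_weight \<beta> (Suc (length hs)) t))" using hs D_increment[of hs x h t] by simp
      also have "\<dots> \<le> 2 * (N * norm_prod hs * (norm h * decay_weight \<beta> (Suc (length hs)) t))"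
        by (intro mult_right_mono mult_nonneg_nonneg N_nonneg norm_prod_nonneg decay_weight_nonneg) auto
      finally show ?thesis using hs by (simp add: mult_ac)
    qed
    show "\<bar>?\<phi> t\<bar> \<le> 2 * N * norm_prod hs * (if n = 0 then norm h powr \<beta> else decay_weight \<beta> n t)" if "t > 0" for t
      by (rule D_increment_low[OF hs that h])
  qed (use h N_nonneg in \<open>auto simp: D_def norm_prod_nonneg\<close>)
  moreover have "(LINT t|lborel. exp_weight l t * ?\<phi> t) = I hs (x + h) - I hs x"
    using int[of "x + h"] int[of x] by (simp add: I_def right_diff_distrib)
  ultimately show ?thesis by (simp add: mult_ac)
qed

lemma zygmund_increment:
  assumes hi: "(real (n + 2) - \<beta>) * \<theta> > 1" and hs: "length hs = n" and h: "h \<noteq> 0"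
  shows "\<bar>I hs (x + 2 *\<^sub>R h) - 2 * I hs (x + h) + I hs x\<bar>
    \<le> 4 * split_const l \<beta> n 2 * N * norm h powr (\<beta> + 1 / \<theta> - real n) * norm_prod hs"
proof -
  let ?\<phi> = "\<lambda>t. D hs (x + 2 *\<^sub>R h) t - 2 * D hs (x + h) t + D hs x t"
  have int: "integrable lborel (\<lambda>t. exp_weight l t * D hs y t)" for y using hs by (intro D_integrable) auto
  have eq: "exp_weight l t * ?\<phi> t = exp_weight l t * D hs (x + 2 *\<^sub>R h) t - 2 * (exp_weight l t * D hs (x + h) t) + exp_weight l t * D hs x t" for t
    by (simp add: algebra_simps)
  have "\<bar>LINT t|lborel. exp_weight l t * ?\<phi> t\<bar> \<le> (4 * N * norm_prod hs) * (split_const l \<beta> n 2 * norm h powr (\<beta> + 1 / \<theta> - real n))"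
  proof (rule split_bound[OF l \<beta>(2) n hi])
    show "integrable lborel (\<lambda>t. exp_weight l t * ?\<phi> t)"
      unfolding eq by (intro Bochner_Integration.integrable_add Bochner_Integration.integrable_diff integrable_mult_right int)
    show "\<bar>?\<phi> t\<bar> \<le> 4 * N * norm_prod hs * (norm h ^ 2 * decay_weight \<beta> (n + 2) t)" for t
    proof -
      have "\<bar>?\<phi> t\<bar> \<le> N * decay_weight \<beta> (length (h # h # hs)) t * norm_prod (h # h # hs)"
        using hs by (intro has_dir_deriv_second_difference[OF D_dir_deriv D_dir_deriv D_bound]) simp
      also have "\<dots> = 1 * (N * norm_prod hs * (norm h ^ 2 * decay_weight \<beta> (n + 2) t))" using hs by (simp add: power2_eq_square mult_ac)
      also have "\<dots> \<le> 4 * (N * norm_prod hs * (norm h ^ 2 * decay_weight \<beta> (n + 2) t))"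
        by (intro mult_right_mono mult_nonneg_nonneg N_nonneg norm_prod_nonneg decay_weight_nonneg) auto
      finally show ?thesis by (simp add: mult_ac)
    qed
    \<comment> \<open>A second difference is the difference of two first differences, each bounded
      with the factor 2.\<close>
    show "\<bar>?\<phi> t\<bar> \<le> 4 * N * norm_prod hs * (if n = 0 then norm h powr \<beta> else decay_weight \<beta> n t)" if "t > 0" for t
      using D_increment_low[OF hs that h, of x] D_increment_low[OF hs that h, of "x + h"]
      by (simp add: scaleR_2 add.assoc)
  qed (use h N_nonneg in \<open>auto simp: D_def norm_prod_nonneg\<close>)
  moreover have "(LINT t|lborel. exp_weight l t * ?\<phi> t) = I hs (x + 2 *\<^sub>R h) - 2 * I hs (x + h) + I hs x"
    unfolding eq I_def using int by (simp add: Bochner_Integration.integral_add Bochner_Integration.integral_diff)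
  ultimately show ?thesis by (simp add: mult_ac)
qed

lemma ennreal_quotient_le:
  assumes "a \<le> ennreal (c * p)" "p > 0" "c \<ge> 0"
  shows "a / ennreal p \<le> ennreal c"
proof -
  have "a / ennreal p \<le> ennreal (c * p) / ennreal p" by (rule divide_right_mono_ennreal[OF assms(1)])
  also have "\<dots> = ennreal c" using assms by (subst divide_ennreal) auto
  finally show ?thesis .
qed

lemma holder_seminorm_u:
  assumes hi: "(real (n + 1) - \<beta>) * \<theta> > 1"
  shows "holder_seminorm n (\<beta> + 1 / \<theta> - real n) (D_form (apply_bcontfun u)) \<le> ennreal (2 * split_const l \<beta> n 1 * N)"
  unfolding holder_seminorm_def
proof (intro SUP_least ennreal_quotient_le)
  fix x h :: 'a assume h: "h \<in> - {0}"
  show c: "0 \<le> 2 * split_const l \<beta> n 1 * N" using split_const_nonneg[OF n hi] N_nonneg by simp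
  show "0 < norm h powr (\<beta> + 1 / \<theta> - real n)" using h by simp
  show "form_norm n (\<lambda>hs. D_form (apply_bcontfun u) (x + h) hs - D_form (apply_bcontfun u) x hs)
      \<le> ennreal (2 * split_const l \<beta> n 1 * N * norm h powr (\<beta> + 1 / \<theta> - real n))"
    using holder_increment[OF hi _, of _ h x] h c by (intro form_norm_le) (auto simp: iter_deriv_u)
qed

text \<open>In this case order n + 1 has the exponent (n + 1 - \<beta>) \<theta> = 1 and its
  integral diverges logarithmically, whereas order n + 2 has exponent 1 + \<theta>. The power of
  norm h delivered by the split is then exactly 1.\<close>

lemma zygmund_seminorm_u:
  assumes s: "\<beta> + 1 / \<theta> = real (Suc n)"
  shows "zygmund_seminorm n (D_form (apply_bcontfun u)) \<le> ennreal (4 * split_const l \<beta> n 2 * N)"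
  unfolding zygmund_seminorm_def
proof (intro SUP_least ennreal_quotient_le)
  have "(real (n + 2) - \<beta>) * \<theta> = 1 + \<theta>" using s \<theta> by (simp add: field_simps)
  then have hi: "(real (n + 2) - \<beta>) * \<theta> > 1" using \<theta> by simp
  fix x h :: 'a assume h: "h \<in> - {0}"
  show c: "0 \<le> 4 * split_const l \<beta> n 2 * N" using split_const_nonneg[OF n hi] N_nonneg by simp
  show "0 < norm h" using h by simp
  have "norm h powr (\<beta> + 1 / \<theta> - real n) = norm h" using s h by simp
  then show "form_norm n (\<lambda>hs. D_form (apply_bcontfun u) (x + 2 *\<^sub>R h) hs - 2 * D_form (apply_bcontfun u) (x + h) hs + D_form (apply_bcontfun u) x hs)
      \<le> ennreal (4 * split_const l \<beta> n 2 * N * norm h)"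
    using zygmund_increment[OF hi _, of _ h x] h c by (intro form_norm_le) (auto simp: iter_deriv_u)
qed

end

section \<open>Assembly of the Hoelder and Zygmund estimates\<close>

context ou_smoothing
begin

text \<open>With \<open>n\<close> the integer part, a noninteger \<beta> + 1/\<theta> lies strictly
  between n and n + 1, which is the same as 1 lying strictly between the exponents (n - \<beta>)
  \<theta> and (n + 1 - \<beta>) \<theta>.\<close>

lemma resolvent_holder:
  assumes l: "l > 0" and \<beta>: "0 \<le> \<beta>" "\<beta> < 1" and s: "\<beta> + 1 / \<theta> \<notin> \<nat>"
  shows "\<exists>C>0. \<forall>f N. decay (nat \<lfloor>\<beta> + 1 / \<theta>\<rfloor> + 2) \<beta> (apply_bcontfun f) N \<longrightarrow>
    resolvent_op l f \<in> Holder (\<beta> + 1 / \<theta>) \<and> Holder_norm (\<beta> + 1 / \<theta>) (resolvent_op l f) \<le> ennreal (C * N)"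
proof -
  define n where "n = nat \<lfloor>\<beta> + 1 / \<theta>\<rfloor>"
  have s0: "\<beta> + 1 / \<theta> > 0" using \<beta> \<theta> by (simp add: add_nonneg_pos)
  then have fl: "real n = of_int \<lfloor>\<beta> + 1 / \<theta>\<rfloor>" by (simp add: n_def)
  have "real n \<le> \<beta> + 1 / \<theta>" "\<beta> + 1 / \<theta> < real n + 1" unfolding fl by linarith+
  moreover have "real n \<noteq> \<beta> + 1 / \<theta>" using s by (metis of_nat_in_Nats)
  ultimately have "real n - \<beta> < 1 / \<theta>" "1 / \<theta> < real (n + 1) - \<beta>" by auto
  then have adm: "(real n - \<beta>) * \<theta> < 1" "(real (n + 1) - \<beta>) * \<theta> > 1"
    using \<theta> by (simp_all add: pos_less_divide_eq pos_divide_less_eq)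
  have fr: "frac (\<beta> + 1 / \<theta>) = \<beta> + 1 / \<theta> - real n" by (simp add: frac_def fl)
  define A where "A = 1 / l + (\<Sum>k=1..n. weight_total l \<beta> k)"
  define B where "B = 2 * split_const l \<beta> n 1"
  have A: "A > 0" using l by (auto simp: A_def intro!: add_pos_nonneg sum_nonneg weight_total_nonneg)
  have B: "B \<ge> 0" using split_const_nonneg[OF adm] by (simp add: B_def)
  show ?thesis
  proof (intro exI[of _ "A + B"] conjI allI impI)
    fix f N assume "decay (nat \<lfloor>\<beta> + 1 / \<theta>\<rfloor> + 2) \<beta> (apply_bcontfun f) N"
    then interpret resolvent_regularity T Q \<theta> \<Gamma> l \<beta> N n f
      using l \<beta> adm(1) by unfold_locales (auto simp: n_def)
    have semi: "holder_seminorm n (\<beta> + 1 / \<theta> - real n) (D_form (apply_bcontfun u)) \<le> ennreal (B * N)"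
      using holder_seminorm_u[OF adm(2)] by (simp add: B_def)
    then show "u \<in> Holder (\<beta> + 1 / \<theta>)"
      unfolding Holder_def n_def[symmetric] fr using u_in_Cb by (auto intro: le_less_trans)
    have "Holder_norm (\<beta> + 1 / \<theta>) u \<le> ennreal (A * N) + ennreal (B * N)"
      unfolding Holder_norm_def n_def[symmetric] fr A_def by (intro add_mono Cb_norm_u semi)
    also have "\<dots> = ennreal ((A + B) * N)"
      using A B N_nonneg by (simp add: distrib_right flip: ennreal_plus)
    finally show "Holder_norm (\<beta> + 1 / \<theta>) u \<le> ennreal ((A + B) * N)" .
  qed (use A B in auto)
qed

lemma resolvent_zygmund:
  assumes l: "l > 0" and \<beta>: "0 \<le> \<beta>" "\<beta> < 1" and s: "\<beta> + 1 / \<theta> = real m"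
  shows "\<exists>C>0. \<forall>f N. decay (m + 1) \<beta> (apply_bcontfun f) N \<longrightarrow>
    resolvent_op l f \<in> Zygmund m \<and> Zygmund_norm m (resolvent_op l f) \<le> ennreal (C * N)"
proof -
  have "real m > 0" unfolding s[symmetric] using \<beta> \<theta> by (simp add: add_nonneg_pos)
  \<comment> \<open>The Zygmund space of order m = n + 1 speaks about the derivative of order
    \<open>n\<close>, the last one whose time integral converges.\<close>
  then obtain n where m: "m = Suc n" by (cases m) auto
  have "real n - \<beta> < 1 / \<theta>" using s m by simp
  then have n: "(real n - \<beta>) * \<theta> < 1" using \<theta> by (simp add: pos_less_divide_eq)
  have "(real (n + 2) - \<beta>) * \<theta> = 1 + \<theta>" using s m \<theta> by (simp add: field_simps)
  then have n2: "(real (n + 2) - \<beta>) * \<theta> > 1" using \<theta> by simp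
  define A where "A = 1 / l + (\<Sum>k=1..n. weight_total l \<beta> k)"
  define B where "B = 4 * split_const l \<beta> n 2"
  have A: "A > 0" using l by (auto simp: A_def intro!: add_pos_nonneg sum_nonneg weight_total_nonneg)
  have B: "B \<ge> 0" using split_const_nonneg[OF n n2] by (simp add: B_def)
  show ?thesis
  proof (intro exI[of _ "A + B"] conjI allI impI)
    fix f N assume "decay (m + 1) \<beta> (apply_bcontfun f) N"
    then interpret resolvent_regularity T Q \<theta> \<Gamma> l \<beta> N n f
      using l \<beta> n by unfold_locales (auto simp: m)
    have semi: "zygmund_seminorm n (D_form (apply_bcontfun u)) \<le> ennreal (B * N)"
      using zygmund_seminorm_u s m by (simp add: B_def)
    then show "u \<in> Zygmund m"
      unfolding Zygmund_def using u_in_Cb by (auto simp: m intro: le_less_trans)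
    have "Zygmund_norm m u \<le> ennreal (A * N) + ennreal (B * N)"
      unfolding Zygmund_norm_def A_def using add_mono[OF Cb_norm_u semi] by (simp add: m)
    also have "\<dots> = ennreal ((A + B) * N)"
      using A B N_nonneg by (simp add: distrib_right flip: ennreal_plus)
    finally show "Zygmund_norm m u \<le> ennreal ((A + B) * N)" .
  qed (use A B in auto)
qed

lemma decay_norm:
  "\<exists>C>0. \<forall>f. decay K 0 (apply_bcontfun f) (C * norm f)"
proof -
  obtain C where C: "C > 0" "\<forall>f B. f \<in> bcontfun \<longrightarrow> (\<forall>x. \<bar>f x\<bar> \<le> B) \<longrightarrow> decay K 0 f (C * B)"
    using decay_bounded[of K] by (elim exE conjE)
  have "decay K 0 (apply_bcontfun f) (C * norm f)" for f
    by (rule C(2)[rule_format, OF apply_bcontfun]) (metis norm_bounded real_norm_def)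
  then show ?thesis using C(1) by blast
qed

text \<open>The full Hoelder norm, converted to a real number, serves both as sup bound and as
  Hoelder constant, so one \<open>N\<close> meets the hypotheses of
  \<open>decay_holder\<close>.\<close>

lemma Holder_decay:
  assumes \<alpha>: "0 < \<alpha>" "\<alpha> < 1"
  shows "\<exists>C>0. \<forall>f\<in>Holder \<alpha>. \<exists>N\<ge>0. Holder_norm \<alpha> f = ennreal N \<and> decay K \<alpha> (apply_bcontfun f) (C * N)"
proof -
  obtain C where C: "C > 0" "\<forall>f N. f \<in> bcontfun \<longrightarrow> (\<forall>x. \<bar>f x\<bar> \<le> N) \<longrightarrow>
    (\<forall>x h. h \<noteq> 0 \<longrightarrow> \<bar>f (x + h) - f x\<bar> \<le> N * norm h powr \<alpha>) \<longrightarrow> decay K \<alpha> f (C * N)"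
    using decay_holder[OF \<alpha>, of K] by (elim exE conjE)
  have \<alpha>0: "nat \<lfloor>\<alpha>\<rfloor> = 0" "frac \<alpha> = \<alpha>" using \<alpha> by (auto simp: floor_eq_iff frac_eq)
  have "\<exists>N\<ge>0. Holder_norm \<alpha> f = ennreal N \<and> decay K \<alpha> (apply_bcontfun f) (C * N)" if f: "f \<in> Holder \<alpha>" for f :: "'a \<Rightarrow>\<^sub>C real"
  proof -
    define H where "H = holder_seminorm 0 \<alpha> (D_form (apply_bcontfun f))"
    have H: "H < \<infinity>" using f by (simp add: Holder_def \<alpha>0 H_def)
    have Hn: "Holder_norm \<alpha> f = ennreal (norm f) + H" by (simp add: Holder_norm_def Cb_norm_def \<alpha>0 H_def)
    define N where "N = enn2real (Holder_norm \<alpha> f)"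
    have N: "Holder_norm \<alpha> f = ennreal N" using H by (simp add: N_def Hn)
    have N0: "N \<ge> 0" by (simp add: N_def)
    have "ennreal (norm f) \<le> ennreal N" "H \<le> ennreal N" unfolding N[symmetric] Hn by auto
    then have nf: "norm f \<le> N" and HN: "H \<le> ennreal N" using N0 by auto
    have "decay K \<alpha> (apply_bcontfun f) (C * N)"
    proof (rule C(2)[rule_format, OF apply_bcontfun])
      show "\<bar>apply_bcontfun f x\<bar> \<le> N" for x using order_trans[OF norm_bounded nf, of x] by simp
    next
      show "\<bar>apply_bcontfun f (x + h) - apply_bcontfun f x\<bar> \<le> N * norm h powr \<alpha>" if h: "h \<noteq> 0" for x h
      proof -
        let ?d = "\<bar>apply_bcontfun f (x + h) - apply_bcontfun f x\<bar>"
        have p: "norm h powr \<alpha> > 0" using h by simp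
        have "form_norm 0 (\<lambda>hs. D_form (apply_bcontfun f) (x + h) hs - D_form (apply_bcontfun f) x hs) = ennreal ?d"
          by (simp add: form_norm_def)
        moreover have "form_norm 0 (\<lambda>hs. D_form (apply_bcontfun f) (x + h) hs - D_form (apply_bcontfun f) x hs) / ennreal (norm h powr \<alpha>) \<le> H"
          unfolding H_def holder_seminorm_def using h by (intro SUP_upper2[of x] SUP_upper2[of h]) auto
        ultimately have "ennreal ?d / ennreal (norm h powr \<alpha>) \<le> ennreal N" using HN by simp
        then have "ennreal (?d / norm h powr \<alpha>) \<le> ennreal N" using p by (simp add: divide_ennreal)
        then have "?d / norm h powr \<alpha> \<le> N" using N0 by simp
        then show ?thesis using p by (simp add: pos_divide_le_eq)
      qed
    qed
    then show ?thesis using N N0 by blast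
  qed
  then show ?thesis using C(1) by blast
qed

end

lemma ou_smoothing_from_assumptions:
  assumes A1: "assumption_A1 D A T Q" and A2: "assumption_A2 T Q \<theta>"
  obtains \<Gamma> where "ou_smoothing T Q \<theta> \<Gamma>"
proof -
  obtain \<omega> C where C: "C > 0" and bl: "\<And>t. t > 0 \<Longrightarrow> bounded_linear (\<lambda>x. pseudo_inverse (op_sqrt (Q_op T Q t)) (T t x))"
    and on: "\<And>t. t > 0 \<Longrightarrow> onorm (\<lambda>x. pseudo_inverse (op_sqrt (Q_op T Q t)) (T t x)) \<le> C * exp (\<omega> * t) * t powr (- \<theta>)"
    using A2 unfolding assumption_A2_def by blast
  have \<theta>: "\<theta> > 0" using A2 by (simp add: assumption_A2_def)
  interpret ornstein_uhlenbeck T Q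
    using A1 by unfold_locales (auto simp: assumption_A1_def)
  \<comment> \<open>On (0,1] the factor exp (\<omega> t) is at most exp (abs \<omega>), whatever the
    sign of \<omega>; the witness \<open>z\<close> is the value of the pseudo-inverse.\<close>
  have "ou_smoothing T Q \<theta> (C * exp \<bar>\<omega>\<bar>)"
  proof unfold_locales
    fix t :: real and h assume t: "0 < t" "t \<le> 1"
    let ?R = "op_sqrt (Q_op T Q t)"
    let ?z = "pseudo_inverse ?R (T t h)"
    have "bounded_linear ?R"
      using t by (intro op_sqrt_props Q_op_bounded_linear Q_op_selfadjoint Q_op_nonneg) auto
    moreover have "T t h \<in> range ?R" using A1 t unfolding assumption_A1_def by blast
    ultimately have "?R ?z = T t h" by (rule pseudo_inverse_right)
    moreover have "norm ?z \<le> C * exp \<bar>\<omega>\<bar> * t powr (- \<theta>) * norm h"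
    proof -
      have "norm ?z \<le> onorm (\<lambda>x. pseudo_inverse ?R (T t x)) * norm h"
        by (rule onorm[OF bl[OF t(1)]])
      also have "\<dots> \<le> (C * exp (\<omega> * t) * t powr (- \<theta>)) * norm h"
        by (intro mult_right_mono on t) auto
      also have "\<dots> \<le> C * exp \<bar>\<omega>\<bar> * t powr (- \<theta>) * norm h"
      proof -
        have "\<omega> * t \<le> \<bar>\<omega>\<bar> * 1" using t by (intro order_trans[OF mult_right_mono[OF abs_ge_self] mult_left_mono]) auto
        then show ?thesis using C by (intro mult_right_mono mult_left_mono) auto
      qed
      finally show ?thesis .
    qed
    ultimately show "\<exists>z. ?R z = T t h \<and> norm z \<le> C * exp \<bar>\<omega>\<bar> * t powr (- \<theta>) * norm h" by blast
  qed (use C \<theta> in auto)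
  then show ?thesis by (rule that)
qed

theorem theorem5p2:
  fixes D :: "'a::{real_inner,banach,second_countable_topology} set"
    and A :: "'a \<Rightarrow> 'a"
    and T :: "real \<Rightarrow> 'a \<Rightarrow>\<^sub>L 'a"
    and Q :: "'a \<Rightarrow>\<^sub>L 'a"
    and \<theta> lam :: real
  assumes "assumption_A1 D A T Q" and "assumption_A2 T Q \<theta>" and "lam > 0"
  shows
    "(1 / \<theta> \<notin> \<nat> \<longrightarrow>
       (\<exists>C>0. \<forall>f. \<exists>u. solves (ou_generator T Q) lam f u \<and>
          (\<forall>v. solves (ou_generator T Q) lam f v \<longrightarrow> v = u) \<and>
          u \<in> Holder (1 / \<theta>) \<and> Holder_norm (1 / \<theta>) u \<le> ennreal (C * norm f)))
     \<and>
     (\<forall>m::nat. 1 / \<theta> = real m \<longrightarrow>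
       (\<exists>C>0. \<forall>f. \<exists>u. solves (ou_generator T Q) lam f u \<and>
          (\<forall>v. solves (ou_generator T Q) lam f v \<longrightarrow> v = u) \<and>
          u \<in> Zygmund m \<and> Zygmund_norm m u \<le> ennreal (C * norm f)))
     \<and>
     (\<forall>\<alpha>. 0 < \<alpha> \<and> \<alpha> < 1 \<and> \<alpha> + 1 / \<theta> \<notin> \<nat> \<longrightarrow>
       (\<exists>C>0. \<forall>f \<in> Holder \<alpha>. \<forall>u. solves (ou_generator T Q) lam f u \<longrightarrow>
          u \<in> Holder (\<alpha> + 1 / \<theta>) \<and>
          Holder_norm (\<alpha> + 1 / \<theta>) u \<le> ennreal C * Holder_norm \<alpha> f))
     \<and>
     (\<forall>\<alpha>. \<forall>k::nat. 0 < \<alpha> \<and> \<alpha> < 1 \<and> \<alpha> + 1 / \<theta> = real k \<longrightarrow>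
       (\<exists>C>0. \<forall>f \<in> Holder \<alpha>. \<forall>u. solves (ou_generator T Q) lam f u \<longrightarrow>
          u \<in> Zygmund k \<and> Zygmund_norm k u \<le> ennreal C * Holder_norm \<alpha> f))"
proof -
  obtain \<Gamma> where "ou_smoothing T Q \<theta> \<Gamma>"
    using ou_smoothing_from_assumptions[OF assms(1,2)] by blast
  then interpret ou_smoothing T Q \<theta> \<Gamma> .
  \<comment> \<open>Every solution is \<open>resolvent_op lam f\<close>, so all four claims become
    statements about this operator. The first two use \<beta> = 0 with the sup norm of
    \<open>f\<close>, the last two \<beta> = \<alpha> with its Hoelder norm.\<close>
  note sol = solves_iff[OF assms(3)]
  have hol: "\<exists>C>0. \<forall>f. resolvent_op lam f \<in> Holder (1 / \<theta>) \<and> Holder_norm (1 / \<theta>) (resolvent_op lam f) \<le> ennreal (C * norm f)"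
    if s: "1 / \<theta> \<notin> \<nat>"
  proof -
    obtain C where C: "C > 0" "\<And>f N. decay (nat \<lfloor>1 / \<theta>\<rfloor> + 2) 0 (apply_bcontfun f) N \<Longrightarrow>
      resolvent_op lam f \<in> Holder (1 / \<theta>) \<and> Holder_norm (1 / \<theta>) (resolvent_op lam f) \<le> ennreal (C * N)"
      using resolvent_holder[OF assms(3), of 0, simplified, OF s] by auto
    obtain C' where C': "C' > 0" "\<And>f. decay (nat \<lfloor>1 / \<theta>\<rfloor> + 2) 0 (apply_bcontfun f) (C' * norm f)"
      using decay_norm by blast
    show ?thesis using C(1) C'(1) C(2)[OF C'(2)] by (intro exI[of _ "C * C'"]) (auto simp: mult.assoc)
  qed
  have zyg: "\<exists>C>0. \<forall>f. resolvent_op lam f \<in> Zygmund m \<and> Zygmund_norm m (resolvent_op lam f) \<le> ennreal (C * norm f)"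
    if s: "1 / \<theta> = real m" for m
  proof -
    obtain C where C: "C > 0" "\<And>f N. decay (m + 1) 0 (apply_bcontfun f) N \<Longrightarrow>
      resolvent_op lam f \<in> Zygmund m \<and> Zygmund_norm m (resolvent_op lam f) \<le> ennreal (C * N)"
      using resolvent_zygmund[OF assms(3), of 0 m, simplified, OF s] by auto
    obtain C' where C': "C' > 0" "\<And>f. decay (m + 1) 0 (apply_bcontfun f) (C' * norm f)"
      using decay_norm by blast
    show ?thesis using C(1) C'(1) C(2)[OF C'(2)] by (intro exI[of _ "C * C'"]) (auto simp: mult.assoc)
  qed
  have hol': "\<exists>C>0. \<forall>f\<in>Holder \<alpha>. resolvent_op lam f \<in> Holder (\<alpha> + 1 / \<theta>) \<and>
      Holder_norm (\<alpha> + 1 / \<theta>) (resolvent_op lam f) \<le> ennreal C * Holder_norm \<alpha> f"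
    if \<alpha>: "0 < \<alpha>" "\<alpha> < 1" and s: "\<alpha> + 1 / \<theta> \<notin> \<nat>" for \<alpha>
  proof -
    let ?K = "nat \<lfloor>\<alpha> + 1 / \<theta>\<rfloor> + 2"
    obtain C where C: "C > 0" "\<And>f N. decay ?K \<alpha> (apply_bcontfun f) N \<Longrightarrow>
      resolvent_op lam f \<in> Holder (\<alpha> + 1 / \<theta>) \<and> Holder_norm (\<alpha> + 1 / \<theta>) (resolvent_op lam f) \<le> ennreal (C * N)"
      using resolvent_holder[OF assms(3) less_imp_le[OF \<alpha>(1)] \<alpha>(2) s] by blast
    obtain C' where C': "C' > 0" "\<And>f. f \<in> Holder \<alpha> \<Longrightarrow> \<exists>N\<ge>0. Holder_norm \<alpha> f = ennreal N \<and> decay ?K \<alpha> (apply_bcontfun f) (C' * N)"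
      using Holder_decay[OF \<alpha>] by blast
    show ?thesis
    proof (intro exI[of _ "C * C'"] conjI ballI)
      fix f :: "'a \<Rightarrow>\<^sub>C real" assume "f \<in> Holder \<alpha>"
      then obtain N where N: "N \<ge> 0" "Holder_norm \<alpha> f = ennreal N" "decay ?K \<alpha> (apply_bcontfun f) (C' * N)"
        using C'(2) by blast
      show "resolvent_op lam f \<in> Holder (\<alpha> + 1 / \<theta>)" using C(2)[OF N(3)] by blast
      show "Holder_norm (\<alpha> + 1 / \<theta>) (resolvent_op lam f) \<le> ennreal (C * C') * Holder_norm \<alpha> f"
        using C(2)[OF N(3)] C(1) C'(1) N by (simp add: mult.assoc flip: ennreal_mult)
    qed (use C C' in auto)
  qed
  have zyg': "\<exists>C>0. \<forall>f\<in>Holder \<alpha>. resolvent_op lam f \<in> Zygmund k \<and>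
      Zygmund_norm k (resolvent_op lam f) \<le> ennreal C * Holder_norm \<alpha> f"
    if \<alpha>: "0 < \<alpha>" "\<alpha> < 1" and s: "\<alpha> + 1 / \<theta> = real k" for \<alpha> k
  proof -
    obtain C where C: "C > 0" "\<And>f N. decay (k + 1) \<alpha> (apply_bcontfun f) N \<Longrightarrow>
      resolvent_op lam f \<in> Zygmund k \<and> Zygmund_norm k (resolvent_op lam f) \<le> ennreal (C * N)"
      using resolvent_zygmund[OF assms(3) less_imp_le[OF \<alpha>(1)] \<alpha>(2) s] by blast
    obtain C' where C': "C' > 0" "\<And>f. f \<in> Holder \<alpha> \<Longrightarrow> \<exists>N\<ge>0. Holder_norm \<alpha> f = ennreal N \<and> decay (k + 1) \<alpha> (apply_bcontfun f) (C' * N)"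
      using Holder_decay[OF \<alpha>] by blast
    show ?thesis
    proof (intro exI[of _ "C * C'"] conjI ballI)
      fix f :: "'a \<Rightarrow>\<^sub>C real" assume "f \<in> Holder \<alpha>"
      then obtain N where N: "N \<ge> 0" "Holder_norm \<alpha> f = ennreal N" "decay (k + 1) \<alpha> (apply_bcontfun f) (C' * N)"
        using C'(2) by blast
      show "resolvent_op lam f \<in> Zygmund k" using C(2)[OF N(3)] by blast
      show "Zygmund_norm k (resolvent_op lam f) \<le> ennreal (C * C') * Holder_norm \<alpha> f"
        using C(2)[OF N(3)] C(1) C'(1) N by (simp add: mult.assoc flip: ennreal_mult)
    qed (use C C' in auto)
  qed
  show ?thesis
    unfolding sol
  proof (intro conjI allI impI, goal_cases)
    case 1
    then show ?case using hol by simp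
  next
    case (2 m)
    then show ?case using zyg[of m] by simp
  next
    case (3 \<alpha>)
    then show ?case using hol'[of \<alpha>] by simp
  next
    case (4 \<alpha> k)
    then show ?case using zyg'[of \<alpha> k] by simp
  qed
qed

end
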